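(* Let $G$ be the free product of at most countably many countably infinite abelian groups. Then for every $\alpha \in \mathit{FR}(G,X,\mu)$, the orbit equivalence class $[\alpha]_{\mathit{OE}}$ is dense in $A(G,X,\mu)$ with respect to the weak topology.
   Context: $(X,\mu)$ is a non-atomic standard probability space. $\mathrm{Aut}(X,\mu)$ is the group of measure-preserving Borel automorphisms of $(X,\mu)$, identified when they agree $\mu$-a.e. Its weak topology is generated by the sets $\{R \in \mathrm{Aut}(X,\mu) : \mu(R(P)\,\triangle\, S(P))<\varepsilon \text{ for all } P\in\mathcal P\}$, where $S\in\mathrm{Aut}(X,\mu)$, $\varepsilon>0$ and $\mathcal P$ is a finite Borel partition of $X$. For a countable group $G$, $A(G,X,\mu)$ is the set of homomorphisms $\alpha: G\to \mathrm{Aut}(X,\mu)$ (p.m.p. actions); write $g^\alpha=\alpha(g)$. It carries the subspace topology of $\prod_G \mathrm{Aut}(X,\mu)$ with the product of weak topologies. $\mathit{FR}(G,X,\mu)\subset A(G,X,\mu)$ is the set of essentially free actions. Two actions $\alpha,\beta\in A(G,X,\mu)$ are orbit equivalent if there is $R\in\mathrm{Aut}(X,\mu)$ with $G^\alpha x = R G^\beta R^{-1}x$ for $\mu$-a.e. $x$; $[\alpha]_{\mathit{OE}}$ is the set of actions in $A(G,X,\mu)$ orbit equivalent to $\alpha$. *)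

theory Defs
  imports "HOL-Probability.Probability_Measure" "HOL-Algebra.Generated_Groups"
begin

text \<open>A standard probability space: the Borel sigma-algebra of a Polish space
  (every standard Borel space is Borel isomorphic to one), with a probability measure.
  Non-atomic: every set of positive measure contains a set of strictly smaller positive measure.\<close>

definition std_nonatomic_prob :: "'a::polish_space measure \<Rightarrow> bool" where
  "std_nonatomic_prob M \<longleftrightarrow>
     sets M = sets borel \<and> prob_space M \<and>
     (\<forall>A\<in>sets M. measure M A > 0 \<longrightarrow>
        (\<exists>B\<in>sets M. B \<subseteq> A \<and> 0 < measure M B \<and> measure M B < measure M A))"

text \<open>Measure-preserving Borel automorphisms (elements are functions; the identification
  of a.e. equal maps is built into all the notions below, which are a.e.-invariant).\<close>

definition Aut :: "'a measure \<Rightarrow> ('a \<Rightarrow> 'a) set" where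
  "Aut M = {T. bij_betw T (space M) (space M) \<and> T \<in> M \<rightarrow>\<^sub>M M \<and>
              the_inv_into (space M) T \<in> M \<rightarrow>\<^sub>M M \<and> distr M M T = M}"

definition finite_borel_partition :: "'a measure \<Rightarrow> 'a set set \<Rightarrow> bool" where
  "finite_borel_partition M P \<longleftrightarrow> finite P \<and> P \<subseteq> sets M \<and> \<Union>P = space M \<and>
     (\<forall>p\<in>P. \<forall>q\<in>P. p \<noteq> q \<longrightarrow> p \<inter> q = {})"

definition weak_nbhd :: "'a measure \<Rightarrow> ('a \<Rightarrow> 'a) \<Rightarrow> real \<Rightarrow> 'a set set \<Rightarrow> ('a \<Rightarrow> 'a) set" where
  "weak_nbhd M S \<epsilon> P = {R \<in> Aut M. \<forall>p\<in>P. measure M ((R ` p - S ` p) \<union> (S ` p - R ` p)) < \<epsilon>}"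

definition weak_topology :: "'a measure \<Rightarrow> ('a \<Rightarrow> 'a) topology" where
  "weak_topology M = topology_generated_by
     {weak_nbhd M S \<epsilon> P | S \<epsilon> P. S \<in> Aut M \<and> \<epsilon> > 0 \<and> finite_borel_partition M P}"

text \<open>A(G,X,mu): homomorphisms G \<rightarrow> Aut(X,mu), where Aut is taken modulo a.e. equality,
  i.e. the homomorphism law holds almost everywhere. Functions are extensional
  (undefined outside the carrier) so that A(G,X,mu) lives in the product space.\<close>

definition actions :: "('g, 'b) monoid_scheme \<Rightarrow> 'a measure \<Rightarrow> ('g \<Rightarrow> 'a \<Rightarrow> 'a) set" where
  "actions G M = {\<alpha>. \<alpha> \<in> extensional (carrier G) \<and> (\<forall>g\<in>carrier G. \<alpha> g \<in> Aut M) \<and>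
      (\<forall>g\<in>carrier G. \<forall>h\<in>carrier G. AE x in M. \<alpha> (g \<otimes>\<^bsub>G\<^esub> h) x = \<alpha> g (\<alpha> h x))}"

definition actions_topology :: "('g, 'b) monoid_scheme \<Rightarrow> 'a measure \<Rightarrow> ('g \<Rightarrow> 'a \<Rightarrow> 'a) topology" where
  "actions_topology G M =
     subtopology (product_topology (\<lambda>_. weak_topology M) (carrier G)) (actions G M)"

definition essentially_free :: "('g, 'b) monoid_scheme \<Rightarrow> 'a measure \<Rightarrow> ('g \<Rightarrow> 'a \<Rightarrow> 'a) \<Rightarrow> bool" where
  "essentially_free G M \<alpha> \<longleftrightarrow>
     (\<forall>g\<in>carrier G. g \<noteq> \<one>\<^bsub>G\<^esub> \<longrightarrow> (AE x in M. \<alpha> g x \<noteq> x))"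

definition free_actions :: "('g, 'b) monoid_scheme \<Rightarrow> 'a measure \<Rightarrow> ('g \<Rightarrow> 'a \<Rightarrow> 'a) set" where
  "free_actions G M = {\<alpha> \<in> actions G M. essentially_free G M \<alpha>}"

definition orbit_equivalent ::
  "('g, 'b) monoid_scheme \<Rightarrow> 'a measure \<Rightarrow> ('g \<Rightarrow> 'a \<Rightarrow> 'a) \<Rightarrow> ('g \<Rightarrow> 'a \<Rightarrow> 'a) \<Rightarrow> bool" where
  "orbit_equivalent G M \<alpha> \<beta> \<longleftrightarrow>
     (\<exists>R\<in>Aut M. AE x in M.
        (\<lambda>g. \<alpha> g x) ` carrier G =
        (\<lambda>g. R (\<beta> g (the_inv_into (space M) R x))) ` carrier G)"

definition OE_class :: "('g, 'b) monoid_scheme \<Rightarrow> 'a measure \<Rightarrow> ('g \<Rightarrow> 'a \<Rightarrow> 'a) \<Rightarrow> ('g \<Rightarrow> 'a \<Rightarrow> 'a) set" where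
  "OE_class G M \<alpha> = {\<beta> \<in> actions G M. orbit_equivalent G M \<alpha> \<beta>}"

definition reduced_word :: "('g, 'b) monoid_scheme \<Rightarrow> 'i set \<Rightarrow> ('i \<Rightarrow> 'g set) \<Rightarrow> ('i \<times> 'g) list \<Rightarrow> bool" where
  "reduced_word G I H w \<longleftrightarrow>
     (\<forall>(i, h)\<in>set w. i \<in> I \<and> h \<in> H i \<and> h \<noteq> \<one>\<^bsub>G\<^esub>) \<and>
     (\<forall>k. Suc k < length w \<longrightarrow> fst (w ! k) \<noteq> fst (w ! Suc k))"

definition word_eval :: "('g, 'b) monoid_scheme \<Rightarrow> ('i \<times> 'g) list \<Rightarrow> 'g" where
  "word_eval G w = foldr (\<lambda>h y. h \<otimes>\<^bsub>G\<^esub> y) (map snd w) \<one>\<^bsub>G\<^esub>"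

definition is_free_product :: "('g, 'b) monoid_scheme \<Rightarrow> 'i set \<Rightarrow> ('i \<Rightarrow> 'g set) \<Rightarrow> bool" where
  "is_free_product G I H \<longleftrightarrow>
     (\<forall>i\<in>I. subgroup (H i) G) \<and>
     generate G (\<Union>i\<in>I. H i) = carrier G \<and>
     (\<forall>w. reduced_word G I H w \<and> w \<noteq> [] \<longrightarrow> word_eval G w \<noteq> \<one>\<^bsub>G\<^esub>)"

end

(* If S and R_i are automorphisms of the space such that R_i moves every point inside its
   alpha(H_i)-orbit, then h |-> S R_i^-1 alpha(h) R_i S^-1 on H_i extends to G by freeness of
   the product, and the extension has the orbits of S alpha S^-1. So it suffices to choose S and R_i such
   that a given finite partition P has almost the statistics that it has under beta.

   An averaging argument yields, for each i, a labelling phi_i whose statistics under alpha(H_i) are those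
   of P under beta(H_i): every x picks a centre in its Folner window (the point whose piece in a fine
   partition has the smallest random rank, so that x and h x usually pick the same centre), and the
   piece of the centre carries an independent random point y which decides the label of x as that of a
   beta-translate of y. The labels are independent along sparse subsets of H_i, so an L2 bound makes phi_i
   nearly independent of all H_i-invariant sets, uniformly in these sets. The same holds for one random
   labelling q which serves all i. A greedy matching along the orbits of H_i then moves q to
   phi_i by some R_i, and nonatomicity gives S which moves P to q. *)

theory Submission
  imports Defs "HOL-Probability.Distribution_Functions" "HOL-Combinatorics.Permutations"
begin

text \<open>An essentially free action need not be ergodic on any H_i. A matching inside the
  H_i-orbits therefore cannot rely on equal total measures of the labels: they have to balance on
  every H_i-invariant set, and the set on which a greedy matching gets stuck is known only after
  phi_i and q are. Hence near independence is needed uniformly in the invariant sets; q and phi_i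
  then both give label j almost the share of each such set that P gives it in the whole space.
  Uniformity is possible because the integral over an invariant set Z can be averaged over many
  translates first, after which Z enters only through its indicator being at most 1. The labelling q
  stands between P and the phi_i because S is one map for all factors, whereas R_i may move points
  in H_i-orbits only. Commutativity gives Folner sets through polynomial growth, infinite factors
  give arbitrarily many sparse translates, and freeness lets a fine partition separate the points of
  a finite part of an orbit.\<close>

section \<open>Folner sets, random permutations and decoupling\<close>

text \<open>The products of powers of the listed elements with exponents from 0 to n. In an abelian
  group a listed element carries box n into box n + 1, while the size is polynomial in n.\<close>

primrec (in monoid) box :: "'a list \<Rightarrow> nat \<Rightarrow> 'a set" where
  "box [] n = {\<one>}"
| "box (h # hs) n = (\<lambda>(a, y). h [^] a \<otimes> y) ` ({..n} \<times> box hs n)"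

lemma (in group) box_closed: "set hs \<subseteq> carrier G \<Longrightarrow> box hs n \<subseteq> carrier G"
  by (induction hs) auto

lemma (in group) finite_box: "finite (box hs n)"
  by (induction hs) auto

lemma (in group) box_nonempty: "box hs n \<noteq> {}"
  by (induction hs) auto

lemma (in group) card_box_le: "card (box hs n) \<le> (n + 1) ^ length hs"
proof (induction hs)
  case (Cons h hs)
  have "card (box (h # hs) n) \<le> card ({..n} \<times> box hs n)"
    unfolding box.simps by (intro card_image_le) (simp add: finite_box)
  also have "\<dots> = (n + 1) * card (box hs n)" by (simp add: card_cartesian_product)
  also have "\<dots> \<le> (n + 1) * (n + 1) ^ length hs" using Cons by (intro mult_left_mono) auto
  finally show ?case by simp
qed simp

lemma (in group) box_mono: "box hs n \<subseteq> box hs (Suc n)"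
proof (induction hs)
  case (Cons h hs)
  have "{..n} \<times> box hs n \<subseteq> {..Suc n} \<times> box hs (Suc n)" using Cons by auto
  thus ?case unfolding box.simps by (rule image_mono)
qed simp

lemma (in comm_group) box_mult:
  "set hs \<subseteq> carrier G \<Longrightarrow> h \<in> set hs \<Longrightarrow> y \<in> box hs n \<Longrightarrow> y \<otimes> h \<in> box hs (Suc n)"
proof (induction hs arbitrary: y)
  case (Cons g hs)
  then obtain a z where y: "y = g [^] a \<otimes> z" "a \<le> n" "z \<in> box hs n" by auto
  have g: "g \<in> carrier G" "h \<in> carrier G" "z \<in> carrier G" "set hs \<subseteq> carrier G"
    using Cons.prems box_closed[of hs n] y by auto
  show ?case
  proof (cases "h = g")
    case True
    have "y \<otimes> h = g [^] Suc a \<otimes> z" using g True y(1) by (simp add: m_ac)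
    moreover have "z \<in> box hs (Suc n)" using y box_mono by blast
    ultimately show ?thesis using y(2) by (auto intro!: image_eqI[where x="(Suc a, z)"])
  next
    case False
    hence "z \<otimes> h \<in> box hs (Suc n)" using Cons g y by auto
    moreover have "y \<otimes> h = g [^] a \<otimes> (z \<otimes> h)" using g y(1) by (simp add: m_ac)
    ultimately show ?thesis using y(2) by (auto intro!: image_eqI[where x="(a, z \<otimes> h)"])
  qed
qed simp

text \<open>A sequence that grows by a factor 1 + \<epsilon> at every step is exponential, which a
  polynomial bound excludes.\<close>

lemma slow_growth_step:
  fixes f :: "nat \<Rightarrow> nat" and \<epsilon> :: real
  assumes f: "\<And>n. f n \<le> (n + 1) ^ k" and f0: "f 0 \<ge> 1" and e: "\<epsilon> > 0"
  obtains n where "real (f (Suc n)) \<le> (1 + \<epsilon>) * f n"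
proof (rule ccontr)
  assume "\<not> thesis"
  hence gr: "real (f (Suc n)) > (1 + \<epsilon>) * f n" for n using that not_le by blast
  have ge: "real (f n) \<ge> (1 + \<epsilon>) ^ n" for n
  proof (induction n)
    case (Suc n)
    have "(1 + \<epsilon>) ^ Suc n \<le> (1 + \<epsilon>) * f n" using Suc e by (simp add: mult_left_mono)
    thus ?case using gr[of n] by linarith
  qed (use f0 in simp)
  \<comment> \<open>At the argument m (k + 1) the exponential lower bound is at least (m
    \<epsilon>)^(k + 1) by Bernoulli, and the polynomial bound is at most ((k + 2) m)^k. This m
    makes the former larger.\<close>
  obtain m :: nat where m: "real m > real ((k + 2) ^ k) / \<epsilon> ^ (k + 1)" using reals_Archimedean2 by blast
  have m0: "m \<ge> 1" using m e by (cases m) (auto simp: field_simps zero_less_mult_iff)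
  have "(real m * \<epsilon>) ^ (k + 1) \<le> (1 + real m * \<epsilon>) ^ (k + 1)" using e by (intro power_mono) auto
  also have "\<dots> \<le> ((1 + \<epsilon>) ^ m) ^ (k + 1)"
    using Bernoulli_inequality[of \<epsilon> m] e by (intro power_mono) (auto simp: mult.commute)
  also have "\<dots> = (1 + \<epsilon>) ^ (m * (k + 1))" by (simp only: power_mult)
  also have "\<dots> \<le> real (f (m * (k + 1)))" by (rule ge)
  also have "\<dots> \<le> real ((m * (k + 1) + 1) ^ k)" using f by (meson of_nat_le_iff)
  also have "\<dots> \<le> real (((k + 2) * m) ^ k)" using m0
    by (intro of_nat_mono power_mono) (auto simp: algebra_simps)
  also have "\<dots> = real m ^ k * real ((k + 2) ^ k)" by (simp only: power_mult_distrib of_nat_mult of_nat_power mult.commute)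
  also have "(real m * \<epsilon>) ^ (k + 1) = real m ^ k * (real m * \<epsilon> ^ (k + 1))" by (simp add: power_mult_distrib)
  finally have "real m ^ k * (real m * \<epsilon> ^ (k + 1)) \<le> real m ^ k * real ((k + 2) ^ k)" .
  hence "real m * \<epsilon> ^ (k + 1) \<le> real ((k + 2) ^ k)" using m0 by simp
  thus False using m e by (simp add: field_simps)
qed

text \<open>With K as the list of generators, the translate of a box by any h in K lies in the next
  box. At a step of slow growth the shell between the two boxes is small, and only this shell can be
  new.\<close>

lemma (in comm_group) folner_set:
  fixes \<epsilon> :: real
  assumes K: "finite K" "K \<subseteq> carrier G" and e: "\<epsilon> > 0"
  obtains E where "finite E" "E \<noteq> {}" "E \<subseteq> carrier G"
    "\<And>h. h \<in> K \<Longrightarrow> real (card ((\<lambda>e. e \<otimes> h) ` E - E)) \<le> \<epsilon> * card E"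
proof -
  obtain hs where hs: "set hs = K" using K finite_list by auto
  obtain n where n: "real (card (box hs (Suc n))) \<le> (1 + \<epsilon>) * card (box hs n)"
    using slow_growth_step[of "\<lambda>n. card (box hs n)" "length hs" \<epsilon>] card_box_le e
    by (metis One_nat_def Suc_leI box_nonempty card_gt_0_iff finite_box)
  show thesis
  proof (rule that[of "box hs n"])
    fix h assume h: "h \<in> K"
    have "(\<lambda>e. e \<otimes> h) ` box hs n - box hs n \<subseteq> box hs (Suc n) - box hs n"
      using box_mult hs h K by auto
    hence "card ((\<lambda>e. e \<otimes> h) ` box hs n - box hs n) \<le> card (box hs (Suc n) - box hs n)"
      by (intro card_mono) (auto simp: finite_box)
    also have "\<dots> = card (box hs (Suc n)) - card (box hs n)"
      by (intro card_Diff_subset finite_box box_mono)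
    finally show "real (card ((\<lambda>e. e \<otimes> h) ` box hs n - box hs n)) \<le> \<epsilon> * card (box hs n)"
      using n card_mono[OF finite_box box_mono, of hs n] by (simp add: algebra_simps of_nat_diff)
  qed (use K hs box_closed finite_box box_nonempty in auto)
qed

text \<open>Greedy choice: a new element has to avoid finitely many products of the form inv e e'
  d'. Disjoint translates E d are what later makes the centres chosen from d x and d' x distinct
  points of the orbit.\<close>

lemma (in group) sparse_set:
  assumes inf: "infinite (carrier G)" and E: "finite E" "E \<subseteq> carrier G"
  shows "\<exists>D. finite D \<and> D \<subseteq> carrier G \<and> card D = n \<and>
    (\<forall>d\<in>D. \<forall>d'\<in>D. d \<noteq> d' \<longrightarrow> (\<forall>e\<in>E. \<forall>e'\<in>E. e \<otimes> d \<noteq> e' \<otimes> d'))"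
proof (induction n)
  case 0
  show ?case by (intro exI[of _ "{}"]) auto
next
  case (Suc n)
  then obtain D where D: "finite D" "D \<subseteq> carrier G" "card D = n"
    "\<forall>d\<in>D. \<forall>d'\<in>D. d \<noteq> d' \<longrightarrow> (\<forall>e\<in>E. \<forall>e'\<in>E. e \<otimes> d \<noteq> e' \<otimes> d')" by blast
  let ?B = "D \<union> (\<lambda>(e, e', d). inv e \<otimes> (e' \<otimes> d)) ` (E \<times> E \<times> D)"
  have "finite ?B" using D E by auto
  then obtain d where d: "d \<in> carrier G" "d \<notin> ?B" using inf by (meson finite_subset subsetI)
  have ne: "e \<otimes> d \<noteq> e' \<otimes> d'" if "e \<in> E" "e' \<in> E" "d' \<in> D" for e e' d'
  proof
    assume *: "e \<otimes> d = e' \<otimes> d'"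
    have c: "e \<in> carrier G" "e' \<in> carrier G" "d' \<in> carrier G" using that E D by auto
    have "d = inv e \<otimes> (e \<otimes> d)" using c d by (simp add: m_assoc[symmetric])
    hence "d = inv e \<otimes> (e' \<otimes> d')" using * by simp
    thus False using d that by (auto simp: image_iff)
  qed
  show ?case
  proof (intro exI[of _ "insert d D"] conjI)
    show "\<forall>x\<in>insert d D. \<forall>x'\<in>insert d D. x \<noteq> x' \<longrightarrow> (\<forall>e\<in>E. \<forall>e'\<in>E. e \<otimes> x \<noteq> e' \<otimes> x')"
      using D(4) ne by (metis insert_iff)
  qed (use D d in auto)
qed

text \<open>The place in U at which a random permutation is smallest is uniform on U: composing with
  the transposition of u and u' turns permutations minimal at u into permutations minimal at
  u'.\<close>

lemma card_permutes_argmin: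
  fixes L :: "nat set"
  assumes L: "finite L" and U: "U \<subseteq> L" and V: "V \<subseteq> U"
  shows "card {\<pi>. \<pi> permutes L \<and> (\<exists>v\<in>V. \<pi> v = Min (\<pi> ` U))} * card U = card V * card {\<pi>. \<pi> permutes L}"
proof (cases "U = {}")
  case False
  define A where "A u = {\<pi>. \<pi> permutes L \<and> \<pi> u = Min (\<pi> ` U)}" for u
  have fU: "finite U" using U L finite_subset by blast
  have "finite {\<pi>. \<pi> permutes L}" using L by (rule finite_permutations)
  hence finA: "finite (A u)" for u unfolding A_def by (rule rev_finite_subset) auto
  have le: "card (A u) \<le> card (A u')" if u: "u \<in> U" "u' \<in> U" for u u'
  proof (rule card_inj_on_le[where f="\<lambda>\<pi>. \<pi> \<circ> Transposition.transpose u u'"])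
    show "inj_on (\<lambda>\<pi>. \<pi> \<circ> Transposition.transpose u u') (A u)"
    proof (rule inj_onI)
      fix \<pi> \<rho> :: "nat \<Rightarrow> nat" assume "\<pi> \<circ> Transposition.transpose u u' = \<rho> \<circ> Transposition.transpose u u'"
      hence "\<pi> \<circ> Transposition.transpose u u' \<circ> Transposition.transpose u u' = \<rho> \<circ> Transposition.transpose u u' \<circ> Transposition.transpose u u'" by simp
      thus "\<pi> = \<rho>" by (simp add: comp_assoc)
    qed
    have tU: "Transposition.transpose u u' ` U = U" using u by (auto simp: Transposition.transpose_def image_iff)
    show "(\<lambda>\<pi>. \<pi> \<circ> Transposition.transpose u u') ` A u \<subseteq> A u'"
    proof clarify
      fix \<pi> assume p: "\<pi> \<in> A u"
      have "(\<pi> \<circ> Transposition.transpose u u') permutes L"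
        using p u U unfolding A_def by (intro permutes_compose permutes_swap_id) auto
      moreover have "(\<pi> \<circ> Transposition.transpose u u') ` U = \<pi> ` U" using tU by (metis image_comp)
      ultimately show "\<pi> \<circ> Transposition.transpose u u' \<in> A u'" using p unfolding A_def by auto
    qed
  qed (rule finA)
  obtain u0 where u0: "u0 \<in> U" using False by blast
  have eq: "card (A u) = card (A u0)" if "u \<in> U" for u using le that u0 by (meson le_antisym)
  have disj: "A u \<inter> A u' = {}" if "u \<in> U" "u' \<in> U" "u \<noteq> u'" for u u'
  proof -
    have "\<pi> u \<noteq> \<pi> u'" if "\<pi> permutes L" for \<pi> :: "nat \<Rightarrow> nat"
      using permutes_inj[OF that] \<open>u \<noteq> u'\<close> by (auto dest: injD)
    thus ?thesis unfolding A_def disjoint_iff mem_Collect_eq by metis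
  qed
  have cnt: "card {\<pi>. \<pi> permutes L \<and> (\<exists>v\<in>W. \<pi> v = Min (\<pi> ` U))} = card W * card (A u0)" if W: "W \<subseteq> U" for W
  proof -
    have "{\<pi>. \<pi> permutes L \<and> (\<exists>v\<in>W. \<pi> v = Min (\<pi> ` U))} = (\<Union>v\<in>W. A v)" unfolding A_def by auto
    also have "card \<dots> = (\<Sum>v\<in>W. card (A v))"
    proof (intro card_UN_disjoint ballI impI)
      show "A u \<inter> A u' = {}" if "u \<in> W" "u' \<in> W" "u \<noteq> u'" for u u' using disj W that by (meson subsetD)
    qed (use W fU finA finite_subset in auto)
    also have "\<dots> = (\<Sum>v\<in>W. card (A u0))" using W eq by (intro sum.cong) auto
    finally show ?thesis by simp
  qed
  have "\<exists>v\<in>U. \<pi> v = Min (\<pi> ` U)" for \<pi> :: "nat \<Rightarrow> nat"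
    using Min_in[of "\<pi> ` U"] fU False by (auto simp: image_iff)
  hence "{\<pi>. \<pi> permutes L} = {\<pi>. \<pi> permutes L \<and> (\<exists>v\<in>U. \<pi> v = Min (\<pi> ` U))}" by auto
  thus ?thesis using cnt[of U] cnt[OF V] by simp
qed (use V in simp)

lemma (in prob_space) exists_le_zero:
  fixes g :: "'a \<Rightarrow> real"
  assumes "integrable M g" "expectation g = 0"
  obtains s where "g s \<le> 0"
proof -
  have "\<exists>s. g s \<le> 0"
  proof (rule ccontr)
    assume "\<not> ?thesis"
    hence "AE x in M. 0 < g x" by (simp add: not_le)
    hence "0 < expectation g" using assms(1) by (rule expectation_greater[rotated])
    thus False using assms by simp
  qed
  thus ?thesis using that by blast
qed

text \<open>The values of c are chosen one at a time: averaged over a new value, its cross terms with the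
  earlier ones vanish.\<close>

lemma (in prob_space) decoupling:
  fixes K :: "'l \<Rightarrow> 'l \<Rightarrow> 'a \<Rightarrow> 'a \<Rightarrow> real"
  assumes "finite L"
    and "\<And>l l' s. l \<noteq> l' \<Longrightarrow> integrable M (K l l' s) \<and> expectation (K l l' s) = 0"
    and "\<And>l l' s. l \<noteq> l' \<Longrightarrow> integrable M (\<lambda>s'. K l l' s' s) \<and> expectation (\<lambda>s'. K l l' s' s) = 0"
  shows "\<exists>c. (\<Sum>l\<in>L. \<Sum>l'\<in>L - {l}. K l l' (c l) (c l')) \<le> 0"
  using assms(1)
proof (induction L)
  case (insert m L)
  then obtain c where c: "(\<Sum>l\<in>L. \<Sum>l'\<in>L - {l}. K l l' (c l) (c l')) \<le> 0" by blast
  define g where "g s = (\<Sum>l\<in>L. K m l s (c l) + K l m (c l) s)" for s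
  have "integrable M g" unfolding g_def
    using assms(2,3) insert.hyps by (intro Bochner_Integration.integrable_sum Bochner_Integration.integrable_add) metis+
  moreover have "expectation g = 0"
  proof -
    have i: "integrable M (\<lambda>s. K m l s (c l))" "integrable M (K l m (c l))" "expectation (\<lambda>s. K m l s (c l)) = 0" "expectation (K l m (c l)) = 0"
      if "l \<in> L" for l using assms(2,3) that insert.hyps by metis+
    have "expectation g = (\<Sum>l\<in>L. expectation (\<lambda>s. K m l s (c l) + K l m (c l) s))"
      unfolding g_def using i by (subst Bochner_Integration.integral_sum) auto
    also have "\<dots> = (\<Sum>l\<in>L. 0)" using i by (intro sum.cong) auto
    finally show ?thesis by simp
  qed
  ultimately obtain s where s: "g s \<le> 0" by (rule exists_le_zero)
  let ?c = "c(m := s)"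
  have nm: "l \<noteq> m" if "l \<in> L" for l using insert that by auto
  have a: "(\<Sum>l'\<in>insert m L - {l}. K l l' (?c l) (?c l')) = K l m (c l) s + (\<Sum>l'\<in>L - {l}. K l l' (c l) (c l'))"
    if "l \<in> L" for l
  proof -
    have "insert m L - {l} = insert m (L - {l})" using nm[OF that] by auto
    moreover have "(\<Sum>l'\<in>L - {l}. K l l' (?c l) (?c l')) = (\<Sum>l'\<in>L - {l}. K l l' (c l) (c l'))"
      using nm that by (intro sum.cong) auto
    ultimately show ?thesis using insert.hyps nm[OF that] by simp
  qed
  have b: "(\<Sum>l'\<in>insert m L - {m}. K m l' (?c m) (?c l')) = (\<Sum>l\<in>L. K m l s (c l))"
    using insert.hyps nm by (intro sum.cong) auto
  have "(\<Sum>l\<in>insert m L. \<Sum>l'\<in>insert m L - {l}. K l l' (?c l) (?c l')) =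
    (\<Sum>l\<in>L. K m l s (c l)) + (\<Sum>l\<in>L. K l m (c l) s + (\<Sum>l'\<in>L - {l}. K l l' (c l) (c l')))"
    using insert.hyps a b by (simp cong: sum.cong)
  also have "\<dots> = g s + (\<Sum>l\<in>L. \<Sum>l'\<in>L - {l}. K l l' (c l) (c l'))"
    by (simp add: g_def sum.distrib)
  also have "\<dots> \<le> 0" using s c by simp
  finally show ?case by blast
qed simp

section \<open>Random labellings of a probability space\<close>

locale pmp = prob_space M for M :: "'a measure" +
  assumes space_UNIV: "space M = UNIV"
begin

definition mp :: "('a \<Rightarrow> 'a) set" where
  "mp = {T. T \<in> M \<rightarrow>\<^sub>M M \<and> distr M M T = M}"

lemma mp_measurable: "T \<in> mp \<Longrightarrow> T \<in> M \<rightarrow>\<^sub>M M" by (simp add: mp_def)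

lemma mp_sets: "T \<in> mp \<Longrightarrow> A \<in> sets M \<Longrightarrow> {x. T x \<in> A} \<in> sets M"
  using measurable_sets[of T M M A] by (simp add: mp_def space_UNIV vimage_def)

lemma mp_emeasure: "T \<in> mp \<Longrightarrow> A \<in> sets M \<Longrightarrow> emeasure M {x. T x \<in> A} = emeasure M A"
  using emeasure_distr[of T M M A] by (simp add: mp_def space_UNIV vimage_def)

lemma mp_measure: "T \<in> mp \<Longrightarrow> A \<in> sets M \<Longrightarrow> measure M {x. T x \<in> A} = measure M A"
  by (simp add: measure_def mp_emeasure)

lemma mp_integral:
  fixes f :: "'a \<Rightarrow> real"
  shows "T \<in> mp \<Longrightarrow> f \<in> borel_measurable M \<Longrightarrow> (\<integral>x. f (T x) \<partial>M) = (\<integral>x. f x \<partial>M)"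
  using integral_distr[of T M M f] by (simp add: mp_def)

lemma mp_comp: "S \<in> mp \<Longrightarrow> T \<in> mp \<Longrightarrow> (\<lambda>x. S (T x)) \<in> mp"
  using distr_distr[of S M M T M] measurable_compose[of T M M S M] by (simp add: mp_def comp_def)

lemma mp_AE: "T \<in> mp \<Longrightarrow> AE x in M. P x \<Longrightarrow> AE x in M. P (T x)"
  by (metis (mono_tags, lifting) AE_distrD mem_Collect_eq mp_def)

lemma bounded_integrable:
  fixes f :: "'a \<Rightarrow> real"
  shows "f \<in> borel_measurable M \<Longrightarrow> (\<And>x. \<bar>f x\<bar> \<le> B) \<Longrightarrow> integrable M f"
  by (rule integrable_const_bound[of _ B]) auto

section \<open>Second moments of randomly labelled points\<close>

text \<open>If the points c l were drawn independently, the mean-zero factors would make the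
  contribution of all x with two different labels vanish on average, and each other x contributes at
  most 1. \<open>decoupling\<close> turns the average into one good c.\<close>

lemma random_quadratic:
  fixes a b :: "'r \<Rightarrow> 'a \<Rightarrow> 'u" and lab :: "'u \<Rightarrow> 'l" and G :: "'r \<Rightarrow> 'u \<Rightarrow> 'a \<Rightarrow> real"
  assumes R: "finite R" and U: "finite U"
    and a: "\<And>r. r \<in> R \<Longrightarrow> a r \<in> M \<rightarrow>\<^sub>M count_space U"
    and b: "\<And>r. r \<in> R \<Longrightarrow> b r \<in> M \<rightarrow>\<^sub>M count_space U"
    and G: "\<And>r u. r \<in> R \<Longrightarrow> u \<in> U \<Longrightarrow> G r u \<in> borel_measurable M"
    and G1: "\<And>r u s. r \<in> R \<Longrightarrow> u \<in> U \<Longrightarrow> \<bar>G r u s\<bar> \<le> 1"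
    and G0: "\<And>r u. r \<in> R \<Longrightarrow> u \<in> U \<Longrightarrow> (\<integral>s. G r u s \<partial>M) = 0"
  shows "\<exists>c. (\<Sum>r\<in>R. \<integral>x. G r (a r x) (c (lab (a r x))) * G r (b r x) (c (lab (b r x))) \<partial>M)
     \<le> (\<Sum>r\<in>R. measure M {x. lab (a r x) = lab (b r x)})"
proof -
  define m where "m r u u' = measure M {x. a r x = u \<and> b r x = u'}" for r u u'
  define L where "L = lab ` U"
  define Q where "Q = R \<times> U \<times> U"
  define P where "P = (SIGMA l:L. L - {l})"
  \<comment> \<open>K l l' gathers the terms whose two labels are l and l', so the sum over distinct
    labels has mean zero in each variable separately.\<close>
  define K where "K l l' s s' = (\<Sum>(r, u, u')\<in>Q. of_bool (lab u = l \<and> lab u' = l') * m r u u' * (G r u s * G r u' s'))"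
    for l l' s s'
  have fin: "finite L" "finite Q" "finite P" unfolding L_def Q_def P_def using R U by auto
  have int: "integrable M (G r u)" if "r \<in> R" "u \<in> U" for r u
    using G[OF that] G1[OF that] by (rule bounded_integrable)
  have K1: "integrable M (K l l' s) \<and> expectation (K l l' s) = 0" for l l' s
  proof -
    have i: "integrable M (\<lambda>s'. case q of (r, u, u') \<Rightarrow> of_bool (lab u = l \<and> lab u' = l') * m r u u' * (G r u s * G r u' s'))"
      and z: "expectation (\<lambda>s'. case q of (r, u, u') \<Rightarrow> of_bool (lab u = l \<and> lab u' = l') * m r u u' * (G r u s * G r u' s')) = 0"
      if "q \<in> Q" for q using that int G0 by (auto simp: Q_def)
    show ?thesis unfolding K_def using i z by (auto simp: Bochner_Integration.integral_sum)
  qed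
  have K2: "integrable M (\<lambda>s'. K l l' s' s) \<and> expectation (\<lambda>s'. K l l' s' s) = 0" for l l' s
  proof -
    have i: "integrable M (\<lambda>s'. case q of (r, u, u') \<Rightarrow> of_bool (lab u = l \<and> lab u' = l') * m r u u' * (G r u s' * G r u' s))"
      and z: "expectation (\<lambda>s'. case q of (r, u, u') \<Rightarrow> of_bool (lab u = l \<and> lab u' = l') * m r u u' * (G r u s' * G r u' s)) = 0"
      if "q \<in> Q" for q using that int G0 by (auto simp: Q_def)
    show ?thesis unfolding K_def using i z by (auto simp: Bochner_Integration.integral_sum)
  qed
  obtain c where c: "(\<Sum>l\<in>L. \<Sum>l'\<in>L - {l}. K l l' (c l) (c l')) \<le> 0"
    using decoupling[of L K] fin K1 K2 by blast
  define X where "X r u u' = m r u u' * (G r u (c (lab u)) * G r u' (c (lab u')))" for r u u'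
  have sa: "{x. a r x = u \<and> b r x = u'} \<in> sets M" if "r \<in> R" "u \<in> U" "u' \<in> U" for r u u'
  proof -
    have "{x \<in> space M. a r x \<in> {u}} \<in> sets M" "{x \<in> space M. b r x \<in> {u'}} \<in> sets M"
      using measurable_sets[OF a[OF that(1)], of "{u}"] measurable_sets[OF b[OF that(1)], of "{u'}"] that
      by (auto simp: vimage_def Int_def conj_commute)
    hence "{x \<in> space M. a r x \<in> {u}} \<inter> {x \<in> space M. b r x \<in> {u'}} \<in> sets M" by blast
    thus ?thesis by (simp add: space_UNIV Collect_conj_eq)
  qed
  have inU: "a r x \<in> U" "b r x \<in> U" if "r \<in> R" for r x
    using measurable_space[OF a[OF that], of x] measurable_space[OF b[OF that], of x] by (auto simp: space_UNIV)
  \<comment> \<open>Since a r and b r have finitely many values, every integral is a finite sum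
    weighted by their joint law m.\<close>
  have expand: "(\<integral>x. F (a r x) (b r x) \<partial>M) = (\<Sum>u\<in>U. \<Sum>u'\<in>U. m r u u' * F u u')" if r: "r \<in> R" for r and F :: "'u \<Rightarrow> 'u \<Rightarrow> real"
  proof -
    have "F (a r x) (b r x) = (\<Sum>u\<in>U. \<Sum>u'\<in>U. indicator {x. a r x = u \<and> b r x = u'} x * F u u')" for x
    proof -
      have "(\<Sum>u\<in>U. \<Sum>u'\<in>U. indicator {x. a r x = u \<and> b r x = u'} x * F u u') =
        (\<Sum>u\<in>U. if u = a r x then F u (b r x) else 0)"
      proof (intro sum.cong refl)
        fix u
        have "(\<Sum>u'\<in>U. indicator {x. a r x = u \<and> b r x = u'} x * F u u') =
          (\<Sum>u'\<in>U. if u' = b r x then (if u = a r x then F u u' else 0) else 0)"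
          by (intro sum.cong) (auto simp: indicator_def)
        also have "\<dots> = (if u = a r x then F u (b r x) else 0)" using U inU[OF r] by (subst sum.delta) auto
        finally show "(\<Sum>u'\<in>U. indicator {x. a r x = u \<and> b r x = u'} x * F u u') = (if u = a r x then F u (b r x) else 0)" .
      qed
      thus ?thesis using U inU[OF r] by (simp add: sum.delta)
    qed
    moreover have [simp]: "integrable M (indicat_real {x. a r x = u \<and> b r x = u'})" if "u \<in> U" "u' \<in> U" for u u'
      using sa[OF r that] by (intro bounded_integrable[where B=1]) (auto simp: indicator_def)
    ultimately have "(\<integral>x. F (a r x) (b r x) \<partial>M) = (\<integral>x. (\<Sum>u\<in>U. \<Sum>u'\<in>U. indicator {x. a r x = u \<and> b r x = u'} x * F u u') \<partial>M)" by simp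
    also have "\<dots> = (\<Sum>u\<in>U. \<integral>x. (\<Sum>u'\<in>U. indicator {x. a r x = u \<and> b r x = u'} x * F u u') \<partial>M)"
      using sa[OF r] by (intro Bochner_Integration.integral_sum Bochner_Integration.integrable_sum) auto
    also have "\<dots> = (\<Sum>u\<in>U. \<Sum>u'\<in>U. \<integral>x. indicator {x. a r x = u \<and> b r x = u'} x * F u u' \<partial>M)"
      using sa[OF r] by (intro sum.cong refl Bochner_Integration.integral_sum Bochner_Integration.integrable_sum) auto
    also have "\<dots> = (\<Sum>u\<in>U. \<Sum>u'\<in>U. m r u u' * F u u')"
    proof (intro sum.cong refl)
      fix u u' assume u: "u \<in> U" "u' \<in> U"
      have "integrable M (indicat_real {x. a r x = u \<and> b r x = u'})"
        using sa[OF r u] by (intro bounded_integrable[where B=1]) (auto simp: indicator_def)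
      thus "(\<integral>x. indicator {x. a r x = u \<and> b r x = u'} x * F u u' \<partial>M) = m r u u' * F u u'"
        using sa[OF r u] by (simp add: m_def)
    qed
    finally show ?thesis .
  qed
  have "(\<Sum>r\<in>R. \<integral>x. G r (a r x) (c (lab (a r x))) * G r (b r x) (c (lab (b r x))) \<partial>M) = (\<Sum>r\<in>R. \<Sum>u\<in>U. \<Sum>u'\<in>U. X r u u')"
  proof (intro sum.cong refl)
    fix r assume "r \<in> R"
    from expand[OF this, of "\<lambda>u u'. G r u (c (lab u)) * G r u' (c (lab u'))"]
    show "(\<integral>x. G r (a r x) (c (lab (a r x))) * G r (b r x) (c (lab (b r x))) \<partial>M) = (\<Sum>u\<in>U. \<Sum>u'\<in>U. X r u u')"
      unfolding X_def .
  qed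
  also have "\<dots> = (\<Sum>(r, u, u')\<in>Q. X r u u')" unfolding Q_def by (simp add: sum.cartesian_product)
  also have "\<dots> = (\<Sum>(r, u, u')\<in>Q. of_bool (lab u = lab u') * X r u u') + (\<Sum>(r, u, u')\<in>Q. of_bool (lab u \<noteq> lab u') * X r u u')"
    by (subst sum.distrib[symmetric]) (auto intro!: sum.cong)
  also have "(\<Sum>(r, u, u')\<in>Q. of_bool (lab u \<noteq> lab u') * X r u u') = (\<Sum>l\<in>L. \<Sum>l'\<in>L - {l}. K l l' (c l) (c l'))"
  proof -
    have "(\<Sum>l\<in>L. \<Sum>l'\<in>L - {l}. K l l' (c l) (c l')) = (\<Sum>(l, l')\<in>P. K l l' (c l) (c l'))"
      unfolding P_def using fin by (subst sum.Sigma) auto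
    also have "\<dots> = (\<Sum>(l, l')\<in>P. \<Sum>(r, u, u')\<in>Q. of_bool (lab u = l \<and> lab u' = l') * X r u u')"
      unfolding K_def X_def by (intro sum.cong refl) (auto intro!: sum.cong)
    also have "\<dots> = (\<Sum>(r, u, u')\<in>Q. \<Sum>(l, l')\<in>P. of_bool (lab u = l \<and> lab u' = l') * X r u u')"
      unfolding case_prod_unfold by (rule sum.swap)
    also have "\<dots> = (\<Sum>(r, u, u')\<in>Q. of_bool (lab u \<noteq> lab u') * X r u u')"
    proof (intro sum.cong refl, clarify)
      fix r u u' assume q: "(r, u, u') \<in> Q"
      have "(\<Sum>(l, l')\<in>P. of_bool (lab u = l \<and> lab u' = l') * X r u u') =
        (\<Sum>p\<in>P. if p = (lab u, lab u') then X r u u' else 0)"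
        by (intro sum.cong) (auto split: prod.splits)
      also have "\<dots> = of_bool (lab u \<noteq> lab u') * X r u u'"
        using q fin by (subst sum.delta) (auto simp: P_def Q_def L_def)
      finally show "(\<Sum>(l, l')\<in>P. of_bool (lab u = l \<and> lab u' = l') * X r u u') = of_bool (lab u \<noteq> lab u') * X r u u'" .
    qed
    finally show ?thesis by simp
  qed
  also have "(\<Sum>(r, u, u')\<in>Q. of_bool (lab u = lab u') * X r u u') + (\<Sum>l\<in>L. \<Sum>l'\<in>L - {l}. K l l' (c l) (c l'))
    \<le> (\<Sum>(r, u, u')\<in>Q. m r u u' * of_bool (lab u = lab u'))"
  proof -
    have "(\<Sum>(r, u, u')\<in>Q. of_bool (lab u = lab u') * X r u u') \<le> (\<Sum>(r, u, u')\<in>Q. m r u u' * of_bool (lab u = lab u'))"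
    proof (intro sum_mono, clarify)
      fix r u u' assume "(r, u, u') \<in> Q"
      hence q: "r \<in> R" "u \<in> U" "u' \<in> U" by (auto simp: Q_def)
      have "\<bar>G r u (c (lab u)) * G r u' (c (lab u'))\<bar> \<le> 1 * 1"
        unfolding abs_mult using G1 q by (intro mult_mono) auto
      hence "X r u u' \<le> m r u u' * 1" unfolding X_def by (intro mult_left_mono) (auto simp: m_def)
      thus "of_bool (lab u = lab u') * X r u u' \<le> m r u u' * of_bool (lab u = lab u')" by simp
    qed
    thus ?thesis using c by linarith
  qed
  also have "(\<Sum>(r, u, u')\<in>Q. m r u u' * of_bool (lab u = lab u')) = (\<Sum>r\<in>R. \<Sum>u\<in>U. \<Sum>u'\<in>U. m r u u' * of_bool (lab u = lab u'))"
    unfolding Q_def by (simp add: sum.cartesian_product)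
  also have "\<dots> = (\<Sum>r\<in>R. \<integral>x. of_bool (lab (a r x) = lab (b r x)) \<partial>M)"
    by (intro sum.cong refl) (rule expand[symmetric])
  also have "\<dots> = (\<Sum>r\<in>R. measure M {x. lab (a r x) = lab (b r x)})"
  proof (intro sum.cong refl)
    fix r assume r: "r \<in> R"
    have "{x. lab (a r x) = lab (b r x)} = (\<Union>u\<in>U. \<Union>u'\<in>{u'\<in>U. lab u = lab u'}. {x. a r x = u \<and> b r x = u'})"
      using inU[OF r] by auto
    also have "\<dots> \<in> sets M" using U r by (intro sets.finite_UN sa) auto
    finally have "{x. lab (a r x) = lab (b r x)} \<in> sets M" .
    moreover have "(\<integral>x. (of_bool (lab (a r x) = lab (b r x)) :: real) \<partial>M) = (\<integral>x. indicator {x. lab (a r x) = lab (b r x)} x \<partial>M)"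
      by (intro Bochner_Integration.integral_cong) (auto simp: indicator_def)
    ultimately show "(\<integral>x. of_bool (lab (a r x) = lab (b r x)) \<partial>M) = measure M {x. lab (a r x) = lab (b r x)}" by simp
  qed
  finally show ?thesis by blast
qed

lemma square_expectation_le:
  fixes f :: "'a \<Rightarrow> real"
  assumes "f \<in> borel_measurable M" "\<And>x. \<bar>f x\<bar> \<le> B"
  shows "(\<integral>x. f x \<partial>M)\<^sup>2 \<le> (\<integral>x. (f x)\<^sup>2 \<partial>M)"
proof -
  have "integrable M f" using assms by (rule bounded_integrable)
  moreover have "integrable M (\<lambda>x. (f x)\<^sup>2)"
    using assms power_mono[of "\<bar>f _\<bar>" B 2] by (intro bounded_integrable[where B="B\<^sup>2"]) auto
  ultimately have "variance f = expectation (\<lambda>x. (f x)\<^sup>2) - (expectation f)\<^sup>2" by (intro variance_eq)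
  thus ?thesis using variance_positive[of f] by linarith
qed

text \<open>For invariant Z, n times the integral of g over Z is the integral over Z of the sum v of
  g over n translates. Its square is at most the integral of v squared, which does not involve Z.
  Expanding this square gives n diagonal terms and collision terms of size at most \<delta>.
  Bounding the sum over all t gives a single c, at the price of the factor card T.\<close>

lemma random_labels:
  fixes \<sigma> :: "'t \<Rightarrow> 'a \<Rightarrow> 'u" and lab :: "'u \<Rightarrow> 'l" and G :: "'t \<Rightarrow> 'u \<Rightarrow> 'a \<Rightarrow> real" and D :: "'t \<Rightarrow> 'd set"
  assumes T: "finite T" and U: "finite U" and n: "n > 0"
    and D: "\<And>t. t \<in> T \<Longrightarrow> finite (D t) \<and> card (D t) = n"
    and A: "\<And>t d. t \<in> T \<Longrightarrow> d \<in> D t \<Longrightarrow> A t d \<in> mp"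
    and s: "\<And>t. t \<in> T \<Longrightarrow> \<sigma> t \<in> M \<rightarrow>\<^sub>M count_space U"
    and G: "\<And>t u. t \<in> T \<Longrightarrow> u \<in> U \<Longrightarrow> G t u \<in> borel_measurable M"
    and G1: "\<And>t u s. t \<in> T \<Longrightarrow> u \<in> U \<Longrightarrow> \<bar>G t u s\<bar> \<le> 1"
    and G0: "\<And>t u. t \<in> T \<Longrightarrow> u \<in> U \<Longrightarrow> (\<integral>s. G t u s \<partial>M) = 0"
    and \<delta>: "\<delta> \<ge> 0"
    and coll: "\<And>t d d'. t \<in> T \<Longrightarrow> d \<in> D t \<Longrightarrow> d' \<in> D t \<Longrightarrow> d \<noteq> d' \<Longrightarrow>
      measure M {x. lab (\<sigma> t (A t d x)) = lab (\<sigma> t (A t d' x))} \<le> \<delta>"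
  shows "\<exists>c. \<forall>t\<in>T. \<forall>Z\<in>sets M. (\<forall>d\<in>D t. \<forall>x. A t d x \<in> Z \<longleftrightarrow> x \<in> Z) \<longrightarrow>
    \<bar>\<integral>x. indicator Z x * G t (\<sigma> t x) (c (lab (\<sigma> t x))) \<partial>M\<bar> \<le> sqrt (card T * (1 / n + \<delta>))"
proof -
  \<comment> \<open>The index t is part of the summation, so that one application of
    \<open>random_quadratic\<close> serves all t.\<close>
  define R where "R = (SIGMA t:T. D t \<times> D t)"
  have fR: "finite R" unfolding R_def using T D by auto
  have sA: "(\<lambda>x. \<sigma> t (A t d x)) \<in> M \<rightarrow>\<^sub>M count_space U" if "t \<in> T" "d \<in> D t" for t d
    using measurable_compose[OF mp_measurable[OF A[OF that]] s[OF that(1)]] .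
  obtain c where c: "(\<Sum>r\<in>R. \<integral>x. G (fst r) (\<sigma> (fst r) (A (fst r) (fst (snd r)) x)) (c (lab (\<sigma> (fst r) (A (fst r) (fst (snd r)) x))))
        * G (fst r) (\<sigma> (fst r) (A (fst r) (snd (snd r)) x)) (c (lab (\<sigma> (fst r) (A (fst r) (snd (snd r)) x)))) \<partial>M)
     \<le> (\<Sum>r\<in>R. measure M {x. lab (\<sigma> (fst r) (A (fst r) (fst (snd r)) x)) = lab (\<sigma> (fst r) (A (fst r) (snd (snd r)) x))})"
    using random_quadratic[of R U "\<lambda>r x. \<sigma> (fst r) (A (fst r) (fst (snd r)) x)" "\<lambda>r x. \<sigma> (fst r) (A (fst r) (snd (snd r)) x)" "\<lambda>r. G (fst r)" lab]
      fR U sA G G1 G0 unfolding R_def by fastforce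
  define g where "g t x = G t (\<sigma> t x) (c (lab (\<sigma> t x)))" for t x
  have inU: "\<sigma> t x \<in> U" if "t \<in> T" for t x using measurable_space[OF s[OF that], of x] by (simp add: space_UNIV)
  have g1: "\<bar>g t x\<bar> \<le> 1" if "t \<in> T" for t x using G1 that inU unfolding g_def by blast
  have gm: "g t \<in> borel_measurable M" if "t \<in> T" for t
    unfolding g_def using measurable_compose[OF s[OF that], of "\<lambda>u. G t u (c (lab u))" borel] by simp
  define v where "v t x = (\<Sum>d\<in>D t. g t (A t d x))" for t x
  have gA: "(\<lambda>x. g t (A t d x)) \<in> borel_measurable M" if "t \<in> T" "d \<in> D t" for t d
    using measurable_compose[OF mp_measurable[OF A[OF that]] gm[OF that(1)]] .
  have vm: "v t \<in> borel_measurable M" if "t \<in> T" for t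
    unfolding v_def using gA that by (intro borel_measurable_sum) auto
  have v1: "\<bar>v t x\<bar> \<le> n" if "t \<in> T" for t x
  proof -
    have "\<bar>v t x\<bar> \<le> (\<Sum>d\<in>D t. \<bar>g t (A t d x)\<bar>)" unfolding v_def by (rule sum_abs)
    also have "\<dots> \<le> (\<Sum>d\<in>D t. 1)" using g1 that by (intro sum_mono) auto
    finally show ?thesis using D that by simp
  qed
  have vsq: "(\<integral>x. (v t x)\<^sup>2 \<partial>M) = (\<Sum>(d, d')\<in>D t \<times> D t. \<integral>x. g t (A t d x) * g t (A t d' x) \<partial>M)" if t: "t \<in> T" for t
  proof -
    have "(v t x)\<^sup>2 = (\<Sum>(d, d')\<in>D t \<times> D t. g t (A t d x) * g t (A t d' x))" for x
      unfolding v_def power2_eq_square sum_product by (simp add: sum.cartesian_product)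
    moreover have "integrable M (\<lambda>x. g t (A t d x) * g t (A t d' x))" if "d \<in> D t" "d' \<in> D t" for d d'
    proof (rule bounded_integrable[where B=1])
      show "(\<lambda>x. g t (A t d x) * g t (A t d' x)) \<in> borel_measurable M" using gA t that by simp
      show "\<bar>g t (A t d x) * g t (A t d' x)\<bar> \<le> 1" for x
        unfolding abs_mult using g1[OF t] by (intro mult_le_one) auto
    qed
    ultimately show ?thesis by (simp add: case_prod_unfold, subst Bochner_Integration.integral_sum) auto
  qed
  have "(\<Sum>t\<in>T. \<integral>x. (v t x)\<^sup>2 \<partial>M) = (\<Sum>t\<in>T. \<Sum>(d, d')\<in>D t \<times> D t. \<integral>x. g t (A t d x) * g t (A t d' x) \<partial>M)"
    using vsq by (intro sum.cong) auto
  also have "\<dots> = (\<Sum>(t, d, d')\<in>R. \<integral>x. g t (A t d x) * g t (A t d' x) \<partial>M)"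
    unfolding R_def using T D by (subst sum.Sigma) (auto simp: case_prod_unfold)
  also have "\<dots> \<le> (\<Sum>(t, d, d')\<in>R. measure M {x. lab (\<sigma> t (A t d x)) = lab (\<sigma> t (A t d' x))})"
    using c unfolding g_def case_prod_unfold .
  also have "\<dots> \<le> (\<Sum>(t, d, d')\<in>R. of_bool (d = d') + \<delta>)" 
  proof (intro sum_mono, clarify)
    fix t d d' assume "(t, d, d') \<in> R"
    hence "t \<in> T" "d \<in> D t" "d' \<in> D t" by (auto simp: R_def)
    thus "measure M {x. lab (\<sigma> t (A t d x)) = lab (\<sigma> t (A t d' x))} \<le> of_bool (d = d') + \<delta>"
      using coll[of t d d'] prob_le_1[of "{x. lab (\<sigma> t (A t d x)) = lab (\<sigma> t (A t d' x))}"] \<delta> by (cases "d = d'") (auto simp del: UNIV_I intro: order_trans[OF prob_le_1])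
  qed
  finally have tot: "(\<Sum>t\<in>T. \<integral>x. (v t x)\<^sup>2 \<partial>M) \<le> (\<Sum>(t, d, d')\<in>R. of_bool (d = d') + \<delta>)" by simp
  have "(\<Sum>(t, d, d')\<in>R. of_bool (d = d') + \<delta>) = (\<Sum>t\<in>T. \<Sum>(d, d')\<in>D t \<times> D t. of_bool (d = d') + \<delta>)"
    unfolding R_def using T D by (subst sum.Sigma) (auto simp: case_prod_unfold)
  also have "\<dots> = (\<Sum>t\<in>T. real n + (real n)\<^sup>2 * \<delta>)"
  proof (intro sum.cong refl)
    fix t assume "t \<in> T"
    hence d: "finite (D t)" "card (D t) = n" using D by auto
    have "(\<Sum>(d, d')\<in>D t \<times> D t. of_bool (d = d') + \<delta>) = (\<Sum>d\<in>D t. \<Sum>d'\<in>D t. of_bool (d = d')) + (\<Sum>d\<in>D t. \<Sum>d'\<in>D t. \<delta>)"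
      by (simp add: sum.cartesian_product[symmetric] sum.distrib)
    also have "(\<Sum>d\<in>D t. \<Sum>d'\<in>D t. of_bool (d = d') :: real) = (\<Sum>d\<in>D t. 1)"
      using d by (intro sum.cong refl) (simp add: of_bool_def sum.delta)
    finally show "(\<Sum>(d, d')\<in>D t \<times> D t. of_bool (d = d') + \<delta>) = real n + (real n)\<^sup>2 * \<delta>"
      using d by (simp add: power2_eq_square)
  qed
  finally have tot2: "(\<Sum>t\<in>T. \<integral>x. (v t x)\<^sup>2 \<partial>M) \<le> card T * (real n + (real n)\<^sup>2 * \<delta>)" using tot by simp
  show ?thesis
  proof (intro exI[of _ c] ballI impI)
    fix t Z assume t: "t \<in> T" and Z: "Z \<in> sets M" and inv: "\<forall>d\<in>D t. \<forall>x. A t d x \<in> Z \<longleftrightarrow> x \<in> Z"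
    have "(\<integral>x. (v t x)\<^sup>2 \<partial>M) \<le> (\<Sum>t\<in>T. \<integral>x. (v t x)\<^sup>2 \<partial>M)" using T t by (intro member_le_sum) auto
    hence vb: "(\<integral>x. (v t x)\<^sup>2 \<partial>M) \<le> card T * (real n + (real n)\<^sup>2 * \<delta>)" using tot2 by simp
    have im: "(\<lambda>x. indicator Z x * g t x) \<in> borel_measurable M" using gm[OF t] Z by simp
    \<comment> \<open>As Z is invariant, its indicator may be evaluated at A t d x instead, and A t
      d preserves the measure.\<close>
    have ii: "(\<integral>x. indicator Z x * g t (A t d x) \<partial>M) = (\<integral>x. indicator Z x * g t x \<partial>M)" if "d \<in> D t" for d
    proof -
      have "indicator Z x = (indicator Z (A t d x) :: real)" for x using inv that by (simp add: indicator_def)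
      thus ?thesis using mp_integral[OF A[OF t that] im] by simp
    qed
    have ib: "integrable M (\<lambda>x. indicator Z x * g t (A t d x))" if "d \<in> D t" for d
      using gA[OF t that] g1[OF t] Z by (intro bounded_integrable[where B=1]) (auto simp: indicator_def)
    have "(\<integral>x. indicator Z x * v t x \<partial>M) = (\<Sum>d\<in>D t. \<integral>x. indicator Z x * g t (A t d x) \<partial>M)"
      unfolding v_def sum_distrib_left using ib by (rule Bochner_Integration.integral_sum)
    also have "\<dots> = n * (\<integral>x. indicator Z x * g t x \<partial>M)" using ii D[OF t] by simp
    finally have e: "n * (\<integral>x. indicator Z x * g t x \<partial>M) = (\<integral>x. indicator Z x * v t x \<partial>M)" by simp
    have m1: "(\<lambda>x. indicator Z x * v t x) \<in> borel_measurable M" using Z vm[OF t] by simp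
    have b1: "\<bar>indicator Z x * v t x\<bar> \<le> n" for x using v1[OF t, of x] by (auto simp: indicator_def)
    have "(\<integral>x. indicator Z x * v t x \<partial>M)\<^sup>2 \<le> (\<integral>x. (indicator Z x * v t x)\<^sup>2 \<partial>M)"
      using m1 b1 by (rule square_expectation_le)
    \<comment> \<open>Dropping the indicator is what makes the bound uniform in Z.\<close>
    also have "\<dots> \<le> (\<integral>x. (v t x)\<^sup>2 \<partial>M)"
    proof (rule integral_mono)
      show "integrable M (\<lambda>x. (v t x)\<^sup>2)"
        using vm[OF t] v1[OF t] power_mono[of "\<bar>v t _\<bar>" n 2] by (intro bounded_integrable[where B="(real n)\<^sup>2"]) auto
      show "integrable M (\<lambda>x. (indicator Z x * v t x)\<^sup>2)"
        using m1 b1 power_mono[of "\<bar>indicator Z _ * v t _\<bar>" n 2] by (intro bounded_integrable[where B="(real n)\<^sup>2"]) auto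
    qed (auto simp: indicator_def)
    finally have "(n * (\<integral>x. indicator Z x * g t x \<partial>M))\<^sup>2 \<le> card T * (real n + (real n)\<^sup>2 * \<delta>)" using vb e by simp
    moreover have "card T * (real n + (real n)\<^sup>2 * \<delta>) = (real n)\<^sup>2 * (card T * (1 / n + \<delta>))"
      using n by (simp add: field_simps power2_eq_square)
    ultimately have "(real n)\<^sup>2 * (\<integral>x. indicator Z x * g t x \<partial>M)\<^sup>2 \<le> (real n)\<^sup>2 * (card T * (1 / n + \<delta>))"
      by (simp add: power_mult_distrib)
    hence "(\<integral>x. indicator Z x * g t x \<partial>M)\<^sup>2 \<le> card T * (1 / n + \<delta>)"
      using n by (subst (asm) mult_le_cancel_left_pos) auto
    show "\<bar>\<integral>x. indicator Z x * G t (\<sigma> t x) (c (lab (\<sigma> t x))) \<partial>M\<bar> \<le> sqrt (card T * (1 / n + \<delta>))"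
      using \<open>(\<integral>x. indicator Z x * g t x \<partial>M)\<^sup>2 \<le> _\<close> unfolding g_def
      by (intro real_le_rsqrt) (simp only: power2_abs)
  qed
qed

end

section \<open>Exchanging labels inside the orbits\<close>

text \<open>A measure isomorphism between conull sets is restricted to the largest set on which all its
  forward and backward iterates are defined, and is continued by the identity.\<close>

lemma (in pmp) Aut_extend:
  assumes A: "A \<in> sets M" "measure M A = 1" and B: "S ` A \<in> sets M" "measure M (S ` A) = 1"
    and inj: "inj_on S A"
    and pre: "\<And>C. C \<in> sets M \<Longrightarrow> {x\<in>A. S x \<in> C} \<in> sets M"
    and im: "\<And>C. C \<in> sets M \<Longrightarrow> C \<subseteq> A \<Longrightarrow> S ` C \<in> sets M"
    and meas: "\<And>C. C \<in> sets M \<Longrightarrow> measure M {x\<in>A. S x \<in> C} = measure M C"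
  shows "\<exists>S'\<in>Aut M. (\<forall>x. S' x = x \<or> x \<in> A \<and> S' x = S x) \<and> (AE x in M. S' x = S x)"
proof -
  \<comment> \<open>Each stage keeps the points whose image and preimage survived the previous
    stage. All stages are conull, and S maps their intersection onto itself.\<close>
  define W where "W = rec_nat (A \<inter> S ` A) (\<lambda>_ W. W \<inter> {x\<in>A. S x \<in> W} \<inter> S ` (W \<inter> A))"
  have W0: "W 0 = A \<inter> S ` A" and WS: "W (Suc n) = W n \<inter> {x\<in>A. S x \<in> W n} \<inter> S ` (W n \<inter> A)" for n
    by (auto simp: W_def)
  have int1: "measure M (C \<inter> D) = 1" if "C \<in> sets M" "D \<in> sets M" "measure M C = 1" "measure M D = 1" for C D
    using that by (auto simp: prob_eq_1)
  have im1: "measure M (S ` C) = measure M C" if "C \<in> sets M" "C \<subseteq> A" for C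
  proof -
    have "{x\<in>A. S x \<in> S ` C} = C" using that inj by (auto simp: inj_on_def)
    thus ?thesis using meas[OF im[OF that]] by simp
  qed
  have Wm: "W n \<in> sets M \<and> W n \<subseteq> A \<and> measure M (W n) = 1" for n
  proof (induction n)
    case 0
    show ?case using A B int1 by (simp add: W0)
  next
    case (Suc n)
    hence s: "W n \<inter> A = W n" "S ` W n \<in> sets M" "measure M (S ` W n) = 1" using im im1 by auto
    have "measure M (W n \<inter> {x\<in>A. S x \<in> W n} \<inter> S ` W n) = 1"
      using Suc pre meas s by (intro int1 sets.Int) auto
    thus ?case using Suc pre s unfolding WS by auto
  qed
  define V where "V = (\<Inter>n. W n)"
  have V: "V \<in> sets M" unfolding V_def using Wm by auto
  have "AE x in M. x \<in> W n" for n using Wm[of n] by (auto simp: prob_eq_1)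
  hence "AE x in M. \<forall>n. x \<in> W n" by (simp add: AE_all_countable)
  hence VAE: "AE x in M. x \<in> V" by (simp add: V_def)
  have VA: "V \<subseteq> A" using Wm[of 0] by (auto simp: V_def)
  have bij: "S ` V = V"
  proof
    show "S ` V \<subseteq> V" unfolding V_def using WS by blast
    show "V \<subseteq> S ` V"
    proof
      fix y assume y: "y \<in> V"
      then obtain x where x: "x \<in> A" "y = S x" using W0 by (auto simp: V_def)
      have "x \<in> W n" for n
      proof -
        have "y \<in> S ` (W n \<inter> A)" using y WS[of n] by (auto simp: V_def)
        thus ?thesis using x inj by (auto simp: inj_on_def)
      qed
      thus "y \<in> S ` V" using x by (auto simp: V_def)
    qed
  qed
  define S' where "S' x = (if x \<in> V then S x else x)" for x
  have injV: "inj_on S V" using inj VA inj_on_subset by blast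
  have b: "bij S'"
  proof (rule bijI)
    show "inj S'"
    proof (rule injI)
      fix x y assume "S' x = S' y"
      thus "x = y" using bij injV unfolding S'_def by (auto simp: inj_on_def split: if_splits)
    qed
    show "surj S'"
      unfolding surj_def
    proof
      fix y show "\<exists>x. y = S' x"
      proof (cases "y \<in> V")
        case True
        then obtain x where "x \<in> V" "S x = y" using bij by (metis imageE)
        thus ?thesis by (intro exI[of _ x]) (simp add: S'_def)
      qed (auto simp: S'_def)
    qed
  qed
  have pre': "S' -` C = {x\<in>A. S x \<in> C} \<inter> V \<union> (C - V)" for C using VA by (auto simp: S'_def split: if_splits)
  have im': "S' ` C = S ` (C \<inter> V) \<union> (C - V)" for C by (auto simp: S'_def)
  have m1: "S' \<in> M \<rightarrow>\<^sub>M M"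
    using pre V by (intro measurableI) (auto simp: space_UNIV pre')
  have m2: "the_inv_into UNIV S' \<in> M \<rightarrow>\<^sub>M M"
  proof (intro measurableI)
    fix C assume C: "C \<in> sets M"
    have "the_inv_into UNIV S' -` C = S' ` C"
    proof (intro equalityI subsetI)
      fix x assume "x \<in> the_inv_into UNIV S' -` C"
      thus "x \<in> S' ` C" using f_the_inv_into_f_bij_betw[OF b, of x] by (metis UNIV_I image_eqI vimage_eq)
    qed (use the_inv_into_f_f[of S' UNIV] b in \<open>auto simp: bij_def\<close>)
    thus "the_inv_into UNIV S' -` C \<inter> space M \<in> sets M"
      using im[of "C \<inter> V"] C V VA by (auto simp: space_UNIV im')
  qed (simp add: space_UNIV)
  have ae: "AE x in M. S' x = S x" using VAE by eventually_elim (simp add: S'_def)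
  have "distr M M S' = M"
  proof (rule measure_eqI)
    fix C assume "C \<in> sets (distr M M S')"
    hence C: "C \<in> sets M" by simp
    have "emeasure M (S' -` C) = emeasure M {x\<in>A. S x \<in> C}"
      using VAE C V pre by (intro emeasure_eq_AE) (auto simp: pre' elim: eventually_mono)
    also have "\<dots> = emeasure M C" using meas[OF C] by (simp add: emeasure_eq_measure)
    finally show "emeasure (distr M M S') C = emeasure M C" using C m1 by (simp add: emeasure_distr space_UNIV)
  qed simp
  hence "S' \<in> Aut M" using b m1 m2 by (simp add: Aut_def space_UNIV)
  thus ?thesis using ae VA by (intro bexI[of _ S']) (auto simp: S'_def)
qed

section \<open>Partial matchings along orbits\<close>

text \<open>The action law holds at every point, which spares null-set corrections in orbits,
  saturations and invariant sets. \<open>strictify\<close> provides such a version of any action of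
  a countable group.\<close>

locale pmp_action = pmp M + group G for M :: "'a measure" and G :: "('g, 'b) monoid_scheme" (structure) +
  fixes act :: "'g \<Rightarrow> 'a \<Rightarrow> 'a"
  assumes act_mp: "g \<in> carrier G \<Longrightarrow> act g \<in> mp"
    and act_mult: "g \<in> carrier G \<Longrightarrow> h \<in> carrier G \<Longrightarrow> act (g \<otimes> h) x = act g (act h x)"
    and act_one: "act \<one> x = x"
begin

lemma act_inv [simp]: "g \<in> carrier G \<Longrightarrow> act (inv g) (act g x) = x" "g \<in> carrier G \<Longrightarrow> act g (act (inv g) x) = x"
  using act_mult[of "inv g" g x] act_mult[of g "inv g" x] by (auto simp: act_one)

lemma act_image: "g \<in> carrier G \<Longrightarrow> act g ` C = {x. act (inv g) x \<in> C}"
  by (auto simp: image_iff) (metis act_inv(2))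

lemma act_image_sets: "g \<in> carrier G \<Longrightarrow> C \<in> sets M \<Longrightarrow> act g ` C \<in> sets M"
  by (simp add: act_image mp_sets act_mp)

lemma act_image_measure: "g \<in> carrier G \<Longrightarrow> C \<in> sets M \<Longrightarrow> measure M (act g ` C) = measure M C"
  by (simp add: act_image mp_measure act_mp)

definition invariant :: "'a set \<Rightarrow> bool" where
  "invariant Z \<longleftrightarrow> (\<forall>g\<in>carrier G. \<forall>x. act g x \<in> Z \<longleftrightarrow> x \<in> Z)"

lemma invariant_saturation: "invariant {x. \<exists>g\<in>carrier G. act g x \<in> V}"
  unfolding invariant_def
proof (intro ballI allI iffI; clarify)
  fix g x h assume "g \<in> carrier G" "h \<in> carrier G" "act h (act g x) \<in> V"
  thus "\<exists>g\<in>carrier G. act g x \<in> V" by (intro bexI[of _ "h \<otimes> g"]) (auto simp: act_mult)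
next
  fix g x h assume "g \<in> carrier G" "h \<in> carrier G" "act h x \<in> V"
  thus "\<exists>h\<in>carrier G. act h (act g x) \<in> V" by (intro bexI[of _ "h \<otimes> inv g"]) (auto simp: act_mult)
qed

lemma saturation_sets:
  assumes "countable (carrier G)" "V \<in> sets M"
  shows "{x. \<exists>g\<in>carrier G. act g x \<in> V} \<in> sets M"
proof -
  have "{x. \<exists>g\<in>carrier G. act g x \<in> V} = (\<Union>g\<in>carrier G. {x. act g x \<in> V})" by auto
  also have "\<dots> \<in> sets M" using assms mp_sets[OF act_mp] by (intro sets.countable_UN') auto
  finally show ?thesis .
qed

text \<open>A partial map inside the orbits is recorded by the group element k x that moves x. For a
  countable group it is, on countably many measurable pieces, one fixed group element, so
  injectivity suffices for it to preserve the measure.\<close>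

definition matching :: "'a set \<Rightarrow> ('a \<Rightarrow> 'g) \<Rightarrow> bool" where
  "matching A k \<longleftrightarrow> A \<in> sets M \<and> (\<forall>g\<in>carrier G. {x\<in>A. k x = g} \<in> sets M) \<and>
     (\<forall>x\<in>A. k x \<in> carrier G) \<and> inj_on (\<lambda>x. act (k x) x) A"

lemma
  assumes c: "countable (carrier G)" and m: "matching A k" and C: "C \<in> sets M" "C \<subseteq> A"
  shows matching_image_sets: "(\<lambda>x. act (k x) x) ` C \<in> sets M"
    and matching_image_measure: "measure M ((\<lambda>x. act (k x) x) ` C) = measure M C"
proof -
  have e: "(\<lambda>x. act (k x) x) ` C = (\<Union>g\<in>carrier G. act g ` (C \<inter> {x\<in>A. k x = g}))"
    using C m by (auto simp: matching_def)
  have s: "C \<inter> {x\<in>A. k x = g} \<in> sets M" if "g \<in> carrier G" for g using m C that by (auto simp: matching_def)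
  show "(\<lambda>x. act (k x) x) ` C \<in> sets M" unfolding e using s c
    by (intro sets.countable_UN') (auto intro: act_image_sets)
  have "emeasure M ((\<lambda>x. act (k x) x) ` C) = (\<integral>\<^sup>+g. emeasure M (act g ` (C \<inter> {x\<in>A. k x = g})) \<partial>count_space (carrier G))"
    unfolding e
  proof (intro emeasure_UN_countable)
    show "disjoint_family_on (\<lambda>g. act g ` (C \<inter> {x\<in>A. k x = g})) (carrier G)"
      using m unfolding disjoint_family_on_def matching_def inj_on_def by auto
  qed (use c s act_image_sets in auto)
  also have "\<dots> = (\<integral>\<^sup>+g. emeasure M (C \<inter> {x\<in>A. k x = g}) \<partial>count_space (carrier G))"
    using s act_image_measure by (intro nn_integral_cong) (auto simp: emeasure_eq_measure)
  also have "\<dots> = emeasure M (\<Union>g\<in>carrier G. C \<inter> {x\<in>A. k x = g})"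
    using c s by (intro emeasure_UN_countable[symmetric]) (auto simp: disjoint_family_on_def)
  also have "(\<Union>g\<in>carrier G. C \<inter> {x\<in>A. k x = g}) = C" using m C by (auto simp: matching_def)
  finally show "measure M ((\<lambda>x. act (k x) x) ` C) = measure M C" by (simp add: measure_def)
qed

lemma matching_preimage_sets:
  assumes c: "countable (carrier G)" and m: "matching A k" and C: "C \<in> sets M"
  shows "{x\<in>A. act (k x) x \<in> C} \<in> sets M"
proof -
  have "{x\<in>A. act (k x) x \<in> C} = (\<Union>g\<in>carrier G. {x\<in>A. k x = g} \<inter> {x. act g x \<in> C})"
    using m by (auto simp: matching_def)
  also have "\<dots> \<in> sets M" using m c C mp_sets[OF act_mp] by (intro sets.countable_UN') (auto simp: matching_def)
  finally show ?thesis .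
qed

text \<open>The group is enumerated, and at stage n a free source x is matched to h n x if that
  target is free and carries the same label. In the end no orbit contains both a free source and a
  free target of label j. Hence on the saturation Z of the free targets of label j all sources of
  label j are matched, inside Z, and the free targets are the surplus of targets there.\<close>

lemma greedy_matching:
  fixes u v :: "'a \<Rightarrow> nat"
  assumes c: "countable (carrier G)" and S: "S0 \<in> sets M" and T: "T0 \<in> sets M"
    and u: "u \<in> M \<rightarrow>\<^sub>M count_space UNIV" and v: "v \<in> M \<rightarrow>\<^sub>M count_space UNIV"
  shows "\<exists>A k. matching A k \<and> A \<subseteq> S0 \<and> (\<forall>x\<in>A. act (k x) x \<in> T0 \<and> v (act (k x) x) = u x) \<and>
    (\<forall>j. \<exists>Z\<in>sets M. invariant Z \<and>
      measure M {y \<in> T0 - (\<lambda>x. act (k x) x) ` A. v y = j} = measure M {y\<in>T0 \<inter> Z. v y = j} - measure M {x\<in>S0 \<inter> Z. u x = j})"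
proof -
  define h where "h = from_nat_into (carrier G)"
  have ne: "carrier G \<noteq> {}" by auto
  have hG [simp]: "h n \<in> carrier G" for n unfolding h_def using ne by (rule from_nat_into)
  have hs: "\<exists>n. h n = g" if "g \<in> carrier G" for g
    unfolding h_def using from_nat_into_surj[OF c that] by auto
  define step where "step n P = (let Q = {x \<in> fst P. act (h n) x \<in> snd P \<and> u x = v (act (h n) x)} in
      (fst P - Q, snd P - act (h n) ` Q))" for n P
  define P where "P = rec_nat (S0, T0) step"
  define Sn where "Sn n = fst (P n)" for n
  define Tn where "Tn n = snd (P n)" for n
  define An where "An n = {x \<in> Sn n. act (h n) x \<in> Tn n \<and> u x = v (act (h n) x)}" for n
  have P0: "Sn 0 = S0" "Tn 0 = T0" by (auto simp: P_def Sn_def Tn_def)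
  have PS: "Sn (Suc n) = Sn n - An n" "Tn (Suc n) = Tn n - act (h n) ` An n" for n
    by (auto simp: P_def Sn_def Tn_def An_def step_def Let_def)
  have um: "{x. u x = j} \<in> sets M" and vm: "{x. v x = j} \<in> sets M" for j
    using measurable_sets[OF u, of "{j}"] measurable_sets[OF v, of "{j}"] by (auto simp: space_UNIV vimage_def)
  have Am: "An n \<in> sets M" if "Sn n \<in> sets M" "Tn n \<in> sets M" for n
  proof -
    have "An n = Sn n \<inter> {x. act (h n) x \<in> Tn n} \<inter> (\<Union>j. {x. u x = j} \<inter> {x. act (h n) x \<in> {y. v y = j}})"
      by (auto simp: An_def)
    also have "\<dots> \<in> sets M" using that um mp_sets[OF act_mp[OF hG]] mp_sets[OF act_mp[OF hG] vm]
      by (intro sets.Int sets.countable_UN) auto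
    finally show ?thesis .
  qed
  have ST: "Sn n \<in> sets M \<and> Tn n \<in> sets M" for n
    by (induction n) (auto simp: P0 PS S T Am act_image_sets)
  note Am = Am[OF conjunct1[OF ST] conjunct2[OF ST]]
  have dS: "Sn m \<subseteq> Sn n" "Tn m \<subseteq> Tn n" if "n \<le> m" for m n
    using that by (induction rule: dec_induct) (auto simp: PS)
  define A where "A = (\<Union>n. An n)"
  define N where "N x = (LEAST n. x \<in> An n)" for x
  define k where "k x = h (N x)" for x
  have disjA: "m = n" if "x \<in> An m" "x \<in> An n" for x m n
  proof (rule ccontr)
    have *: "x \<notin> Sn (Suc m)" "x \<in> Sn m" "x \<notin> Sn (Suc n)" "x \<in> Sn n" using that by (auto simp: PS An_def)
    assume "m \<noteq> n"
    then consider "Suc m \<le> n" | "Suc n \<le> m" by linarith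
    thus False using * dS(1) by cases (metis subsetD)+
  qed
  have Nx: "N x = n" if "x \<in> An n" for x n
    unfolding N_def using that disjA by (metis LeastI)
  have kx: "k x = h n" if "x \<in> An n" for x n using Nx[OF that] by (simp add: k_def)
  have disjT: "m = n" if "x \<in> An m" "y \<in> An n" "act (h m) x = act (h n) y" for x y m n
  proof (rule ccontr)
    have *: "act (h m) x \<notin> Tn (Suc m)" "act (h m) x \<in> Tn m" "act (h n) y \<notin> Tn (Suc n)" "act (h n) y \<in> Tn n"
      using that(1,2) by (auto simp: PS An_def)
    assume "m \<noteq> n"
    then consider "Suc m \<le> n" | "Suc n \<le> m" by linarith
    thus False using * that(3) dS(2) by cases (metis subsetD)+
  qed
  have inj: "inj_on (\<lambda>x. act (k x) x) A"
  proof (rule inj_onI)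
    fix x y assume "x \<in> A" "y \<in> A" and e: "act (k x) x = act (k y) y"
    then obtain m n where mn: "x \<in> An m" "y \<in> An n" by (auto simp: A_def)
    hence "act (h m) x = act (h n) y" using e kx by simp
    with disjT mn have "m = n" by blast
    thus "x = y" using \<open>act (h m) x = act (h n) y\<close> act_inv(1)[OF hG] by metis
  qed
  have "A \<in> sets M" unfolding A_def using Am by auto
  moreover have "{x\<in>A. k x = g} \<in> sets M" for g
  proof -
    \<comment> \<open>The enumeration may repeat a group element, so several stages can share the
      value g.\<close>
    have "{x\<in>A. k x = g} = (\<Union>n\<in>{n. h n = g}. An n)" using kx by (auto simp: A_def)
    thus ?thesis using Am by auto
  qed
  moreover have "\<forall>x\<in>A. k x \<in> carrier G" by (simp add: k_def)
  ultimately have mat: "matching A k" using inj by (simp add: matching_def)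
  have AS: "A \<subseteq> S0" using dS(1) P0 by (auto simp: A_def An_def)
  have lab: "act (k x) x \<in> T0 \<and> v (act (k x) x) = u x" if x: "x \<in> A" for x
  proof -
    obtain n where n: "x \<in> An n" using x by (auto simp: A_def)
    thus ?thesis using kx[OF n] dS(2)[of 0 n] P0 by (auto simp: An_def)
  qed
  let ?R = "\<lambda>x. act (k x) x"
  \<comment> \<open>Such a pair would have been matched at the stage at which g was tried.\<close>
  have left: "\<not> (act g x \<in> T0 - ?R ` A \<and> v (act g x) = u x)" if x: "x \<in> S0 - A" "g \<in> carrier G" for x g
  proof
    assume *: "act g x \<in> T0 - ?R ` A \<and> v (act g x) = u x"
    obtain n where n: "h n = g" using hs x by blast
    have "x \<in> Sn m" for m using x by (induction m) (auto simp: P0 PS A_def)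
    moreover have "act g x \<in> Tn m" for m
    proof (induction m)
      case (Suc m)
      have "act g x \<notin> act (h m) ` An m" using * kx by (force simp: A_def)
      thus ?case using Suc by (simp add: PS)
    qed (use * P0 in simp)
    ultimately have "x \<in> An n" using * n by (simp add: An_def)
    thus False using x by (auto simp: A_def)
  qed
  have "\<exists>Z\<in>sets M. invariant Z \<and> measure M {y \<in> T0 - ?R ` A. v y = j} = measure M {y\<in>T0 \<inter> Z. v y = j} - measure M {x\<in>S0 \<inter> Z. u x = j}" for j
  proof -
    define V where "V = {y \<in> T0 - ?R ` A. v y = j}"
    \<comment> \<open>This set depends on the outcome of the matching; that is why
      \<open>exchange\<close> asks for its bound on all invariant sets.\<close>
    define Z where "Z = {x. \<exists>g\<in>carrier G. act g x \<in> V}"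
    have RA: "?R ` A \<in> sets M" using matching_image_sets[OF c mat] mat by (simp add: matching_def)
    have "V = (T0 - ?R ` A) \<inter> {y. v y = j}" by (auto simp: V_def)
    hence V: "V \<in> sets M" using T RA vm by auto
    have Z: "Z \<in> sets M" unfolding Z_def using c V by (rule saturation_sets)
    have iZ: "invariant Z" unfolding Z_def by (rule invariant_saturation)
    define X where "X = {x\<in>S0 \<inter> Z. u x = j}"
    have "X = S0 \<inter> Z \<inter> {x. u x = j}" by (auto simp: X_def)
    hence Xm: "X \<in> sets M" using S Z um by auto
    have XA: "X \<subseteq> A"
    proof
      fix x assume x: "x \<in> X"
      then obtain g where "g \<in> carrier G" "act g x \<in> V" by (auto simp: X_def Z_def)
      thus "x \<in> A" using left[of x g] x by (auto simp: X_def V_def)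
    qed
    have "{y\<in>T0 \<inter> Z. v y = j} = V \<union> ?R ` X"
    proof (intro equalityI subsetI)
      fix y assume y: "y \<in> {y\<in>T0 \<inter> Z. v y = j}"
      show "y \<in> V \<union> ?R ` X"
      proof (cases "y \<in> ?R ` A")
        case True
        then obtain x where x: "x \<in> A" "y = ?R x" by blast
        have "x \<in> Z" using y x iZ mat by (auto simp: invariant_def matching_def)
        hence "x \<in> X" using lab[OF x(1)] x AS y by (auto simp: X_def)
        thus ?thesis using x by blast
      qed (use y in \<open>auto simp: V_def\<close>)
    next
      fix y assume "y \<in> V \<union> ?R ` X"
      thus "y \<in> {y\<in>T0 \<inter> Z. v y = j}"
      proof
        assume y: "y \<in> V"
        hence "act \<one> y \<in> V" by (simp add: act_one)
        hence "y \<in> Z" unfolding Z_def by blast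
        thus ?thesis using y by (auto simp: V_def)
      next
        assume "y \<in> ?R ` X"
        then obtain x where x: "x \<in> X" "y = ?R x" by blast
        hence "y \<in> Z" using iZ mat XA by (auto simp: invariant_def matching_def X_def)
        thus ?thesis using lab[of x] x XA by (auto simp: X_def)
      qed
    qed
    hence "measure M {y\<in>T0 \<inter> Z. v y = j} = measure M V + measure M (?R ` X)"
      using V XA matching_image_sets[OF c mat Xm XA] by (simp, intro finite_measure_Union) (auto simp: V_def)
    hence "measure M V = measure M {y\<in>T0 \<inter> Z. v y = j} - measure M X"
      using matching_image_measure[OF c mat Xm XA] by simp
    thus ?thesis using Z iZ unfolding V_def X_def by blast
  qed
  thus ?thesis using mat AS lab by (intro exI[of _ A] exI[of _ k]) auto
qed

text \<open>A first matching respects the labels, and the bound on invariant sets leaves few free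
  targets of each label. A second matching ignores the labels and completes the first up to a null
  set, because both leftovers have the same measure in every invariant set.\<close>

lemma exchange:
  fixes q \<phi> :: "'a \<Rightarrow> nat" and \<epsilon> :: real
  assumes c: "countable (carrier G)"
    and q: "q \<in> M \<rightarrow>\<^sub>M count_space UNIV" and \<phi>: "\<phi> \<in> M \<rightarrow>\<^sub>M count_space UNIV"
    and \<phi>k: "\<And>x. \<phi> x < k"
    and bound: "\<And>j Z. j < k \<Longrightarrow> Z \<in> sets M \<Longrightarrow> invariant Z \<Longrightarrow> measure M {x\<in>Z. \<phi> x = j} - measure M {x\<in>Z. q x = j} \<le> \<epsilon>"
  shows "\<exists>R\<in>Aut M. (\<forall>x. \<exists>g\<in>carrier G. R x = act g x) \<and> measure M {x. \<phi> (R x) \<noteq> q x} \<le> k * \<epsilon>"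
proof -
  have UM: "UNIV \<in> sets M" using sets.top[of M] by (simp add: space_UNIV)
  from greedy_matching[OF c UM UM q \<phi>] obtain A1 k1 where
    g1: "matching A1 k1 \<and> A1 \<subseteq> UNIV \<and> (\<forall>x\<in>A1. act (k1 x) x \<in> UNIV \<and> \<phi> (act (k1 x) x) = q x) \<and>
      (\<forall>j. \<exists>Z\<in>sets M. invariant Z \<and> measure M {y \<in> UNIV - (\<lambda>x. act (k1 x) x) ` A1. \<phi> y = j}
      = measure M {y\<in>UNIV \<inter> Z. \<phi> y = j} - measure M {x\<in>UNIV \<inter> Z. q x = j})"
    by (elim exE) rule
  hence m1: "matching A1 k1" and l1: "\<forall>x\<in>A1. \<phi> (act (k1 x) x) = q x"
    and b1: "\<forall>j. \<exists>Z\<in>sets M. invariant Z \<and> measure M {y \<in> UNIV - (\<lambda>x. act (k1 x) x) ` A1. \<phi> y = j}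
      = measure M {y\<in>UNIV \<inter> Z. \<phi> y = j} - measure M {x\<in>UNIV \<inter> Z. q x = j}"
    by simp_all
  define R1 where "R1 x = act (k1 x) x" for x
  define S0 where "S0 = UNIV - A1"
  define T0 where "T0 = UNIV - R1 ` A1"
  have A1: "A1 \<in> sets M" using m1 by (simp add: matching_def)
  have RA1: "R1 ` A1 \<in> sets M" unfolding R1_def using matching_image_sets[OF c m1 A1] by simp
  have S0: "S0 \<in> sets M" and T0: "T0 \<in> sets M" unfolding S0_def T0_def using UM A1 RA1 by auto
  \<comment> \<open>Constant labels turn the second matching into an unlabelled one.\<close>
  have cz: "(\<lambda>_. 0::nat) \<in> M \<rightarrow>\<^sub>M count_space UNIV" by simp
  from greedy_matching[OF c S0 T0 cz cz] obtain A2 k2 where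
    g2: "matching A2 k2 \<and> A2 \<subseteq> S0 \<and> (\<forall>x\<in>A2. act (k2 x) x \<in> T0 \<and> (0::nat) = 0) \<and>
      (\<forall>j. \<exists>Z\<in>sets M. invariant Z \<and> measure M {y \<in> T0 - (\<lambda>x. act (k2 x) x) ` A2. (0::nat) = j}
      = measure M {y\<in>T0 \<inter> Z. (0::nat) = j} - measure M {x\<in>S0 \<inter> Z. (0::nat) = j})"
    by (elim exE) rule
  hence m2: "matching A2 k2" and A2S: "A2 \<subseteq> S0" and A2T: "\<forall>x\<in>A2. act (k2 x) x \<in> T0" by simp_all
  have b2: "\<exists>Z\<in>sets M. invariant Z \<and> measure M (T0 - (\<lambda>x. act (k2 x) x) ` A2) = measure M (T0 \<inter> Z) - measure M (S0 \<inter> Z)"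
    using g2[THEN conjunct2, THEN conjunct2, THEN conjunct2, THEN spec[of _ 0]] by (simp add: set_diff_eq Int_def)
  define R2 where "R2 x = act (k2 x) x" for x
  have A2: "A2 \<in> sets M" using m2 by (simp add: matching_def)
  obtain Z where Z: "Z \<in> sets M" "invariant Z" "measure M (T0 - R2 ` A2) = measure M (T0 \<inter> Z) - measure M (S0 \<inter> Z)"
    using b2 unfolding R2_def by blast
  \<comment> \<open>R1 moves points inside orbits and so respects Z; the first matching uses up
    equal parts of Z on both sides.\<close>
  have "R1 ` A1 \<inter> Z = R1 ` (A1 \<inter> Z)"
    using Z(2) m1 by (auto simp: R1_def invariant_def matching_def)
  hence "measure M (R1 ` A1 \<inter> Z) = measure M (A1 \<inter> Z)"
    using matching_image_measure[OF c m1, of "A1 \<inter> Z"] A1 Z by (simp add: R1_def)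
  moreover have "measure M (T0 \<inter> Z) = measure M Z - measure M (R1 ` A1 \<inter> Z)"
  proof -
    have "T0 \<inter> Z = Z - (R1 ` A1 \<inter> Z)" by (auto simp: T0_def)
    thus ?thesis using RA1 Z finite_measure_Diff[of Z "R1 ` A1 \<inter> Z"] by simp
  qed
  moreover have "measure M (S0 \<inter> Z) = measure M Z - measure M (A1 \<inter> Z)"
  proof -
    have "S0 \<inter> Z = Z - (A1 \<inter> Z)" by (auto simp: S0_def)
    thus ?thesis using A1 Z finite_measure_Diff[of Z "A1 \<inter> Z"] by simp
  qed
  ultimately have z0: "measure M (T0 - R2 ` A2) = 0" using Z by simp
  define A where "A = A1 \<union> A2"
  define kk where "kk x = (if x \<in> A1 then k1 x else k2 x)" for x
  define S where "S x = act (kk x) x" for x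
  have disj: "A1 \<inter> A2 = {}" using A2S by (auto simp: S0_def)
  have S1: "S x = R1 x" if "x \<in> A1" for x using that by (simp add: S_def R1_def kk_def)
  have S2: "S x = R2 x" if "x \<in> A2" for x using that disj by (auto simp: S_def R2_def kk_def)
  have SA: "S ` A = R1 ` A1 \<union> R2 ` A2" unfolding A_def image_Un using S1 S2 by (simp cong: image_cong)
  have Am: "A \<in> sets M" using A1 A2 by (simp add: A_def)
  have inj: "inj_on S A"
  proof (rule inj_onI)
    fix x y assume xy: "x \<in> A" "y \<in> A" "S x = S y"
    have i1: "inj_on R1 A1" and i2: "inj_on R2 A2" using m1 m2 by (auto simp: matching_def R1_def[abs_def] R2_def[abs_def])
    have "R1 x \<noteq> R2 y" if "x \<in> A1" "y \<in> A2" for x y using that A2T unfolding T0_def R2_def by (metis DiffD2 image_eqI)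
    thus "x = y" using xy i1 i2 S1 S2 unfolding A_def inj_on_def by (metis Un_iff)
  qed
  have mat: "matching A kk" unfolding matching_def
  proof (intro conjI ballI)
    fix g assume g: "g \<in> carrier G"
    have "{x\<in>A. kk x = g} = {x\<in>A1. k1 x = g} \<union> {x\<in>A2. k2 x = g}" using disj by (auto simp: A_def kk_def)
    moreover have "{x\<in>A1. k1 x = g} \<in> sets M" "{x\<in>A2. k2 x = g} \<in> sets M" using m1 m2 g by (auto simp: matching_def)
    ultimately show "{x\<in>A. kk x = g} \<in> sets M" by simp
  qed (use Am m1 m2 inj in \<open>auto simp: A_def kk_def matching_def S_def[abs_def]\<close>)
  have SAm: "S ` A \<in> sets M" unfolding S_def using matching_image_sets[OF c mat Am] by simp
  have "UNIV - S ` A = T0 - R2 ` A2" by (auto simp: SA T0_def)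
  hence SA1: "measure M (S ` A) = 1" using z0 prob_compl[OF SAm] by (simp add: space_UNIV)
  hence A1': "measure M A = 1" using matching_image_measure[OF c mat Am] by (simp add: S_def)
  have meas: "measure M {x\<in>A. S x \<in> C} = measure M C" if C: "C \<in> sets M" for C
  proof -
    have "{x\<in>A. S x \<in> C} \<in> sets M" unfolding S_def using c mat C by (rule matching_preimage_sets)
    hence "measure M {x\<in>A. S x \<in> C} = measure M (S ` {x\<in>A. S x \<in> C})"
      unfolding S_def using matching_image_measure[OF c mat] by simp
    also have "S ` {x\<in>A. S x \<in> C} = C \<inter> S ` A" by auto
    also have "measure M (C \<inter> S ` A) = measure M C"
      using C SAm SA1 by (intro measure_eq_AE) (auto simp: prob_eq_1)
    finally show ?thesis .
  qed
  have pre: "{x\<in>A. S x \<in> C} \<in> sets M" if "C \<in> sets M" for C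
    unfolding S_def using c mat that by (rule matching_preimage_sets)
  have im: "S ` C \<in> sets M" if "C \<in> sets M" "C \<subseteq> A" for C
    unfolding S_def using c mat that by (rule matching_image_sets)
  obtain R where R: "R \<in> Aut M" "\<forall>x. R x = x \<or> x \<in> A \<and> R x = S x" "AE x in M. R x = S x"
    using Aut_extend[OF Am A1' SAm SA1 inj pre im meas] by blast
  have "\<exists>g\<in>carrier G. R x = act g x" for x
  proof (cases "R x = x")
    case True
    thus ?thesis using act_one[of x] by (intro bexI[of _ \<one>]) auto
  next
    case False
    thus ?thesis using R(2) mat unfolding matching_def S_def by blast
  qed
  moreover have "measure M {x. \<phi> (R x) \<noteq> q x} \<le> k * \<epsilon>"
  proof -
    \<comment> \<open>Almost everywhere the labels can disagree only at sources left over by the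
      first matching. These have the measure of the free targets, at most \<epsilon> for each of the
      k labels.\<close>
    have "measure M {x. \<phi> (R x) \<noteq> q x} \<le> measure M S0"
      using R(3) S0 l1 S1 by (intro finite_measure_mono_AE) (auto simp: S0_def R1_def elim!: eventually_mono)
    also have "\<dots> = measure M T0"
      using prob_compl[OF A1] prob_compl[OF RA1] matching_image_measure[OF c m1 A1]
      by (simp add: S0_def T0_def R1_def space_UNIV)
    also have "\<dots> = (\<Sum>j<k. measure M {y\<in>T0. \<phi> y = j})"
    proof -
      have "T0 = (\<Union>j<k. {y\<in>T0. \<phi> y = j})" using \<phi>k by auto
      moreover have "{y\<in>T0. \<phi> y = j} \<in> sets M" for j
        using measurable_sets[OF \<phi>, of "{j}"] T0 by (auto simp: space_UNIV vimage_def Collect_conj_eq)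
      ultimately show ?thesis
        using finite_measure_finite_Union[of "{..<k}" "\<lambda>j. {y\<in>T0. \<phi> y = j}"] by (auto simp: disjoint_family_on_def)
    qed
    also have "\<dots> \<le> (\<Sum>j<k. \<epsilon>)"
    proof (intro sum_mono)
      fix j assume "j \<in> {..<k}"
      moreover obtain Z where "Z \<in> sets M" "invariant Z" "measure M {y\<in>T0. \<phi> y = j} = measure M {y\<in>Z. \<phi> y = j} - measure M {x\<in>Z. q x = j}"
        using b1 unfolding T0_def R1_def[abs_def] by auto
      ultimately show "measure M {y\<in>T0. \<phi> y = j} \<le> \<epsilon>" using bound[of j Z] by simp
    qed
    finally show ?thesis by simp
  qed
  ultimately show ?thesis using R(1) by blast
qed

end

section \<open>Automorphisms of a nonatomic standard space\<close>

definition code :: "(nat \<Rightarrow> 'a set) \<Rightarrow> 'a \<Rightarrow> real" where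
  "code B x = (\<Sum>n. (1 / 3) ^ n * indicator (B n) x)"

lemma code_summable: "summable (\<lambda>n. (1 / 3) ^ n * indicator (B n) x :: real)"
  by (rule summable_comparison_test'[where g="\<lambda>n. (1 / 3) ^ n" and N=0]) (auto simp: indicator_def summable_geometric)

text \<open>The base 3 makes the coding map order the points lexicographically by their memberships.\<close>

lemma code_less:
  assumes "\<And>m. m < n \<Longrightarrow> x \<in> B m \<longleftrightarrow> y \<in> B m" "x \<notin> B n" "y \<in> B n"
  shows "code B x < code B y"
proof -
  let ?t = "\<lambda>x n. (1 / 3) ^ n * indicator (B n) x :: real"
  have "code B x = (\<Sum>m. ?t x (m + Suc n)) + (\<Sum>m<Suc n. ?t x m)"
    unfolding code_def by (rule suminf_split_initial_segment[OF code_summable])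
  also have "(\<Sum>m. ?t x (m + Suc n)) \<le> (\<Sum>m. (1 / 3) ^ Suc n * (1 / 3) ^ m)"
  proof (rule suminf_le)
    show "?t x (m + Suc n) \<le> (1 / 3) ^ Suc n * (1 / 3) ^ m" for m by (auto simp: indicator_def power_add)
    show "summable (\<lambda>m. ?t x (m + Suc n))" by (subst summable_iff_shift) (rule code_summable)
    show "summable (\<lambda>m. (1 / 3 :: real) ^ Suc n * (1 / 3) ^ m)" by (intro summable_mult summable_geometric) auto
  qed
  \<comment> \<open>All terms after the n-th together reach only half of it, so later memberships
    cannot undo the first difference.\<close>
  also have "\<dots> = (1 / 3) ^ n / 2" by (subst suminf_mult) (auto simp: suminf_geometric summable_geometric)
  also have "(\<Sum>m<Suc n. ?t x m) = (\<Sum>m<n. ?t y m)" using assms by (auto simp: indicator_def intro!: sum.cong)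
  also have "(1 / 3) ^ n / 2 + (\<Sum>m<n. ?t y m) < (\<Sum>m<Suc n. ?t y m)" using assms by simp
  also have "\<dots> \<le> code B y" unfolding code_def by (rule sum_le_suminf[OF code_summable]) auto
  finally show ?thesis by simp
qed

lemma code_inj:
  assumes "\<And>x y. x \<noteq> y \<Longrightarrow> \<exists>n. x \<in> B n \<longleftrightarrow> y \<notin> B n"
  shows "inj (code B)"
proof (rule injI, rule ccontr)
  fix x y assume e: "code B x = code B y" and "x \<noteq> y"
  hence ex: "\<exists>n. x \<in> B n \<longleftrightarrow> y \<notin> B n" using assms by blast
  define n where "n = (LEAST n. x \<in> B n \<longleftrightarrow> y \<notin> B n)"
  have "x \<in> B n \<longleftrightarrow> y \<notin> B n" unfolding n_def using ex by (rule LeastI_ex)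
  moreover have "x \<in> B m \<longleftrightarrow> y \<in> B m" if "m < n" for m using not_less_Least[OF that[unfolded n_def]] by blast
  ultimately have "code B x < code B y \<or> code B y < code B x" using code_less[of n x B y] code_less[of n y B x] by metis
  thus False using e by simp
qed

lemma code_measurable:
  assumes "\<And>n. B n \<in> sets M"
  shows "code B \<in> borel_measurable M"
  unfolding code_def[abs_def] using assms by (intro borel_measurable_suminf) auto

text \<open>Closed sets that split K along B n make the indicator of B n continuous on K, and the
  series converges uniformly.\<close>

lemma code_continuous_on:
  fixes K :: "'a::t2_space set"
  assumes "\<And>n. \<exists>C D. closed C \<and> closed D \<and> C \<subseteq> B n \<and> D \<inter> B n = {} \<and> K \<subseteq> C \<union> D"
  shows "continuous_on K (code B)"
proof -
  have ind: "continuous_on K (\<lambda>x. (1 / 3) ^ n * indicator (B n) x :: real)" for n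
  proof -
    obtain C D where cd: "closed C" "closed D" "C \<subseteq> B n" "D \<inter> B n = {}" "K \<subseteq> C \<union> D" using assms by metis
    have "continuous_on C (indicator (B n) :: 'a \<Rightarrow> real)" using cd
      by (subst continuous_on_cong[OF refl, where g="\<lambda>_. 1"]) (auto simp: indicator_def)
    moreover have "continuous_on D (indicator (B n) :: 'a \<Rightarrow> real)" using cd
      by (subst continuous_on_cong[OF refl, where g="\<lambda>_. 0"]) (auto simp: indicator_def)
    ultimately have "continuous_on (C \<union> D) (indicator (B n) :: 'a \<Rightarrow> real)" using cd continuous_on_closed_Un by blast
    thus ?thesis using cd continuous_on_subset by (intro continuous_intros) blast
  qed
  have "uniform_limit K (\<lambda>n x. \<Sum>i<n. (1 / 3) ^ i * indicator (B i) x :: real) (\<lambda>x. \<Sum>i. (1 / 3) ^ i * indicator (B i) x) sequentially"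
    by (rule Weierstrass_m_test[where M="\<lambda>n. (1 / 3) ^ n"]) (auto simp: indicator_def summable_geometric)
  moreover have "\<forall>\<^sub>F n in sequentially. continuous_on K (\<lambda>x. \<Sum>i<n. (1 / 3) ^ i * indicator (B i) x :: real)"
    using ind by (intro always_eventually allI continuous_on_sum) auto
  ultimately show ?thesis unfolding code_def[abs_def]
    by (intro uniform_limit_theorem[OF _ _ sequentially_bot]) auto
qed

locale std_nonatomic = pmp M for M :: "'a::polish_space measure" +
  assumes sets_M: "sets M = sets borel"
    and nonatomic: "A \<in> sets M \<Longrightarrow> measure M A > 0 \<Longrightarrow> \<exists>B\<in>sets M. B \<subseteq> A \<and> 0 < measure M B \<and> measure M B < measure M A"
begin

lemma singleton_null: "measure M {x} = 0"
proof (rule ccontr)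
  assume "measure M {x} \<noteq> 0"
  hence "measure M {x} > 0" using measure_nonneg[of M "{x}"] by linarith
  then obtain B where "B \<subseteq> {x}" "0 < measure M B" "measure M B < measure M {x}"
    using nonatomic[of "{x}"] by (auto simp: sets_M)
  thus False by (cases "B = {}") (auto dest: subset_singletonD)
qed

lemma inner_compact:
  assumes A: "A \<in> sets M" and e: "e > 0"
  obtains K where "compact K" "K \<subseteq> A" "K \<in> sets M" "measure M A - e < measure M K"
proof (cases "measure M A - e < 0")
  case True
  thus ?thesis by (intro that[of "{}"]) auto
next
  case False
  have "ennreal (measure M A - e) < emeasure M A" using False e by (simp add: emeasure_eq_measure ennreal_less_iff)
  also have "\<dots> = (SUP K\<in>{K. K \<subseteq> A \<and> compact K}. emeasure M K)"
    using A sets_M by (intro inner_regular) (auto simp: emeasure_eq_measure)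
  finally obtain K where K: "K \<subseteq> A" "compact K" "ennreal (measure M A - e) < emeasure M K" by (auto simp: less_SUP_iff)
  thus ?thesis using False by (intro that[of K]) (auto simp: sets_M emeasure_eq_measure ennreal_less_iff compact_imp_closed)
qed

text \<open>A form of Lusin's theorem: each B n and its complement are approximated from inside by
  compact sets, and on the intersection of these unions over all n \<open>code_continuous_on\<close>
  applies.\<close>

lemma code_lusin:
  assumes B: "\<And>n. B n \<in> sets M" and X: "X \<in> sets M" "measure M X = 1" and e: "e > 0"
  obtains K where "compact K" "K \<subseteq> X" "measure M K > 1 - e" "continuous_on K (code B)"
proof -
  \<comment> \<open>The compact sets inside B n and inside its complement lose this much each, which
    sums to e / 2 over all n. The set K0 inside X loses less than another e / 2.\<close>
  have half: "0 < e / 8 * (1 / 2) ^ n" for n :: nat using e by simp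
  have "\<forall>n. \<exists>C D. compact C \<and> compact D \<and> C \<subseteq> B n \<and> D \<inter> B n = {} \<and> measure M (C \<union> D) > 1 - e / 4 * (1 / 2) ^ n"
  proof
    fix n
    obtain C where C: "compact C" "C \<subseteq> B n" "C \<in> sets M" "measure M (B n) - e / 8 * (1 / 2) ^ n < measure M C"
      using inner_compact[OF B half] .
    have "UNIV - B n \<in> sets M" using B sets_M by auto
    then obtain D where D: "compact D" "D \<subseteq> UNIV - B n" "D \<in> sets M" "measure M (UNIV - B n) - e / 8 * (1 / 2) ^ n < measure M D"
      using inner_compact[OF _ half] by blast
    have "measure M (C \<union> D) = measure M C + measure M D" using C D by (intro finite_measure_Union) auto
    moreover have "measure M (UNIV - B n) = 1 - measure M (B n)" using prob_compl[OF B] by (simp add: space_UNIV)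
    moreover have "e / 4 * (1 / 2) ^ n = e / 8 * (1 / 2) ^ n + e / 8 * (1 / 2) ^ n" by simp
    ultimately have "measure M (C \<union> D) > 1 - e / 4 * (1 / 2) ^ n" using C(4) D(4) by linarith
    thus "\<exists>C D. compact C \<and> compact D \<and> C \<subseteq> B n \<and> D \<inter> B n = {} \<and> measure M (C \<union> D) > 1 - e / 4 * (1 / 2) ^ n"
      using C D by (intro exI[of _ C] exI[of _ D]) auto
  qed
  then obtain C D where CD: "\<And>n. compact (C n)" "\<And>n. compact (D n)" "\<And>n. C n \<subseteq> B n" "\<And>n. D n \<inter> B n = {}"
    "\<And>n. measure M (C n \<union> D n) > 1 - e / 4 * (1 / 2) ^ n" by metis
  obtain K0 where K0: "compact K0" "K0 \<subseteq> X" "K0 \<in> sets M" "measure M X - e / 2 < measure M K0"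
    using inner_compact[OF X(1), of "e / 2"] e by auto
  define K where "K = K0 \<inter> (\<Inter>n. C n \<union> D n)"
  have cl: "closed (C n \<union> D n)" for n using CD by (intro closed_Un compact_imp_closed)
  have cm: "C n \<union> D n \<in> sets M" for n using cl sets_M by auto
  have "compact K" unfolding K_def using K0 cl by (intro compact_Int_closed) auto
  moreover have "K \<subseteq> X" using K0 by (auto simp: K_def)
  moreover have "continuous_on K (code B)"
  proof (rule code_continuous_on)
    fix n
    show "\<exists>C D. closed C \<and> closed D \<and> C \<subseteq> B n \<and> D \<inter> B n = {} \<and> K \<subseteq> C \<union> D"
      by (rule exI[of _ "C n"], rule exI[of _ "D n"]) (use CD in \<open>auto simp: K_def compact_imp_closed\<close>)
  qed
  moreover have "measure M K > 1 - e"
  proof -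
    let ?N = "\<lambda>n. UNIV - (C n \<union> D n)"
    have N: "?N n \<in> sets M" for n using cl sets_M by auto
    have le: "measure M (?N n) \<le> e / 4 * (1 / 2) ^ n" for n
      using CD(5)[of n] prob_compl[OF cm, of n] by (simp add: space_UNIV)
    have s: "summable (\<lambda>n. e / 4 * (1 / 2) ^ n)" by (intro summable_mult summable_geometric) auto
    have s': "summable (\<lambda>n. measure M (?N n))" using le by (intro summable_comparison_test'[OF s, of 0]) auto
    have "measure M (\<Union>n. ?N n) \<le> (\<Sum>n. measure M (?N n))"
      using N s' by (intro finite_measure_subadditive_countably) auto
    also have "\<dots> \<le> (\<Sum>n. e / 4 * (1 / 2) ^ n)" by (rule suminf_le[OF le s' s])
    also have "\<dots> = e / 2" by (subst suminf_mult) (auto simp: suminf_geometric summable_geometric)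
    finally have "measure M (\<Union>n. ?N n) \<le> e / 2" .
    moreover have "measure M (UNIV - K0) < e / 2" using K0 X prob_compl[of K0] by (simp add: space_UNIV)
    moreover have "measure M (UNIV - K) \<le> measure M (UNIV - K0) + measure M (\<Union>n. ?N n)"
    proof -
      have "UNIV - K = (UNIV - K0) \<union> (\<Union>n. ?N n)" by (auto simp: K_def)
      moreover have "(\<Union>n. ?N n) \<in> sets M" using N by blast
      moreover have "UNIV - K0 \<in> sets M" using sets.compl_sets[OF K0(3)] by (simp add: space_UNIV)
      ultimately show ?thesis using measure_Un_le[of "UNIV - K0" M "\<Union>n. ?N n"] by simp
    qed
    moreover have "K \<in> sets M" using \<open>compact K\<close> sets_M by (auto simp: compact_imp_closed)
    ultimately show ?thesis using prob_compl[of K] by (simp add: space_UNIV)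
  qed
  ultimately show ?thesis using that by blast
qed

section \<open>The uniform coordinate\<close>

text \<open>The probability integral transform of the coding. It respects the order of the codes and
  is uniform on [0, 1] when the codes separate points, so two different codings have the same law
  after this transform and yield an isomorphism between them.\<close>

definition theta :: "(nat \<Rightarrow> 'a set) \<Rightarrow> 'a \<Rightarrow> real" where
  "theta B x = cdf (distr M borel (code B)) (code B x)"

context
  fixes B :: "nat \<Rightarrow> 'a set"
  assumes Bm: "\<And>n. B n \<in> sets M" and sep: "\<And>x y. x \<noteq> y \<Longrightarrow> \<exists>n. x \<in> B n \<longleftrightarrow> y \<notin> B n"
begin

private abbreviation "F \<equiv> cdf (distr M borel (code B))"

lemma code_law: "real_distribution (distr M borel (code B))"
  using code_measurable[of B M] Bm by (simp add: real_distribution_distr)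

interpretation law: real_distribution "distr M borel (code B)" by (rule code_law)

lemma cdf_code: "F r = measure M {y. code B y \<le> r}"
  using code_measurable[of B M] Bm by (simp add: cdf_def measure_distr vimage_def space_UNIV)

lemma theta_eq: "theta B x = measure M {y. code B y \<le> code B x}"
  by (simp add: theta_def cdf_code)

lemma cont_F: "isCont F r"
proof -
  have "measure (distr M borel (code B)) {r} = measure M {x. code B x = r}"
    using code_measurable[of B M] Bm by (simp add: measure_distr vimage_def space_UNIV)
  also have "\<dots> = 0"
  proof (cases "\<exists>x. code B x = r")
    case True
    then obtain x where "code B x = r" by blast
    hence "{x. code B x = r} = {x}" using code_inj[of B] sep by (auto dest: injD)
    thus ?thesis using singleton_null by simp
  qed simp
  finally show ?thesis by (simp add: law.isCont_cdf)
qed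

lemma theta_measurable: "theta B \<in> borel_measurable M"
proof -
  have "continuous_on UNIV F" using cont_F by (simp add: continuous_on_eq_continuous_at)
  hence "F \<in> borel_measurable borel" by (rule borel_measurable_continuous_onI)
  thus ?thesis unfolding theta_def[abs_def] using code_measurable[of B M] Bm by simp
qed

lemma theta_01: "0 \<le> theta B x" "theta B x \<le> 1"
  by (simp_all add: theta_eq)

text \<open>By continuity of F, the set where F is at most t is a closed half-line, and F equals t
  at its end point. The points in question are those with code in this half-line.\<close>

lemma theta_uniform_open:
  assumes t: "0 < t" "t < 1"
  shows "measure M {x. theta B x \<le> t} = t"
proof -
  define S where "S = {r. F r \<le> t}"
  have "\<forall>\<^sub>F r in at_bot. F r < t" using law.cdf_lim_at_bot t by (simp add: order_tendsto_iff)
  then obtain a where a: "F a < t" by (auto simp: eventually_at_bot_linorder)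
  have "\<forall>\<^sub>F r in at_top. F r > t" using law.cdf_lim_at_top_prob t by (simp add: order_tendsto_iff)
  then obtain b where b: "F b > t" by (auto simp: eventually_at_top_linorder)
  have cF: "continuous_on A F" for A using cont_F by (simp add: continuous_at_imp_continuous_on)
  have ab: "a \<le> b" using a b law.cdf_nondecreasing[of b a] by linarith
  obtain s where s: "F s = t" using IVT'[of F a t b] a b ab cF by auto
  have "closed S" unfolding S_def using cF by (intro closed_Collect_le) auto
  moreover have bd: "bdd_above S"
  proof (rule bdd_aboveI)
    fix r assume "r \<in> S"
    thus "r \<le> b" using b law.cdf_nondecreasing[of b r] by (force simp: S_def)
  qed
  moreover have sS: "s \<in> S" using s by (simp add: S_def)
  ultimately have "Sup S \<in> S" by (intro closed_contains_Sup) auto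
  hence "F (Sup S) \<le> t" by (simp add: S_def)
  moreover have "F (Sup S) \<ge> t" using law.cdf_nondecreasing[of s "Sup S"] cSup_upper[OF sS bd] s by simp
  ultimately have Fs: "F (Sup S) = t" by simp
  have "S = {..Sup S}"
  proof
    show "S \<subseteq> {..Sup S}" using cSup_upper bd by auto
    show "{..Sup S} \<subseteq> S" using law.cdf_nondecreasing Fs by (fastforce simp: S_def)
  qed
  hence "{x. theta B x \<le> t} = {x. code B x \<le> Sup S}" by (auto simp: theta_def S_def)
  thus ?thesis using Fs cdf_code by simp
qed

lemma theta_law_cdf: "cdf (distr M borel (theta B)) t = max 0 (min 1 t)"
proof -
  have e: "cdf (distr M borel (theta B)) t = measure M {x. theta B x \<le> t}" for t
    using theta_measurable by (simp add: cdf_def measure_distr vimage_def space_UNIV)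
  consider "0 < t" "t < 1" | "t \<ge> 1" | "t \<le> 0" by linarith
  thus ?thesis
  proof cases
    case 2
    hence "{x. theta B x \<le> t} = space M" by (auto simp: space_UNIV intro: order_trans[OF theta_01(2)])
    thus ?thesis using 2 by (simp add: e prob_space)
  next
    case 3
    have "measure M {x. theta B x \<le> t} \<le> s" if "0 < s" "s < 1" for s
    proof -
      have "{x. theta B x \<le> s} \<in> sets M" using measurable_sets[OF theta_measurable, of "{..s}"] by (simp add: vimage_def space_UNIV)
      hence "measure M {x. theta B x \<le> t} \<le> measure M {x. theta B x \<le> s}" using 3 that by (intro finite_measure_mono) auto
      thus ?thesis using theta_uniform_open that by simp
    qed
    hence "measure M {x. theta B x \<le> t} \<le> 0" by (intro dense_ge_bounded[of 0 1]) auto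
    thus ?thesis using 3 e measure_nonneg[of M "{x. theta B x \<le> t}"] by simp
  qed (simp add: e theta_uniform_open)
qed

lemma theta_law: "real_distribution (distr M borel (theta B))"
  using theta_measurable by (simp add: real_distribution_distr)

lemma theta_point_null: "measure M {x. theta B x = t} = 0"
proof -
  interpret th: real_distribution "distr M borel (theta B)" by (rule theta_law)
  have "isCont (cdf (distr M borel (theta B))) t" unfolding theta_law_cdf by (intro continuous_intros)
  thus ?thesis using theta_measurable by (simp add: th.isCont_cdf measure_distr vimage_def space_UNIV)
qed

lemma theta_interval: "a \<le> b \<Longrightarrow> 0 \<le> a \<Longrightarrow> b \<le> 1 \<Longrightarrow> measure M {x. a \<le> theta B x \<and> theta B x \<le> b} = b - a"
proof -
  assume ab: "a \<le> b" "0 \<le> a" "b \<le> 1"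
  have m: "{x. theta B x \<le> t} \<in> sets M" "{x. theta B x = t} \<in> sets M" "{x. theta B x < t} \<in> sets M" for t
    using measurable_sets[OF theta_measurable, of "{..t}"] measurable_sets[OF theta_measurable, of "{t}"]
      measurable_sets[OF theta_measurable, of "{..<t}"] by (auto simp: vimage_def space_UNIV)
  have c: "measure M {x. theta B x \<le> t} = max 0 (min 1 t)" for t
    using theta_law_cdf[of t] theta_measurable by (simp add: cdf_def measure_distr vimage_def space_UNIV)
  have "{x. theta B x \<le> a} = {x. theta B x < a} \<union> {x. theta B x = a}" by auto
  hence "measure M {x. theta B x \<le> a} = measure M {x. theta B x < a} + measure M {x. theta B x = a}"
    using m by (simp, intro finite_measure_Union) auto
  hence "measure M {x. theta B x < a} = a" using c[of a] ab theta_point_null by simp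
  moreover have "{x. a \<le> theta B x \<and> theta B x \<le> b} = {x. theta B x \<le> b} - {x. theta B x < a}" by auto
  ultimately show ?thesis using ab c[of b] m finite_measure_Diff[of "{x. theta B x \<le> b}" "{x. theta B x < a}"] by fastforce
qed

text \<open>Two points share a value of \<open>theta\<close> only if F is constant between their
  codes, hence equal to its value at a rational in between. Deleting these countably many null level
  sets leaves \<open>theta\<close> injective. Borel images are obtained by exhausting the space, up
  to a null set, by compact sets on which \<open>theta\<close> is continuous.\<close>

lemma theta_coding: "\<exists>X\<in>sets M. measure M X = 1 \<and> inj_on (theta B) X \<and> (\<forall>C\<in>sets M. theta B ` (C \<inter> X) \<in> sets borel)"
proof -
  define X0 where "X0 = {x. \<forall>\<rho>\<in>\<rat>. theta B x \<noteq> F \<rho>}"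
  have N: "{x. theta B x = t} \<in> null_sets M" for t
    using measurable_sets[OF theta_measurable, of "{t}"] theta_point_null
    by (auto simp: null_sets_def emeasure_eq_measure vimage_def space_UNIV)
  have "UNIV - X0 = (\<Union>\<rho>\<in>\<rat>. {x. theta B x = F \<rho>})" by (auto simp: X0_def)
  also have "\<dots> \<in> null_sets M" using N countable_rat by (intro null_sets_UN') auto
  finally have n0: "UNIV - X0 \<in> null_sets M" .
  have "UNIV - (UNIV - X0) \<in> sets M" using null_setsD2[OF n0] sets_M by auto
  hence X0m: "X0 \<in> sets M" by (simp add: double_diff)
  have X01: "measure M X0 = 1" using prob_compl[OF X0m] n0 by (simp add: null_sets_def measure_def space_UNIV)
  have injX0: "inj_on (theta B) X0"
  proof -
    have "theta B x \<noteq> theta B y" if xy: "x \<in> X0" "code B x < code B y" for x y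
    proof
      assume e: "theta B x = theta B y"
      obtain \<rho> where \<rho>: "\<rho> \<in> \<rat>" "code B x < \<rho>" "\<rho> < code B y" using Rats_dense_in_real[OF xy(2)] by blast
      have "F (code B x) \<le> F \<rho>" "F \<rho> \<le> F (code B y)" using \<rho> by (intro law.cdf_nondecreasing; simp)+
      hence "theta B x = F \<rho>" using e by (simp add: theta_def)
      thus False using xy(1) \<rho>(1) unfolding X0_def by blast
    qed
    thus ?thesis using code_inj[of B] sep by (intro inj_onI) (metis injD linorder_less_linear)
  qed
  have "\<exists>K. compact K \<and> K \<subseteq> X0 \<and> measure M K > 1 - 1 / real (Suc j) \<and> continuous_on K (code B)" for j
    by (rule code_lusin[of B X0 "1 / real (Suc j)"]) (use Bm X0m X01 in auto)
  then obtain K where K: "\<And>j. compact (K j)" "\<And>j. K j \<subseteq> X0" "\<And>j. measure M (K j) > 1 - 1 / real (Suc j)"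
    "\<And>j. continuous_on (K j) (code B)" by metis
  define X where "X = (\<Union>j. K j)"
  have Km: "K j \<in> sets M" for j using K(1)[of j] sets_M by (auto simp: compact_imp_closed)
  have Xm: "X \<in> sets M" unfolding X_def using Km by auto
  have "measure M X \<ge> 1"
  proof (rule ccontr)
    assume "\<not> ?thesis"
    then obtain j where "1 / real (Suc j) < 1 - measure M X" using reals_Archimedean[of "1 - measure M X"] by (auto simp: inverse_eq_divide)
    moreover have "measure M (K j) \<le> measure M X" using Xm by (intro finite_measure_mono) (auto simp: X_def)
    ultimately show False using K(3)[of j] by linarith
  qed
  hence X1: "measure M X = 1" using prob_le_1[of X] by linarith
  have XX0: "X \<subseteq> X0" using K by (auto simp: X_def)
  have injX: "inj_on (theta B) X" using injX0 XX0 inj_on_subset by blast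
  have cont: "continuous_on (K j) (theta B)" for j
    unfolding theta_def[abs_def]
    by (rule continuous_on_compose2[of UNIV F "K j" "code B"]) (auto simp: cont_F K continuous_at_imp_continuous_on)
  \<comment> \<open>Closed sets have compact images, and injectivity lets images commute with
    complements, so the property passes to the generated sigma-algebra.\<close>
  have img: "theta B ` (C \<inter> K j) \<in> sets borel" if "C \<in> sigma_sets UNIV {S. closed S}" for C j
    using that
  proof induction
    case (Basic C)
    hence "compact (C \<inter> K j)" using K(1) by (metis closed_Int_compact mem_Collect_eq)
    hence "compact (theta B ` (C \<inter> K j))" using cont continuous_on_subset by (intro compact_continuous_image) blast+
    thus ?case by (simp add: compact_imp_closed)
  next
    case (Compl C)
    have "theta B ` ((UNIV - C) \<inter> K j) = theta B ` K j - theta B ` (C \<inter> K j)"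
      using injX unfolding X_def inj_on_def by blast
    moreover have "compact (theta B ` K j)" using cont K by (intro compact_continuous_image) auto
    ultimately show ?case using Compl.IH by (simp add: compact_imp_closed)
  next
    case (Union C)
    have "theta B ` (\<Union> (range C) \<inter> K j) = (\<Union>i. theta B ` (C i \<inter> K j))" by auto
    thus ?case using Union.IH by auto
  qed simp
  have "theta B ` (C \<inter> X) \<in> sets borel" if "C \<in> sets M" for C
  proof -
    have "C \<in> sigma_sets UNIV {S. closed S}" using that sets_M by (simp add: borel_eq_closed)
    moreover have "theta B ` (C \<inter> X) = (\<Union>j. theta B ` (C \<inter> K j))" by (auto simp: X_def)
    ultimately show ?thesis using img by auto
  qed
  thus ?thesis using Xm X1 injX by blast
qed

end

lemma theta_same_law:
  assumes "\<And>n. B n \<in> sets M" "\<And>x y. x \<noteq> y \<Longrightarrow> \<exists>n. x \<in> B n \<longleftrightarrow> y \<notin> B n"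
    and "\<And>n. B' n \<in> sets M" "\<And>x y. x \<noteq> y \<Longrightarrow> \<exists>n. x \<in> B' n \<longleftrightarrow> y \<notin> B' n" and C: "C \<in> sets borel"
  shows "measure M {x. theta B x \<in> C} = measure M {x. theta B' x \<in> C}"
proof -
  have "distr M borel (theta B) = distr M borel (theta B')"
    using assms theta_law theta_law_cdf by (intro cdf_unique) auto
  moreover have "measure M {x. theta B x \<in> C} = measure (distr M borel (theta B)) C"
    using theta_measurable[of B] assms by (simp add: measure_distr vimage_def space_UNIV)
  moreover have "measure M {x. theta B' x \<in> C} = measure (distr M borel (theta B')) C"
    using theta_measurable[of B'] assms by (simp add: measure_distr vimage_def space_UNIV)
  ultimately show ?thesis by simp
qed

text \<open>The codings list the labels in increasing order, so the points with label at most j fill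
  the values of \<open>theta\<close> up to the measure of their set. S joins points with equal
  values of \<open>theta\<close>; hence labels differ only where this value lies between the
  thresholds of P and q for some j.\<close>

lemma Aut_matching_labels:
  fixes P q :: "'a \<Rightarrow> nat"
  assumes P: "P \<in> M \<rightarrow>\<^sub>M count_space UNIV" "\<And>x. P x < k" and q: "q \<in> M \<rightarrow>\<^sub>M count_space UNIV" "\<And>x. q x < k"
  shows "\<exists>S\<in>Aut M. measure M {x. P (S x) \<noteq> q x} \<le> (\<Sum>j<k. \<bar>measure M {x. P x \<le> j} - measure M {x. q x \<le> j}\<bar>)"
proof -
  obtain \<B> :: "'a set set" where \<B>: "countable \<B>" "topological_basis \<B>" using ex_countable_basis by blast
  have \<B>ne: "\<B> \<noteq> {}" using topological_basisE[OF \<B>(2) open_UNIV, of undefined] by auto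
  \<comment> \<open>The first k sets let the label dominate the order of the codes; the countable
    base that follows separates the points.\<close>
  define B where "B p n = (if n < k then {x. n < p x} else from_nat_into \<B> (n - k))" for p :: "'a \<Rightarrow> nat" and n
  have Bm: "B p n \<in> sets M" if "p \<in> M \<rightarrow>\<^sub>M count_space UNIV" for p n
  proof -
    have "{x. n < p x} \<in> sets M" using measurable_sets[OF that, of "{n<..}"] by (simp add: vimage_def space_UNIV)
    moreover have "open (from_nat_into \<B> m)" for m
      using from_nat_into[OF \<B>ne] topological_basis_open[OF \<B>(2)] by blast
    ultimately show ?thesis using sets_M by (simp add: B_def)
  qed
  have sep: "\<exists>n. x \<in> B p n \<longleftrightarrow> y \<notin> B p n" if xy: "x \<noteq> y" for x y and p :: "'a \<Rightarrow> nat"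
  proof -
    obtain U where "open U" "x \<in> U" "y \<notin> U" using t1_space[OF xy] by blast
    then obtain V where V: "V \<in> \<B>" "x \<in> V" "V \<subseteq> U" using topological_basisE[OF \<B>(2)] by metis
    obtain m where "from_nat_into \<B> m = V" using from_nat_into_surj[OF \<B>(1) V(1)] by blast
    thus ?thesis using V \<open>y \<notin> U\<close> by (intro exI[of _ "m + k"]) (auto simp: B_def)
  qed
  have mono: "code (B p) x < code (B p) y" if pk: "\<And>x. p x < k" and lt: "p x < p y" for x y and p :: "'a \<Rightarrow> nat"
  proof (rule code_less[of "p x"])
    show "x \<in> B p m \<longleftrightarrow> y \<in> B p m" if "m < p x" for m using that lt pk[of x] by (simp add: B_def)
  qed (use lt pk[of x] in \<open>auto simp: B_def\<close>)
  have thr: "p x \<le> j \<Longrightarrow> theta (B p) x \<le> measure M {x. p x \<le> j}" "\<not> p x \<le> j \<Longrightarrow> measure M {x. p x \<le> j} \<le> theta (B p) x"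
    if p: "p \<in> M \<rightarrow>\<^sub>M count_space UNIV" "\<And>x. p x < k" for p x j
  proof -
    have s1: "{x. p x \<le> j} \<in> sets M" using measurable_sets[OF p(1), of "{..j}"] by (simp add: vimage_def space_UNIV)
    have s2: "{y. code (B p) y \<le> code (B p) x} \<in> sets M"
      using measurable_sets[OF code_measurable[of "B p" M], of "{..code (B p) x}"] Bm[OF p(1)] by (simp add: vimage_def space_UNIV)
    have e: "theta (B p) x = measure M {y. code (B p) y \<le> code (B p) x}" for x
      by (rule theta_eq[of "B p"]) (rule Bm[OF p(1)], rule sep)
    have mono': "code (B p) x < code (B p) y" if "p x < p y" for x y using mono[of p x y] p(2) that by blast
    show "theta (B p) x \<le> measure M {x. p x \<le> j}" if "p x \<le> j"
    proof -
      have "p y \<le> j" if "code (B p) y \<le> code (B p) x" for y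
        using mono'[of x y] that \<open>p x \<le> j\<close> by linarith
      thus ?thesis unfolding e using s1 by (intro finite_measure_mono) auto
    qed
    show "measure M {x. p x \<le> j} \<le> theta (B p) x" if "\<not> p x \<le> j"
    proof -
      have "code (B p) y \<le> code (B p) x" if "p y \<le> j" for y
        using mono'[of y x] that \<open>\<not> p x \<le> j\<close> by linarith
      thus ?thesis unfolding e using s2 by (intro finite_measure_mono) auto
    qed
  qed
  have bq: "\<And>n. B q n \<in> sets M" and bP: "\<And>n. B P n \<in> sets M" by (rule Bm[OF q(1)]) (rule Bm[OF P(1)])
  have sq: "\<And>x y. x \<noteq> y \<Longrightarrow> \<exists>n. x \<in> B q n \<longleftrightarrow> y \<notin> B q n"
    and sP: "\<And>x y. x \<noteq> y \<Longrightarrow> \<exists>n. x \<in> B P n \<longleftrightarrow> y \<notin> B P n" by (rule sep, assumption)+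
  obtain X where X: "X \<in> sets M" "measure M X = 1" "inj_on (theta (B q)) X" "\<And>C. C \<in> sets M \<Longrightarrow> theta (B q) ` (C \<inter> X) \<in> sets borel"
    using theta_coding[of "B q", OF bq sq] by blast
  obtain Y where Y: "Y \<in> sets M" "measure M Y = 1" "inj_on (theta (B P)) Y" "\<And>C. C \<in> sets M \<Longrightarrow> theta (B P) ` (C \<inter> Y) \<in> sets borel"
    using theta_coding[of "B P", OF bP sP] by blast
  let ?f = "theta (B q)" and ?g = "theta (B P)"
  have tf: "?f \<in> borel_measurable M" and tg: "?g \<in> borel_measurable M"
    using theta_measurable[of "B q", OF bq sq] theta_measurable[of "B P", OF bP sP] by simp_all
  have fm: "{x. ?f x \<in> C} \<in> sets M" and gm: "{x. ?g x \<in> C} \<in> sets M" if "C \<in> sets borel" for C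
    using measurable_sets[OF tf that] measurable_sets[OF tg that]
    by (simp_all add: vimage_def space_UNIV)
  have law: "measure M {x. ?f x \<in> C} = measure M {x. ?g x \<in> C}" if "C \<in> sets borel" for C
    by (rule theta_same_law[of "B q" "B P" C, OF bq sq bP sP that])
  have UM: "UNIV \<in> sets M" using sets.top[of M] by (simp add: space_UNIV)
  have fX: "?f ` X \<in> sets borel" and gY: "?g ` Y \<in> sets borel" using X(4)[OF UM] Y(4)[OF UM] by simp_all
  \<comment> \<open>The points of X whose value of \<open>theta\<close> is also attained on Y. This
    set is conull because the two coordinates have the same law.\<close>
  define A where "A = X \<inter> {x. ?f x \<in> ?g ` Y}"
  define S where "S x = inv_into Y ?g (?f x)" for x
  have Sx: "S x \<in> Y" "?g (S x) = ?f x" if "x \<in> A" for x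
    using that inv_into_into[of "?f x" ?g Y] f_inv_into_f[of "?f x" ?g Y] by (auto simp: A_def S_def)
  have SA: "y \<in> S ` C \<longleftrightarrow> y \<in> Y \<and> ?g y \<in> ?f ` C" if "C \<subseteq> A" for y C
  proof
    assume "y \<in> S ` C"
    then obtain x where "x \<in> C" "y = S x" by blast
    thus "y \<in> Y \<and> ?g y \<in> ?f ` C" using Sx[of x] that by auto
  next
    assume y: "y \<in> Y \<and> ?g y \<in> ?f ` C"
    then obtain x where x: "x \<in> C" "?g y = ?f x" by blast
    have "S x = inv_into Y ?g (?g y)" using x by (simp add: S_def)
    also have "\<dots> = y" using Y(3) y by (simp add: inv_into_f_f)
    finally show "y \<in> S ` C" using x by blast
  qed
  have A: "A \<in> sets M" unfolding A_def using X fm[OF gY] by simp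
  have full: "measure M {y. ?g y \<in> ?g ` Y} = 1" "measure M {y. ?f y \<in> ?f ` X} = 1"
  proof -
    have "measure M Y \<le> measure M {y. ?g y \<in> ?g ` Y}" using gm[OF gY] by (intro finite_measure_mono) auto
    thus "measure M {y. ?g y \<in> ?g ` Y} = 1" using Y prob_le_1 by (metis antisym)
    have "measure M X \<le> measure M {y. ?f y \<in> ?f ` X}" using fm[OF fX] by (intro finite_measure_mono) auto
    thus "measure M {y. ?f y \<in> ?f ` X} = 1" using X prob_le_1 by (metis antisym)
  qed
  have cap1: "measure M (C \<inter> D) = measure M C" if "C \<in> sets M" "D \<in> sets M" "measure M D = 1" for C D
    using that by (intro measure_eq_AE) (auto simp: prob_eq_1)
  have A1: "measure M A = 1" unfolding A_def using cap1[OF X(1) fm[OF gY]] law[OF gY] full X by simp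
  have im: "S ` C \<in> sets M" if "C \<in> sets M" "C \<subseteq> A" for C
  proof -
    have "S ` C = Y \<inter> {y. ?g y \<in> ?f ` (C \<inter> X)}" using SA[OF that(2)] that by (auto simp: A_def Int_absorb2)
    thus ?thesis using Y gm[OF X(4)[OF that(1)]] by simp
  qed
  have pre: "{x\<in>A. S x \<in> C} = A \<inter> {x. ?f x \<in> ?g ` (C \<inter> Y)}" for C
  proof -
    have "S x \<in> C \<longleftrightarrow> ?f x \<in> ?g ` (C \<inter> Y)" if xA: "x \<in> A" for x
    proof
      assume "S x \<in> C"
      thus "?f x \<in> ?g ` (C \<inter> Y)" using Sx[OF xA] by (metis IntI imageI)
    next
      assume "?f x \<in> ?g ` (C \<inter> Y)"
      then obtain z where z: "z \<in> C" "z \<in> Y" "?g (S x) = ?g z" using Sx[OF xA] by auto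
      hence "S x = z" using Y(3) Sx(1)[OF xA] by (auto dest: inj_onD)
      thus "S x \<in> C" using z by simp
    qed
    thus ?thesis by auto
  qed
  have pre_sets: "{x\<in>A. S x \<in> C} \<in> sets M" if "C \<in> sets M" for C
    unfolding pre using A fm[OF Y(4)[OF that]] by simp
  have meas: "measure M {x\<in>A. S x \<in> C} = measure M C" if C: "C \<in> sets M" for C
  proof -
    have "measure M {x\<in>A. S x \<in> C} = measure M {x. ?f x \<in> ?g ` (C \<inter> Y)}"
      unfolding pre using cap1[OF fm[OF Y(4)[OF C]] A A1] by (simp add: Int_commute)
    also have "\<dots> = measure M {y. ?g y \<in> ?g ` (C \<inter> Y)}" using law[OF Y(4)[OF C]] .
    also have "\<dots> = measure M ({y. ?g y \<in> ?g ` (C \<inter> Y)} \<inter> Y)" using cap1[OF gm[OF Y(4)[OF C]] Y(1,2)] by simp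
    also have "{y. ?g y \<in> ?g ` (C \<inter> Y)} \<inter> Y = C \<inter> Y" using Y(3) by (auto simp: inj_on_def)
    finally show ?thesis using cap1[OF C Y(1,2)] by simp
  qed
  have inj: "inj_on S A"
  proof (rule inj_onI)
    fix x y assume "x \<in> A" "y \<in> A" "S x = S y"
    hence "?f x = ?f y" using Sx(2) by metis
    thus "x = y" using X(3) \<open>x \<in> A\<close> \<open>y \<in> A\<close> by (auto simp: A_def inj_on_def)
  qed
  have SA1: "measure M (S ` A) = 1"
  proof -
    have "{x\<in>A. S x \<in> S ` A} = A" by auto
    thus ?thesis using meas[OF im[OF A subset_refl]] A1 by simp
  qed
  obtain S' where S': "S' \<in> Aut M" "AE x in M. S' x = S x"
    using Aut_extend[OF A A1 im[OF A subset_refl] SA1 inj pre_sets im meas] by blast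
  define a where "a j = measure M {x. P x \<le> j}" for j
  define b where "b j = measure M {x. q x \<le> j}" for j
  have "measure M {x. P (S' x) \<noteq> q x} \<le> measure M (\<Union>j<k. {x. min (a j) (b j) \<le> ?f x \<and> ?f x \<le> max (a j) (b j)})"
  proof (rule finite_measure_mono_AE)
    have "AE x in M. x \<in> A" using A A1 by (simp add: prob_eq_1)
    thus "AE x in M. x \<in> {x. P (S' x) \<noteq> q x} \<longrightarrow> x \<in> (\<Union>j<k. {x. min (a j) (b j) \<le> ?f x \<and> ?f x \<le> max (a j) (b j)})"
      using S'(2)
    proof eventually_elim
      case (elim x)
      show ?case
      proof
        assume "x \<in> {x. P (S' x) \<noteq> q x}"
        hence ne: "P (S x) \<noteq> q x" using elim by simp
        \<comment> \<open>For the smaller label j exactly one of the two labels is at most j, which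
          puts the common value of \<open>theta\<close> between the two thresholds.\<close>
        define j where "j = min (P (S x)) (q x)"
        have j: "j < k" using P(2)[of "S x"] by (simp add: j_def)
        have g: "?g (S x) = ?f x" using Sx elim by blast
        have "min (a j) (b j) \<le> ?f x \<and> ?f x \<le> max (a j) (b j)"
        proof (cases "P (S x) \<le> j")
          case True
          hence "\<not> q x \<le> j" using ne by (auto simp: j_def)
          thus ?thesis using thr(1)[OF P True] thr(2)[OF q, of x j] g by (auto simp: a_def b_def min_le_iff_disj le_max_iff_disj)
        next
          case False
          hence "q x \<le> j" by (auto simp: j_def)
          thus ?thesis using thr(2)[OF P False] thr(1)[OF q, of x j] g by (auto simp: a_def b_def min_le_iff_disj le_max_iff_disj)
        qed
        thus "x \<in> (\<Union>j<k. {x. min (a j) (b j) \<le> ?f x \<and> ?f x \<le> max (a j) (b j)})" using j by blast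
      qed
    qed
    have "{x. c \<le> ?f x \<and> ?f x \<le> d} \<in> sets M" for c d using fm[of "{c..d}"] by simp
    thus "(\<Union>j<k. {x. min (a j) (b j) \<le> ?f x \<and> ?f x \<le> max (a j) (b j)}) \<in> sets M" by auto
  qed
  also have "\<dots> \<le> (\<Sum>j<k. measure M {x. min (a j) (b j) \<le> ?f x \<and> ?f x \<le> max (a j) (b j)})"
  proof (rule finite_measure_subadditive_finite)
    have "{x. c \<le> ?f x \<and> ?f x \<le> d} \<in> sets M" for c d using fm[of "{c..d}"] by simp
    thus "(\<lambda>j. {x. min (a j) (b j) \<le> ?f x \<and> ?f x \<le> max (a j) (b j)}) ` {..<k} \<subseteq> sets M" by auto
  qed simp
  also have "\<dots> = (\<Sum>j<k. \<bar>a j - b j\<bar>)"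
  proof (intro sum.cong refl)
    fix j
    have "measure M {x. min (a j) (b j) \<le> ?f x \<and> ?f x \<le> max (a j) (b j)} = max (a j) (b j) - min (a j) (b j)"
      by (rule theta_interval[of "B q"]) (use bq sq in \<open>auto simp: a_def b_def min_def max_def\<close>)
    thus "measure M {x. min (a j) (b j) \<le> ?f x \<and> ?f x \<le> max (a j) (b j)} = \<bar>a j - b j\<bar>" by (simp add: min_def max_def)
  qed
  finally show ?thesis using S'(1) unfolding a_def b_def by blast
qed

end

section \<open>Random Folner centres\<close>

lemma (in pmp) count_space_rel_sets:
  fixes f g :: "'a \<Rightarrow> nat"
  assumes "f \<in> M \<rightarrow>\<^sub>M count_space UNIV" "g \<in> M \<rightarrow>\<^sub>M count_space UNIV"
  shows "{x. Q (f x) (g x)} \<in> sets M"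
proof -
  have s: "{x. f x = a} \<in> sets M" "{x. g x = a} \<in> sets M" for a
    using assms[THEN measurable_sets, of "{a}"] by (simp_all add: vimage_def space_UNIV)
  have "{x. Q (f x) (g x)} = (\<Union>a. \<Union>b\<in>{b. Q a b}. {x. f x = a} \<inter> {x. g x = b})" by auto
  also have "\<dots> \<in> sets M" using s by (intro sets.countable_UN' sets.Int) auto
  finally show ?thesis .
qed

context std_nonatomic
begin

text \<open>The range of an injective Borel function f is cut into intervals of length 1 / (m + 1).
  If S x and T x share a piece, then f (S x) and f (T x) are this close, and the measure of that
  event decreases to the measure of S x = T x, which is 0.\<close>

lemma fine_pieces:
  assumes FP: "finite FP" and d: "\<delta> > 0"
    and S: "\<And>S T. (S, T) \<in> FP \<Longrightarrow> S \<in> M \<rightarrow>\<^sub>M M \<and> T \<in> M \<rightarrow>\<^sub>M M \<and> (AE x in M. S x \<noteq> T x)"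
  shows "\<exists>N p. p \<in> M \<rightarrow>\<^sub>M count_space {..<N::nat} \<and> (\<forall>(S, T)\<in>FP. measure M {x. p (S x) = p (T x)} \<le> \<delta>)"
proof -
  obtain \<B> :: "'a set set" where \<B>: "countable \<B>" "topological_basis \<B>" using ex_countable_basis by blast
  have \<B>ne: "\<B> \<noteq> {}" using topological_basisE[OF \<B>(2) open_UNIV, of undefined] by auto
  define f where "f = code (from_nat_into \<B>)"
  have op: "open (from_nat_into \<B> m)" for m
    using from_nat_into[OF \<B>ne] topological_basis_open[OF \<B>(2)] by blast
  have fm: "f \<in> borel_measurable M" unfolding f_def using op sets_M by (intro code_measurable) auto
  have inj: "inj f" unfolding f_def
  proof (rule code_inj)
    fix x y :: 'a assume "x \<noteq> y"
    then obtain U where "open U" "x \<in> U" "y \<notin> U" using t1_space by blast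
    then obtain V where V: "V \<in> \<B>" "x \<in> V" "V \<subseteq> U" using topological_basisE[OF \<B>(2)] by metis
    obtain m where "from_nat_into \<B> m = V" using from_nat_into_surj[OF \<B>(1) V(1)] by blast
    thus "\<exists>n. x \<in> from_nat_into \<B> n \<longleftrightarrow> y \<notin> from_nat_into \<B> n" using V \<open>y \<notin> U\<close> by blast
  qed
  have f0: "0 \<le> f x" and f2: "f x \<le> 3 / 2" for x
  proof -
    show "0 \<le> f x" unfolding f_def code_def by (intro suminf_nonneg code_summable) auto
    have "f x \<le> (\<Sum>n. (1 / 3) ^ n)" unfolding f_def code_def
      by (intro suminf_le code_summable summable_geometric) (auto simp: indicator_def)
    thus "f x \<le> 3 / 2" by (simp add: suminf_geometric)
  qed
  define p where "p m x = nat \<lfloor>real (Suc m) * f x\<rfloor>" for m x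
  have pm: "p m \<in> M \<rightarrow>\<^sub>M count_space {..<2 * Suc m}" for m
  proof -
    \<comment> \<open>The values of f are at most 3 / 2, so 2 (m + 1) pieces are enough.\<close>
    have lt: "p m x < 2 * Suc m" for x
    proof -
      have "real (Suc m) * f x \<le> real (Suc m) * (3 / 2)" using f2 by (intro mult_left_mono) auto
      hence "real (Suc m) * f x < real (2 * Suc m)" by simp
      hence "\<lfloor>real (Suc m) * f x\<rfloor> < int (2 * Suc m)" by (simp only: floor_less_iff of_int_of_nat_eq)
      thus ?thesis unfolding p_def by (simp add: nat_less_iff)
    qed
    have "p m \<in> M \<rightarrow>\<^sub>M count_space UNIV" unfolding p_def[abs_def] using fm by measurable
    hence "{x. p m x = a} \<in> sets M" for a
      using measurable_sets[of "p m" M "count_space UNIV" "{a}"] by (simp add: vimage_def space_UNIV)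
    thus ?thesis using lt by (subst measurable_count_space_eq2) (auto simp: vimage_def space_UNIV)
  qed
  have "\<forall>\<^sub>F m in sequentially. measure M {x. p m (S x) = p m (T x)} \<le> \<delta>" if ST: "(S, T) \<in> FP" for S T
  proof -
    have m: "(\<lambda>x. f (S x)) \<in> borel_measurable M" "(\<lambda>x. f (T x)) \<in> borel_measurable M"
      using S[OF ST] fm by (auto intro: measurable_compose)
    define A where "A m = {x. \<bar>f (S x) - f (T x)\<bar> < 1 / real (Suc m)}" for m
    have "{x \<in> space M. \<bar>f (S x) - f (T x)\<bar> < 1 / real (Suc m)} \<in> sets M" for m using m by measurable
    hence Am: "A m \<in> sets M" for m by (simp add: A_def space_UNIV)
    have sub: "{x. p m (S x) = p m (T x)} \<subseteq> A m" for m
    proof clarify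
      fix x assume "p m (S x) = p m (T x)"
      hence "\<lfloor>real (Suc m) * f (S x)\<rfloor> = \<lfloor>real (Suc m) * f (T x)\<rfloor>" using f0 by (simp add: p_def eq_nat_nat_iff)
      hence "\<bar>real (Suc m) * f (S x) - real (Suc m) * f (T x)\<bar> < 1" by linarith
      hence "real (Suc m) * \<bar>f (S x) - f (T x)\<bar> < 1" by (simp add: abs_mult flip: right_diff_distrib)
      thus "x \<in> A m" by (simp add: A_def field_simps)
    qed
    have dec: "decseq A"
    proof (rule decseq_SucI, rule subsetI)
      fix n x assume "x \<in> A (Suc n)"
      moreover have "1 / real (Suc (Suc n)) \<le> 1 / real (Suc n)" by (intro divide_left_mono) auto
      ultimately show "x \<in> A n" by (simp add: A_def)
    qed
    have "(\<lambda>m. measure M (A m)) \<longlonglongrightarrow> measure M (\<Inter>m. A m)"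
      using Am dec by (intro finite_Lim_measure_decseq) auto
    moreover have "measure M (\<Inter>m. A m) = 0"
    proof -
      have "f (S x) = f (T x)" if "x \<in> (\<Inter>m. A m)" for x
      proof (rule ccontr)
        assume "f (S x) \<noteq> f (T x)"
        then obtain n where "1 / real (Suc n) < \<bar>f (S x) - f (T x)\<bar>"
          using reals_Archimedean[of "\<bar>f (S x) - f (T x)\<bar>"] by (auto simp: inverse_eq_divide)
        thus False using that by (auto simp: A_def dest!: spec[of _ n])
      qed
      hence "AE x in M. x \<notin> (\<Inter>m. A m)" using S[OF ST] inj by (auto simp: inj_eq elim!: eventually_mono)
      thus ?thesis using Am by (subst prob_eq_0) auto
    qed
    ultimately have "\<forall>\<^sub>F m in sequentially. measure M (A m) < \<delta>" using d by (simp add: order_tendsto_iff)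
    thus ?thesis
      using finite_measure_mono[OF sub Am] by (auto elim!: eventually_mono intro: order_trans less_imp_le)
  qed
  hence "\<forall>\<^sub>F m in sequentially. \<forall>(S, T)\<in>FP. measure M {x. p m (S x) = p m (T x)} \<le> \<delta>"
    using FP by (subst eventually_ball_finite_distrib) auto
  then obtain m where "\<forall>(S, T)\<in>FP. measure M {x. p m (S x) = p m (T x)} \<le> \<delta>"
    by (auto simp: eventually_sequentially)
  thus ?thesis using pm by blast
qed

end

locale free_action = pmp_action M G act + std_nonatomic M
  for M :: "'a::polish_space measure" and G :: "('g, 'b) monoid_scheme" (structure) and act +
  assumes free: "g \<in> carrier G \<Longrightarrow> g \<noteq> \<one> \<Longrightarrow> AE x in M. act g x \<noteq> x"
begin

lemma free_neq:
  assumes "g \<in> carrier G" "h \<in> carrier G" "g \<noteq> h"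
  shows "AE x in M. act g x \<noteq> act h x"
proof -
  have "inv h \<otimes> g \<noteq> \<one>" using assms by (metis inv_closed inv_equality inv_inv)
  hence "AE x in M. act (inv h \<otimes> g) x \<noteq> x" using assms free by simp
  thus ?thesis using assms by (auto simp: act_mult elim!: eventually_mono)
qed

lemma act_pieces:
  assumes "finite F" "F \<subseteq> carrier G" "\<delta> > 0"
  shows "\<exists>N p. p \<in> M \<rightarrow>\<^sub>M count_space {..<N::nat} \<and>
    (\<forall>g\<in>F. \<forall>h\<in>F. g \<noteq> h \<longrightarrow> measure M {x. p (act g x) = p (act h x)} \<le> \<delta>)"
proof -
  let ?FP = "(\<lambda>(g, h). (act g, act h)) ` {(g, h) \<in> F \<times> F. g \<noteq> h}"
  have "finite ?FP" using assms by (intro finite_imageI) (rule finite_subset[of _ "F \<times> F"], auto)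
  moreover have "S \<in> M \<rightarrow>\<^sub>M M \<and> T \<in> M \<rightarrow>\<^sub>M M \<and> (AE x in M. S x \<noteq> T x)" if ST: "(S, T) \<in> ?FP" for S T
  proof -
    obtain g h where "g \<in> F" "h \<in> F" "g \<noteq> h" "S = act g" "T = act h" using ST by auto
    thus ?thesis using free_neq[of g h] mp_measurable[OF act_mp] assms(2) by auto
  qed
  ultimately obtain N p where "p \<in> M \<rightarrow>\<^sub>M count_space {..<N::nat}" "\<forall>(S, T)\<in>?FP. measure M {x. p (S x) = p (T x)} \<le> \<delta>"
    using fine_pieces[of ?FP \<delta>] assms(3) by blast
  thus ?thesis by (intro exI[of _ N] exI[of _ p]) auto
qed

text \<open>A permutation \<pi> ranks the pieces, and e \<pi> x leads from x to the point of its
  window with smallest rank. Seen from x, the windows of x and h x are E and E h. If the minimum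
  over their union falls into their intersection, both points choose the same centre. For a random
  ranking this fails with probability at most 2 \<epsilon>, unless x lies in the set
  \<open>coin\<close> where two points of F x share a piece.\<close>

lemma folner_centers:
  fixes p :: "'a \<Rightarrow> nat" and \<epsilon> \<delta> :: real
  assumes E: "finite E" "E \<noteq> {}" "E \<subseteq> carrier G" and K: "finite K" "K \<subseteq> carrier G"
    and fol: "\<And>h. h \<in> K \<Longrightarrow> real (card ((\<lambda>e. e \<otimes> h) ` E - E)) \<le> \<epsilon> * card E"
    and p: "p \<in> M \<rightarrow>\<^sub>M count_space {..<N}"
    and F: "F = E \<union> (\<Union>h\<in>K. (\<lambda>e. e \<otimes> h) ` E)"
    and coll: "\<And>g g'. g \<in> F \<Longrightarrow> g' \<in> F \<Longrightarrow> g \<noteq> g' \<Longrightarrow> measure M {x. p (act g x) = p (act g' x)} \<le> \<delta>"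
    and d: "\<delta> \<ge> 0"
  shows "\<exists>e. e \<in> M \<rightarrow>\<^sub>M count_space E \<and>
    (\<forall>h\<in>K. measure M {x. e (act h x) \<otimes> h \<noteq> e x} \<le> card K * (2 * \<epsilon> + (card F)\<^sup>2 * \<delta>))"
proof -
  have fF: "finite F" "F \<subseteq> carrier G" using E K F by auto
  obtain es where es: "set es = E" using finite_list[OF E(1)] by blast
  define n where "n = length es"
  have n: "n > 0" using es E by (auto simp: n_def)
  define L where "L = {..<N}"
  define Perms where "Perms = {\<pi>. \<pi> permutes L}"
  have fin_Perms: "finite Perms" unfolding Perms_def L_def by (rule finite_permutations) simp
  have Perms_ne: "Perms \<noteq> {}" unfolding Perms_def using permutes_id by blast
  have pN: "p x \<in> L" for x using measurable_space[OF p, of x] by (simp add: L_def space_UNIV)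
  have p': "p \<in> M \<rightarrow>\<^sub>M count_space UNIV" using measurable_compose[OF p, of "\<lambda>x. x" "count_space UNIV"] by simp
  have pg: "(\<lambda>x. p (act g x)) \<in> M \<rightarrow>\<^sub>M count_space UNIV" if "g \<in> carrier G" for g
    using measurable_compose[OF mp_measurable[OF act_mp[OF that]] p'] .
  \<comment> \<open>Ties go to the first entry of the list, which keeps the choice
    measurable.\<close>
  define idx where "idx \<pi> x = (LEAST i. i < n \<and> (\<forall>j<n. \<pi> (p (act (es ! i) x)) \<le> \<pi> (p (act (es ! j) x))))" for \<pi> :: "nat \<Rightarrow> nat" and x
  define e where "e \<pi> x = es ! idx \<pi> x" for \<pi> x
  have esG: "es ! i \<in> carrier G" if "i < n" for i using that es E(3) n_def nth_mem by blast
  have idx: "idx \<pi> x < n \<and> (\<forall>j<n. \<pi> (p (act (es ! idx \<pi> x) x)) \<le> \<pi> (p (act (es ! j) x)))" for \<pi> x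
    unfolding idx_def
  proof (rule LeastI_ex)
    have "finite {..<n}" "{..<n} \<noteq> {}" using n by auto
    from ex_min_if_finite[of "(\<lambda>i. \<pi> (p (act (es ! i) x))) ` {..<n}"] this
    obtain i where "i < n" "\<forall>j<n. \<not> \<pi> (p (act (es ! j) x)) < \<pi> (p (act (es ! i) x))" by auto
    thus "\<exists>i<n. \<forall>j<n. \<pi> (p (act (es ! i) x)) \<le> \<pi> (p (act (es ! j) x))" by (auto simp: not_less)
  qed
  have eE: "e \<pi> x \<in> E" for \<pi> x using idx es by (auto simp: e_def n_def)
  have emin: "\<pi> (p (act (e \<pi> x) x)) \<le> \<pi> (p (act g x))" if "g \<in> E" for \<pi> x g
    using idx[of \<pi> x] that es unfolding e_def n_def by (metis in_set_conv_nth)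
  have em: "e \<pi> \<in> M \<rightarrow>\<^sub>M count_space E" for \<pi>
  proof -
    have pred: "Measurable.pred M (\<lambda>x. i < n \<and> (\<forall>j<n. \<pi> (p (act (es ! i) x)) \<le> \<pi> (p (act (es ! j) x))))" for i
    proof (cases "i < n")
      case True
      have "Measurable.pred M (\<lambda>x. \<pi> (p (act (es ! i) x)) \<le> \<pi> (p (act (es ! j) x)))" if "j < n" for j
        using count_space_rel_sets[OF pg[OF esG[OF True]] pg[OF esG[OF that]], of "\<lambda>a b. \<pi> a \<le> \<pi> b"]
        by (simp add: pred_def space_UNIV)
      thus ?thesis using True by (intro pred_intros_logic pred_intros_finite) auto
    qed simp
    have "idx \<pi> \<in> M \<rightarrow>\<^sub>M count_space UNIV"
      unfolding idx_def[abs_def] using pred by (rule measurable_Least)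
    hence "{x. e \<pi> x = a} \<in> sets M" for a
      using measurable_sets[of "idx \<pi>" M "count_space UNIV" "{i. es ! i = a}"] by (simp add: vimage_def space_UNIV e_def)
    thus ?thesis using eE E(1) by (subst measurable_count_space_eq2) (auto simp: vimage_def space_UNIV)
  qed
  define bad where "bad \<pi> h = {x. e \<pi> (act h x) \<otimes> h \<noteq> e \<pi> x}" for \<pi> h
  have badm: "bad \<pi> h \<in> sets M" if "h \<in> K" for \<pi> h
  proof -
    have m2: "(\<lambda>x. e \<pi> (act h x)) \<in> M \<rightarrow>\<^sub>M count_space E"
      using measurable_compose[OF mp_measurable[OF act_mp] em] that K by auto
    have s: "{x. e \<pi> x = a} \<in> sets M" "{x. e \<pi> (act h x) = a} \<in> sets M" if "a \<in> E" for a
      using measurable_sets[OF em, of "{a}"] measurable_sets[OF m2, of "{a}"] that by (auto simp: vimage_def space_UNIV)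
    have "bad \<pi> h = (\<Union>a\<in>E. \<Union>b\<in>{b\<in>E. b \<otimes> h \<noteq> a}. {x. e \<pi> x = a} \<inter> {x. e \<pi> (act h x) = b})"
      using eE by (auto simp: bad_def)
    also have "\<dots> \<in> sets M" using E s by (intro sets.finite_UN sets.Int) auto
    finally show ?thesis .
  qed
  define coin where "coin = (\<Union>q\<in>{q\<in>F \<times> F. fst q \<noteq> snd q}. {x. p (act (fst q) x) = p (act (snd q) x)})"
  have coinm: "{x. p (act g x) = p (act h x)} \<in> sets M" if "g \<in> F" "h \<in> F" for g h
  proof -
    show ?thesis using count_space_rel_sets[OF pg[of g] pg[of h], of "(=)"] that fF by auto
  qed
  have fQ: "finite {q\<in>F \<times> F. fst q \<noteq> snd q}" using fF by auto
  have coin_sets: "coin \<in> sets M" unfolding coin_def using fQ coinm by (intro sets.finite_UN) auto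
  have coin_le: "measure M coin \<le> (card F)\<^sup>2 * \<delta>"
  proof -
    have "measure M coin \<le> (\<Sum>q\<in>{q\<in>F \<times> F. fst q \<noteq> snd q}. measure M {x. p (act (fst q) x) = p (act (snd q) x)})"
      unfolding coin_def using fQ coinm by (intro finite_measure_subadditive_finite) auto
    also have "\<dots> \<le> (\<Sum>q\<in>{q\<in>F \<times> F. fst q \<noteq> snd q}. \<delta>)" using coll by (intro sum_mono) auto
    also have "\<dots> = card {q\<in>F \<times> F. fst q \<noteq> snd q} * \<delta>" by simp
    also have "\<dots> \<le> card (F \<times> F) * \<delta>" using fF d by (intro mult_right_mono of_nat_mono card_mono) auto
    finally show ?thesis by (simp add: card_cartesian_product power2_eq_square)
  qed
  have stable: "x \<notin> bad \<pi> h"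
    if pi: "\<pi> \<in> Perms" and h: "h \<in> K" and good: "x \<notin> coin"
      and g: "g \<in> E" "g \<in> (\<lambda>e. e \<otimes> h) ` E" and mn: "\<And>u. u \<in> E \<union> (\<lambda>e. e \<otimes> h) ` E \<Longrightarrow> \<pi> (p (act g x)) \<le> \<pi> (p (act u x))"
    for \<pi> h x g
  proof -
    have EF: "E \<union> (\<lambda>e. e \<otimes> h) ` E \<subseteq> F" using F h by auto
    have eq: "u = g" if u: "u \<in> E \<union> (\<lambda>e. e \<otimes> h) ` E" "\<pi> (p (act u x)) \<le> \<pi> (p (act g x))" for u
    proof (rule ccontr)
      assume "u \<noteq> g"
      have "\<pi> (p (act u x)) = \<pi> (p (act g x))" using u mn[of u] by simp
      moreover have "inj \<pi>" using pi permutes_inj by (auto simp: Perms_def)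
      ultimately have "p (act u x) = p (act g x)" by (simp add: inj_eq)
      moreover have "u \<in> F" "g \<in> F" using u g EF by auto
      ultimately show False using good \<open>u \<noteq> g\<close> by (auto simp: coin_def)
    qed
    have hG: "h \<in> carrier G" using h K by auto
    have 1: "e \<pi> x = g" using eE[of \<pi> x] emin[OF g(1), of \<pi> x] by (intro eq) auto
    obtain g' where g': "g' \<in> E" "g = g' \<otimes> h" using g by auto
    have e'G: "e \<pi> (act h x) \<in> carrier G" "g' \<in> carrier G" using eE E(3) g' by auto
    \<comment> \<open>Seen from x, the centre chosen by h x is given by e \<pi> (act h x) times h,
      and g = g' h is one of the candidates of h x.\<close>
    have "\<pi> (p (act (e \<pi> (act h x) \<otimes> h) x)) \<le> \<pi> (p (act g x))"
      using emin[OF g'(1), of \<pi> "act h x"] e'G hG g' by (simp add: act_mult)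
    hence "e \<pi> (act h x) \<otimes> h = g" using eE by (intro eq) auto
    thus ?thesis using 1 by (simp add: bad_def)
  qed
  have count: "real (card {\<pi>\<in>Perms. x \<in> bad \<pi> h}) \<le> 2 * \<epsilon> * card Perms" if h: "h \<in> K" and good: "x \<notin> coin" for x h
  proof -
    let ?Eh = "(\<lambda>e. e \<otimes> h) ` E"
    let ?p = "\<lambda>g. p (act g x)"
    define U where "U = ?p ` (E \<union> ?Eh)"
    define V where "V = ?p ` (E \<inter> ?Eh)"
    have hG: "h \<in> carrier G" using h K by auto
    have EF: "E \<union> ?Eh \<subseteq> F" using F h by auto
    have inj: "inj_on ?p F" using good unfolding coin_def by (auto intro!: inj_onI)
    have UL: "U \<subseteq> L" "V \<subseteq> U" using pN by (auto simp: U_def V_def)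
    have cU: "card U = card (E \<union> ?Eh)" and cV: "card V = card (E \<inter> ?Eh)"
      unfolding U_def V_def using inj EF by (auto intro!: card_image intro: inj_on_subset)
    have sub: "{\<pi>\<in>Perms. x \<in> bad \<pi> h} \<subseteq> Perms - {\<pi>. \<pi> permutes L \<and> (\<exists>v\<in>V. \<pi> v = Min (\<pi> ` U))}"
    proof (clarify, rule ccontr)
      fix \<pi> v assume a: "\<pi> \<in> Perms" "x \<in> bad \<pi> h" "v \<in> V" "\<pi> v = Min (\<pi> ` U)"
      then obtain g where g: "g \<in> E" "g \<in> ?Eh" "v = ?p g" by (auto simp: V_def)
      have "finite U" unfolding U_def using E by auto
      hence "\<pi> (?p g) \<le> \<pi> (?p u)" if "u \<in> E \<union> ?Eh" for u
        using a(4) g(3) that by (auto simp: U_def)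
      hence "x \<notin> bad \<pi> h" using stable[OF a(1) h good g(1,2)] by blast
      thus False using a by blast
    qed
    define a where "a = card (?Eh - E)"
    have ch: "card ?Eh = card E"
    proof (intro card_image inj_onI)
      fix x y assume "x \<in> E" "y \<in> E" "x \<otimes> h = y \<otimes> h"
      thus "x = y" using E(3) hG right_cancel[of h x y] by auto
    qed
    have "card ?Eh = card (E \<inter> ?Eh) + a"
      unfolding a_def using card_Diff_subset_Int[of ?Eh E] E(1) card_mono[of ?Eh "?Eh \<inter> E"] by (simp add: Int_commute)
    hence V_a: "card V + a = card E" using ch cV by simp
    have "card (E \<union> ?Eh) = card E + card (?Eh - E)" using E(1)
      by (metis Un_Diff_cancel card_Un_disjoint Diff_disjoint finite_Diff finite_imageI)
    hence U_a: "card U = card E + a" using cU a_def by simp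
    have cm: "card {\<pi>. \<pi> permutes L \<and> (\<exists>v\<in>V. \<pi> v = Min (\<pi> ` U))} * card U = card V * card Perms"
      unfolding Perms_def using UL by (intro card_permutes_argmin) (auto simp: L_def)
    let ?W = "{\<pi>. \<pi> permutes L \<and> (\<exists>v\<in>V. \<pi> v = Min (\<pi> ` U))}"
    have W: "?W \<subseteq> Perms" by (auto simp: Perms_def)
    have "card {\<pi>\<in>Perms. x \<in> bad \<pi> h} \<le> card (Perms - ?W)" using sub fin_Perms by (intro card_mono) auto
    also have "card (Perms - ?W) = card Perms - card ?W" using W fin_Perms by (intro card_Diff_subset) (auto intro: finite_subset)
    finally have 1: "real (card {\<pi>\<in>Perms. x \<in> bad \<pi> h}) \<le> real (card Perms) - real (card ?W)"
      using card_mono[OF fin_Perms W] by linarith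
    have cE: "card E > 0" using E by (simp add: card_gt_0_iff)
    \<comment> \<open>Since card U = card E + a and card V = card E - a, the share of rankings with
      minimum outside V is 2 a / card U.\<close>
    have "(real (card Perms) - real (card ?W)) * card U = real (card Perms) * (2 * a)"
    proof -
      have "real (card ?W) * real (card U) = real (card V) * real (card Perms)" using arg_cong[OF cm, of real] by (simp only: of_nat_mult)
      moreover have "real (card V) = real (card E) - a" using V_a by linarith
      ultimately show ?thesis using U_a by (simp add: algebra_simps)
    qed
    also have "\<dots> \<le> real (card Perms) * (2 * (\<epsilon> * card E))" using fol[OF h] by (intro mult_left_mono) (auto simp: a_def)
    also have "\<dots> \<le> (2 * \<epsilon> * card Perms) * card U"
    proof -
      have "\<epsilon> * card E \<ge> 0" using fol[OF h] by (meson of_nat_0_le_iff order_trans)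
      hence "\<epsilon> \<ge> 0" using cE by (simp add: zero_le_mult_iff)
      hence "(2 * \<epsilon> * card Perms) * card E \<le> (2 * \<epsilon> * card Perms) * card U" using U_a by (intro mult_left_mono) auto
      thus ?thesis by (simp add: mult_ac)
    qed
    finally have "real (card Perms) - real (card ?W) \<le> 2 * \<epsilon> * card Perms" using U_a cE by simp
    thus ?thesis using 1 by linarith
  qed
  have avg: "(\<Sum>\<pi>\<in>Perms. measure M (bad \<pi> h)) \<le> card Perms * (2 * \<epsilon> + (card F)\<^sup>2 * \<delta>)" if h: "h \<in> K" for h
  proof -
    have "\<epsilon> * card E \<ge> 0" using fol[OF h] by (meson of_nat_0_le_iff order_trans)
    moreover have "card E > 0" using E by (simp add: card_gt_0_iff)
    ultimately have e0: "\<epsilon> \<ge> 0" by (simp add: zero_le_mult_iff)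
    have int: "integrable M (\<lambda>x. indicat_real (bad \<pi> h) x)" for \<pi>
      using badm[OF h] by (intro bounded_integrable[where B=1]) (auto simp: indicator_def)
    have "(\<Sum>\<pi>\<in>Perms. measure M (bad \<pi> h)) = (\<Sum>\<pi>\<in>Perms. \<integral>x. indicat_real (bad \<pi> h) x \<partial>M)" using badm[OF h] by simp
    also have "\<dots> = (\<integral>x. (\<Sum>\<pi>\<in>Perms. indicat_real (bad \<pi> h) x) \<partial>M)" using int by (simp add: Bochner_Integration.integral_sum)
    also have "\<dots> \<le> (\<integral>x. 2 * \<epsilon> * card Perms + card Perms * indicat_real coin x \<partial>M)"
    proof (rule integral_mono)
      fix x
      have "(\<Sum>\<pi>\<in>Perms. indicat_real (bad \<pi> h) x) = card {\<pi>\<in>Perms. x \<in> bad \<pi> h}"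
        using fin_Perms by (simp add: indicator_def sum.If_cases Int_def)
      also have "\<dots> \<le> 2 * \<epsilon> * card Perms + card Perms * indicat_real coin x"
      proof (cases "x \<in> coin")
        case True
        have "card {\<pi>\<in>Perms. x \<in> bad \<pi> h} \<le> card Perms" using fin_Perms by (intro card_mono) auto
        thus ?thesis using True e0 by (simp add: add_increasing)
      next
        case False
        thus ?thesis using count[OF h False] by simp
      qed
      finally show "(\<Sum>\<pi>\<in>Perms. indicat_real (bad \<pi> h) x) \<le> 2 * \<epsilon> * card Perms + card Perms * indicat_real coin x" .
    next
      show "integrable M (\<lambda>x. \<Sum>\<pi>\<in>Perms. indicat_real (bad \<pi> h) x)" using int by simp
      have "integrable M (indicat_real coin)"
        by (rule bounded_integrable[where B=1]) (use coin_sets in simp, simp add: indicator_def)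
      thus "integrable M (\<lambda>x. 2 * \<epsilon> * card Perms + card Perms * indicat_real coin x)" by simp
    qed
    also have "\<dots> = 2 * \<epsilon> * card Perms + card Perms * measure M coin"
      using coin_sets
      by (subst Bochner_Integration.integral_add) (auto simp: prob_space intro!: bounded_integrable[where B="card Perms"] split: split_indicator)
    also have "\<dots> \<le> 2 * \<epsilon> * card Perms + card Perms * ((card F)\<^sup>2 * \<delta>)" using coin_le by (intro add_left_mono mult_left_mono) auto
    finally show ?thesis by (simp add: algebra_simps)
  qed
  let ?\<eta> = "2 * \<epsilon> + (card F)\<^sup>2 * \<delta>"
  \<comment> \<open>Averaging the sum over K gives one ranking for all h; each summand is then
    bounded by the sum, whence the factor card K.\<close>
  have "\<exists>\<pi>\<in>Perms. (\<Sum>h\<in>K. measure M (bad \<pi> h)) \<le> card K * ?\<eta>"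
  proof (rule ccontr)
    assume "\<not> ?thesis"
    hence "(\<Sum>\<pi>\<in>Perms. card K * ?\<eta>) < (\<Sum>\<pi>\<in>Perms. \<Sum>h\<in>K. measure M (bad \<pi> h))"
      using fin_Perms Perms_ne by (intro sum_strict_mono) (auto simp: not_le)
    also have "\<dots> = (\<Sum>h\<in>K. \<Sum>\<pi>\<in>Perms. measure M (bad \<pi> h))" by (rule sum.swap)
    also have "\<dots> \<le> (\<Sum>h\<in>K. card Perms * ?\<eta>)" using avg by (rule sum_mono)
    finally show False by (simp add: mult_ac)
  qed
  then obtain \<pi> where \<pi>: "(\<Sum>h\<in>K. measure M (bad \<pi> h)) \<le> card K * ?\<eta>" by blast
  have "measure M (bad \<pi> h) \<le> card K * ?\<eta>" if "h \<in> K" for h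
    using member_le_sum[of h K "\<lambda>h. measure M (bad \<pi> h)"] that K(1) \<pi> by simp
  thus ?thesis using em unfolding bad_def by blast
qed

end

section \<open>Labellings with prescribed statistics\<close>

lemma (in pmp) count_space_pred_sets:
  "f \<in> M \<rightarrow>\<^sub>M count_space UNIV \<Longrightarrow> {x. Q (f x)} \<in> sets M"
  using measurable_sets[of f M "count_space UNIV" "{a. Q a}"] by (simp add: vimage_def space_UNIV)

lemma abs_of_bool_diff_le: "0 \<le> t \<Longrightarrow> t \<le> 1 \<Longrightarrow> \<bar>of_bool b - t\<bar> \<le> (1::real)"
  by auto

lemma (in pmp) integral_of_bool_diff:
  fixes t :: real
  assumes "{x. Q x} \<in> sets M" "Z \<in> sets M"
  shows "(\<integral>x. indicator Z x * (of_bool (Q x) - t) \<partial>M) = measure M {x\<in>Z. Q x} - t * measure M Z"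
proof -
  have s: "{x\<in>Z. Q x} \<in> sets M" using sets.Int[OF assms] by (simp add: Int_def conj_commute)
  have "(\<integral>x. indicator Z x * (of_bool (Q x) - t) \<partial>M) = (\<integral>x. indicat_real {x\<in>Z. Q x} x - t * indicator Z x \<partial>M)"
    by (intro Bochner_Integration.integral_cong) (auto simp: indicator_def)
  also have "\<dots> = (\<integral>x. indicat_real {x\<in>Z. Q x} x \<partial>M) - (\<integral>x. t * indicator Z x \<partial>M)"
  proof (rule Bochner_Integration.integral_diff)
    show "integrable M (indicat_real {x\<in>Z. Q x})"
      by (rule bounded_integrable[where B=1]) (use s in simp, simp add: indicator_def)
    show "integrable M (\<lambda>x. t * indicat_real Z x)"
      by (rule bounded_integrable[where B="\<bar>t\<bar>"]) (use assms in simp, simp add: indicator_def)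
  qed
  finally show ?thesis using s assms by simp
qed

context free_action
begin

text \<open>Each piece of a fine partition receives the P-label of a random point. Any n elements of
  H i can serve as translates, because freeness lets a fine partition put their images of most
  points into different pieces. The index set T holds all pairs of a factor and a label, so a single
  c serves them all.\<close>

lemma independent_label:
  fixes P :: "'a \<Rightarrow> nat" and I :: "'i set"
  assumes I: "finite I" and H: "\<And>i. i \<in> I \<Longrightarrow> H i \<subseteq> carrier G \<and> infinite (H i)"
    and P: "P \<in> M \<rightarrow>\<^sub>M count_space UNIV" "\<And>x. P x < k" and e: "\<epsilon> > 0"
  shows "\<exists>q. q \<in> M \<rightarrow>\<^sub>M count_space UNIV \<and> (\<forall>x. q x < k) \<and>
    (\<forall>i\<in>I. \<forall>Z\<in>sets M. (\<forall>h\<in>H i. \<forall>x. act h x \<in> Z \<longleftrightarrow> x \<in> Z) \<longrightarrow>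
      (\<forall>j<k. \<bar>measure M {x\<in>Z. q x = j} - measure M {x. P x = j} * measure M Z\<bar> \<le> \<epsilon>))"
proof -
  define T where "T = I \<times> {..<k}"
  have fT: "finite T" unfolding T_def using I by auto
  \<comment> \<open>The summand 1 keeps C positive when T is empty. Below, 1 / n and \<delta> each
    take half of \<epsilon>^2 / C.\<close>
  define C where "C = real (card T) + 1"
  have C: "C > 0" "real (card T) \<le> C" by (auto simp: C_def)
  obtain n :: nat where n: "real n > 2 * C / \<epsilon>\<^sup>2" using reals_Archimedean2 by blast
  have n0: "n > 0" using n C e by (cases n) (auto simp: field_simps)
  define \<delta> where "\<delta> = \<epsilon>\<^sup>2 / (2 * C)"
  have d: "\<delta> > 0" using e C by (simp add: \<delta>_def)
  have "\<exists>D. D \<subseteq> H i \<and> finite D \<and> card D = n" if "i \<in> I" for i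
    using infinite_arbitrarily_large[of "H i" n] H[OF that] by blast
  then obtain D where D: "\<And>i. i \<in> I \<Longrightarrow> D i \<subseteq> H i \<and> finite (D i) \<and> card (D i) = n" by metis
  define F where "F = (\<Union>i\<in>I. D i)"
  have F: "finite F" "F \<subseteq> carrier G" unfolding F_def using I D H by blast+
  obtain N p where p: "p \<in> M \<rightarrow>\<^sub>M count_space {..<N::nat}"
    and coll: "\<forall>g\<in>F. \<forall>h\<in>F. g \<noteq> h \<longrightarrow> measure M {x. p (act g x) = p (act h x)} \<le> \<delta>"
    using act_pieces[OF F d] by blast
  \<comment> \<open>The deviation is the same for all pieces u; the piece decides only which random
    point is inserted for s.\<close>
  define G where "G t u s = of_bool (P s = snd t) - measure M {x. P x = snd t}" for t :: "'i \<times> nat" and u :: nat and s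
  have Pm: "{x. P x = j} \<in> sets M" for j using count_space_pred_sets[OF P(1)] .
  have Gm: "G t u \<in> borel_measurable M" for t u
  proof -
    have "(\<lambda>s. of_bool (P s = snd t) :: real) \<in> borel_measurable M"
      using measurable_compose[OF P(1), of "\<lambda>a. of_bool (a = snd t) :: real" borel] by simp
    thus ?thesis unfolding G_def[abs_def] by simp
  qed
  have G0: "(\<integral>s. G t u s \<partial>M) = 0" for t u
    using integral_of_bool_diff[of "\<lambda>s. P s = snd t" UNIV "measure M {x. P x = snd t}"] Pm sets.top[of M] prob_space
    by (simp add: G_def space_UNIV)
  have G1: "\<bar>G t u s\<bar> \<le> 1" for t u s unfolding G_def by (intro abs_of_bool_diff_le) auto
  have "\<exists>c. \<forall>t\<in>T. \<forall>Z\<in>sets M. (\<forall>d\<in>D (fst t). \<forall>x. act d x \<in> Z \<longleftrightarrow> x \<in> Z) \<longrightarrow>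
    \<bar>\<integral>x. indicator Z x * G t (p x) (c (p x)) \<partial>M\<bar> \<le> sqrt (card T * (1 / n + \<delta>))"
  proof (rule random_labels[OF fT _ n0, where U="{..<N}" and \<sigma>="\<lambda>_. p" and lab="\<lambda>u. u"])
    show "act d \<in> mp" if "t \<in> T" "d \<in> D (fst t)" for t d
    proof -
      have "fst t \<in> I" using that by (auto simp: T_def)
      thus ?thesis using that D[of "fst t"] H[of "fst t"] by (intro act_mp) blast
    qed
    show "measure M {x. p (act d x) = p (act d' x)} \<le> \<delta>" if "t \<in> T" "d \<in> D (fst t)" "d' \<in> D (fst t)" "d \<noteq> d'" for t d d'
      using that coll by (auto simp: T_def F_def)
  qed (use D p Gm G0 G1 d in \<open>auto simp: T_def\<close>)
  then obtain c where c0: "\<forall>t\<in>T. \<forall>Z\<in>sets M. (\<forall>d\<in>D (fst t). \<forall>x. act d x \<in> Z \<longleftrightarrow> x \<in> Z) \<longrightarrow>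
    \<bar>\<integral>x. indicator Z x * G t (p x) (c (p x)) \<partial>M\<bar> \<le> sqrt (card T * (1 / n + \<delta>))" by (elim exE) (rule that)
  define q where "q x = P (c (p x))" for x
  have p': "p \<in> M \<rightarrow>\<^sub>M count_space UNIV" using measurable_compose[OF p, of "\<lambda>x. x" "count_space UNIV"] by simp
  have q: "q \<in> M \<rightarrow>\<^sub>M count_space UNIV" unfolding q_def[abs_def] using measurable_compose[OF p', of "\<lambda>a. P (c a)"] by simp
  have "card T * (1 / n + \<delta>) \<le> C * (1 / n + \<delta>)" using C d by (intro mult_right_mono) auto
  also have "\<dots> \<le> C * (\<epsilon>\<^sup>2 / (2 * C) + \<delta>)"
  proof -
    have "1 / n \<le> \<epsilon>\<^sup>2 / (2 * C)" using n n0 C e by (simp add: field_simps)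
    thus ?thesis using C by (intro mult_left_mono) auto
  qed
  also have "\<dots> = \<epsilon>\<^sup>2" using C by (simp add: \<delta>_def)
  finally have "sqrt (card T * (1 / n + \<delta>)) \<le> \<epsilon>" using e by (simp add: real_sqrt_le_iff real_le_lsqrt)
  hence c': "\<bar>\<integral>x. indicator Z x * G t (p x) (c (p x)) \<partial>M\<bar> \<le> \<epsilon>"
    if "t \<in> T" "Z \<in> sets M" "\<forall>d\<in>D (fst t). \<forall>x. act d x \<in> Z \<longleftrightarrow> x \<in> Z" for t Z
    using c0[THEN bspec, OF that(1), THEN bspec, OF that(2), THEN mp, OF that(3)] by linarith
  have "\<bar>measure M {x\<in>Z. q x = j} - measure M {x. P x = j} * measure M Z\<bar> \<le> \<epsilon>"
    if i: "i \<in> I" and Z: "Z \<in> sets M" "\<forall>h\<in>H i. \<forall>x. act h x \<in> Z \<longleftrightarrow> x \<in> Z" and j: "j < k" for i Z j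
  proof -
    have "\<bar>\<integral>x. indicator Z x * G (i, j) (p x) (c (p x)) \<partial>M\<bar> \<le> \<epsilon>"
      using i Z j D[OF i] by (intro c') (auto simp: T_def)
    also have "(\<integral>x. indicator Z x * G (i, j) (p x) (c (p x)) \<partial>M) = measure M {x\<in>Z. q x = j} - measure M {x. P x = j} * measure M Z"
      using integral_of_bool_diff[of "\<lambda>x. q x = j" Z] count_space_pred_sets[OF q] Z by (simp add: G_def q_def)
    finally show ?thesis .
  qed
  thus ?thesis using q P(2) by (intro exI[of _ q]) (auto simp: q_def)
qed

text \<open>The random point y attached to the centre of x plays the part of the centre in the
  action \<beta>. As x is the inverse of \<open>ce x\<close> applied to its centre, it receives the
  P-label of z = \<beta> (inv (ce x)) y. If h x has the same centre, its label is that of \<beta> h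
  z for almost every y, and averaging over y gives the statistics of P under \<beta> h.\<close>

lemma label_approximation:
  fixes P :: "'a \<Rightarrow> nat" and \<beta> :: "'g \<Rightarrow> 'a \<Rightarrow> 'a"
  assumes comm: "comm_group G" and inf: "infinite (carrier G)"
    and \<beta>: "\<And>g. g \<in> carrier G \<Longrightarrow> \<beta> g \<in> mp"
    and \<beta>_mult: "\<And>g h. g \<in> carrier G \<Longrightarrow> h \<in> carrier G \<Longrightarrow> AE x in M. \<beta> (g \<otimes> h) x = \<beta> g (\<beta> h x)"
    and \<beta>_one: "AE x in M. \<beta> \<one> x = x"
    and K: "finite K" "K \<subseteq> carrier G"
    and P: "P \<in> M \<rightarrow>\<^sub>M count_space UNIV" "\<And>x. P x < k" and e: "\<epsilon> > 0"
  shows "\<exists>\<phi>. \<phi> \<in> M \<rightarrow>\<^sub>M count_space UNIV \<and> (\<forall>x. \<phi> x < k) \<and>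
    (\<forall>h\<in>K. \<forall>i<k. \<forall>j<k. \<bar>measure M {x. \<phi> x = i \<and> \<phi> (act h x) = j} - measure M {x. P x = i \<and> P (\<beta> h x) = j}\<bar> \<le> \<epsilon>) \<and>
    (\<forall>Z\<in>sets M. invariant Z \<longrightarrow> (\<forall>j<k. \<bar>measure M {x\<in>Z. \<phi> x = j} - measure M {x. P x = j} * measure M Z\<bar> \<le> \<epsilon>))"
proof -
  interpret comm_group G by (rule comm)
  \<comment> \<open>With the identity included, \<open>main\<close> also yields the one-point
    statistics on invariant sets.\<close>
  define K' where "K' = insert \<one> K"
  have K': "finite K'" "K' \<subseteq> carrier G" "card K' > 0" using K by (auto simp: K'_def card_gt_0_iff)
  define T where "T = K' \<times> {..<k} \<times> {..<k}"
  have fT: "finite T" unfolding T_def using K' by auto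
  define \<tau> where "\<tau> h i j = measure M {x. P x = i \<and> P (\<beta> h x) = j}" for h i j
  define C where "C = real (card T) + 1"
  have C: "C > 0" "real (card T) \<le> C" by (auto simp: C_def)
  \<comment> \<open>After the factor 2 card K' this accounts for \<epsilon> / 4 of the points at
    which the centre changes.\<close>
  define \<epsilon>1 where "\<epsilon>1 = \<epsilon> / (8 * card K')"
  have e1: "\<epsilon>1 > 0" using e K' by (simp add: \<epsilon>1_def)
  obtain E where E: "finite E" "E \<noteq> {}" "E \<subseteq> carrier G"
    and fol: "\<And>h. h \<in> K' \<Longrightarrow> real (card ((\<lambda>e. e \<otimes> h) ` E - E)) \<le> \<epsilon>1 * card E"
    using folner_set[OF K'(1,2) e1] by blast
  obtain n :: nat where n: "real n > 8 * C / \<epsilon>\<^sup>2" using reals_Archimedean2 by blast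
  have n0: "n > 0" using n C e by (cases n) (auto simp: field_simps)
  obtain D where D: "finite D" "D \<subseteq> carrier G" "card D = n"
    and sparse: "\<And>d d' g g'. d \<in> D \<Longrightarrow> d' \<in> D \<Longrightarrow> d \<noteq> d' \<Longrightarrow> g \<in> E \<Longrightarrow> g' \<in> E \<Longrightarrow> g \<otimes> d \<noteq> g' \<otimes> d'"
    using sparse_set[OF inf E(1,3), of n] by blast
  define F0 where "F0 = E \<union> (\<Union>h\<in>K'. (\<lambda>e. e \<otimes> h) ` E)"
  define F where "F = F0 \<union> (\<lambda>(e, d). e \<otimes> d) ` (E \<times> D)"
  have F0: "finite F0" and F: "finite F" "F \<subseteq> carrier G" unfolding F_def F0_def using E K' D by auto
  have cE: "card E > 0" using E by (simp add: card_gt_0_iff)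
  \<comment> \<open>The first bound makes the collision term of the second moments at most
    \<epsilon>^2 / (8 C), as much as 1 / n contributes. The second bound keeps the effect of
    collisions on the choice of centres below \<epsilon> / 4.\<close>
  define \<delta> where "\<delta> = min (\<epsilon>\<^sup>2 / (8 * C * (card E)\<^sup>2)) (\<epsilon> / (4 * card K' * ((card F0)\<^sup>2 + 1)))"
  have d: "\<delta> > 0"
  proof -
    have "0 < \<epsilon>\<^sup>2 / (8 * C * (card E)\<^sup>2)" using e C cE by simp
    moreover have "0 < \<epsilon> / (4 * card K' * ((card F0)\<^sup>2 + 1))"
    proof -
      have "0 < 4 * card K' * ((card F0)\<^sup>2 + 1)" using K' by simp
      thus ?thesis using e by (intro divide_pos_pos) (simp_all only: of_nat_0_less_iff)
    qed
    ultimately show ?thesis by (simp add: \<delta>_def)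
  qed
  obtain N p where p: "p \<in> M \<rightarrow>\<^sub>M count_space {..<N::nat}"
    and coll: "\<forall>g\<in>F. \<forall>h\<in>F. g \<noteq> h \<longrightarrow> measure M {x. p (act g x) = p (act h x)} \<le> \<delta>"
    using act_pieces[OF F d] by blast
  have p': "p \<in> M \<rightarrow>\<^sub>M count_space UNIV" using measurable_compose[OF p, of "\<lambda>x. x" "count_space UNIV"] by simp
  have pg: "(\<lambda>x. p (act g x)) \<in> M \<rightarrow>\<^sub>M count_space UNIV" if "g \<in> carrier G" for g
    using measurable_compose[OF mp_measurable[OF act_mp[OF that]] p'] .
  have pN: "p x < N" for x using measurable_space[OF p, of x] by (simp add: space_UNIV)
  have coll0: "measure M {x. p (act g x) = p (act g' x)} \<le> \<delta>" if "g \<in> F0" "g' \<in> F0" "g \<noteq> g'" for g g'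
    using coll that by (auto simp: F_def)
  obtain ce where ce: "ce \<in> M \<rightarrow>\<^sub>M count_space E"
    and cb: "\<forall>h\<in>K'. measure M {x. ce (act h x) \<otimes> h \<noteq> ce x} \<le> card K' * (2 * \<epsilon>1 + (card F0)\<^sup>2 * \<delta>)"
    using folner_centers[OF E K'(1,2) fol p F0_def coll0 less_imp_le[OF d]] by blast
  have ceE: "ce x \<in> E" for x using measurable_space[OF ce, of x] by (simp add: space_UNIV)
  have ceG: "ce x \<in> carrier G" for x using ceE E(3) by blast
  have ceh: "(\<lambda>x. ce (act h x)) \<in> M \<rightarrow>\<^sub>M count_space E" if "h \<in> carrier G" for h
    using measurable_compose[OF mp_measurable[OF act_mp[OF that]] ce] .
  have cs: "{x. ce x = a} \<in> sets M" if "a \<in> E" for a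
    using measurable_sets[OF ce, of "{a}"] that by (simp add: vimage_def space_UNIV)
  have chs: "{x. ce (act h x) = a} \<in> sets M" if "a \<in> E" "h \<in> carrier G" for a h
    using measurable_sets[OF ceh[OF that(2)], of "{a}"] that by (simp add: vimage_def space_UNIV)
  define lab where "lab x = p (act (ce x) x)" for x
  \<comment> \<open>The label of x and of h x depends on both centres, but the random point depends
    on the piece alone; hence the third component serves as the label in
    \<open>random_labels\<close>.\<close>
  define \<sigma> where "\<sigma> t x = (ce x, ce (act (fst t) x), lab x)" for t :: "'g \<times> nat \<times> nat" and x
  define U where "U = E \<times> E \<times> {..<N}"
  have fU: "finite U" using E by (simp add: U_def)
  have \<sigma>: "\<sigma> t \<in> M \<rightarrow>\<^sub>M count_space U" if t: "t \<in> T" for t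
  proof -
    have h: "fst t \<in> carrier G" using t K' by (auto simp: T_def)
    have "{x. \<sigma> t x = (a, b, l)} \<in> sets M" if u: "a \<in> E" "b \<in> E" for a b l
    proof -
      have "{x. \<sigma> t x = (a, b, l)} = {x. ce x = a} \<inter> {x. ce (act (fst t) x) = b} \<inter> {x. p (act a x) = l}"
        by (auto simp: \<sigma>_def lab_def)
      also have "\<dots> \<in> sets M"
        using cs chs[OF _ h] u E(3) count_space_pred_sets[OF pg, of a "\<lambda>y. y = l"] by (intro sets.Int) auto
      finally show ?thesis .
    qed
    thus ?thesis using fU ceE pN by (subst measurable_count_space_eq2) (auto simp: U_def \<sigma>_def lab_def vimage_def space_UNIV)
  qed
  \<comment> \<open>Where the two centres disagree the deviation is replaced by 0, so that it has
    mean zero for every u. Those points are accounted for by the set B in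
    \<open>main\<close>.\<close>
  define Gf where "Gf t u s = (case t of (h, i, j) \<Rightarrow> case u of (e1, e2, l) \<Rightarrow>
     if e2 \<otimes> h = e1 then of_bool (P (\<beta> (inv e1) s) = i \<and> P (\<beta> (inv e2) s) = j) - \<tau> h i j else 0)"
    for t :: "'g \<times> nat \<times> nat" and u :: "'g \<times> 'g \<times> nat" and s
  have P\<beta>: "(\<lambda>x. P (\<beta> g x)) \<in> M \<rightarrow>\<^sub>M count_space UNIV" if "g \<in> carrier G" for g
    using measurable_compose[OF mp_measurable[OF \<beta>[OF that]] P(1)] .
  have joint: "{s. P (\<beta> g s) = i \<and> P (\<beta> h s) = j} \<in> sets M" if "g \<in> carrier G" "h \<in> carrier G" for g h i j
    using count_space_rel_sets[OF P\<beta>[OF that(1)] P\<beta>[OF that(2)], of "\<lambda>a b. a = i \<and> b = j"] .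
  have Gm: "Gf t u \<in> borel_measurable M" and G0: "(\<integral>s. Gf t u s \<partial>M) = 0" if t: "t \<in> T" and u: "u \<in> U" for t u
  proof -
    obtain h i j where th: "t = (h, i, j)" by (cases t)
    obtain e1 e2 l where ul: "u = (e1, e2, l)" by (cases u)
    have h: "h \<in> carrier G" and e12: "e1 \<in> carrier G" "e2 \<in> carrier G" using t u th ul K' E by (auto simp: T_def U_def)
    define A where "A = {s. P (\<beta> (inv e1) s) = i \<and> P (\<beta> (inv e2) s) = j}"
    have A: "A \<in> sets M" unfolding A_def using joint e12 by simp
    have G: "Gf t u s = (if e2 \<otimes> h = e1 then indicat_real A s - \<tau> h i j else 0)" for s
      by (simp add: Gf_def th ul A_def indicator_def of_bool_def)
    show "Gf t u \<in> borel_measurable M" unfolding G[abs_def] using A by simp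
    show "(\<integral>s. Gf t u s \<partial>M) = 0"
    proof (cases "e2 \<otimes> h = e1")
      case True
      \<comment> \<open>A common centre, e2 h = e1, means inv e2 = h inv e1: the second label is
        read one step h after the first.\<close>
      have "h \<otimes> inv e1 = h \<otimes> (inv h \<otimes> inv e2)" unfolding True[symmetric] using h e12 by (simp add: inv_mult_group)
      also have "\<dots> = inv e2" using h e12 by (simp add: m_assoc[symmetric])
      finally have "inv e2 = h \<otimes> inv e1" by simp
      hence "AE s in M. \<beta> (inv e2) s = \<beta> h (\<beta> (inv e1) s)" using \<beta>_mult[OF h, of "inv e1"] e12 by simp
      hence ae: "AE s in M. s \<in> A \<longleftrightarrow> s \<in> {s. \<beta> (inv e1) s \<in> {y. P y = i \<and> P (\<beta> h y) = j}}"
        by eventually_elim (simp add: A_def)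
      have W: "{y. P y = i \<and> P (\<beta> h y) = j} \<in> sets M"
        using count_space_rel_sets[OF P(1) P\<beta>[OF h], of "\<lambda>a b. a = i \<and> b = j"] .
      have b1: "\<beta> (inv e1) \<in> mp" using \<beta> e12 by simp
      have "measure M A = measure M {s. \<beta> (inv e1) s \<in> {y. P y = i \<and> P (\<beta> h y) = j}}"
        by (rule measure_eq_AE[OF ae A mp_sets[OF b1 W]])
      also have "\<dots> = \<tau> h i j" unfolding \<tau>_def by (rule mp_measure[OF b1 W])
      finally have "measure M A = \<tau> h i j" .
      moreover have "integrable M (indicat_real A)"
        by (rule bounded_integrable[where B=1]) (use A in simp, simp add: indicator_def)
      ultimately show ?thesis unfolding G using True A by (simp add: prob_space)
    qed (simp add: G)
  qed
  have G1: "\<bar>Gf t u s\<bar> \<le> 1" for t u s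
    unfolding Gf_def \<tau>_def by (auto split: prod.splits intro!: abs_of_bool_diff_le simp del: of_bool_conj)
  \<comment> \<open>The pieces compared are those of e d x and e' d' x for some e and e' in E. By
    sparseness these are different group elements, and there are at most (card E)^2 such
    pairs.\<close>
  have lc: "measure M {x. lab (act d x) = lab (act d' x)} \<le> (card E)\<^sup>2 * \<delta>" if dd: "d \<in> D" "d' \<in> D" "d \<noteq> d'" for d d'
  proof -
    have dG: "d \<in> carrier G" "d' \<in> carrier G" using dd D by auto
    let ?C = "\<lambda>q. {x. p (act (fst q \<otimes> d) x) = p (act (snd q \<otimes> d') x)}"
    have Cs: "?C q \<in> sets M" if "q \<in> E \<times> E" for q
    proof -
      have "fst q \<otimes> d \<in> carrier G" "snd q \<otimes> d' \<in> carrier G" using that E(3) dG by (auto simp: mem_Times_iff)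
      from count_space_rel_sets[OF pg[OF this(1)] pg[OF this(2)], of "(=)"] show ?thesis .
    qed
    have "{x. lab (act d x) = lab (act d' x)} \<subseteq> (\<Union>q\<in>E \<times> E. ?C q)"
    proof clarify
      fix x assume "lab (act d x) = lab (act d' x)"
      hence "x \<in> ?C (ce (act d x), ce (act d' x))" using ceG dG by (simp add: lab_def act_mult)
      thus "x \<in> (\<Union>q\<in>E \<times> E. ?C q)" using ceE by blast
    qed
    hence "measure M {x. lab (act d x) = lab (act d' x)} \<le> measure M (\<Union>q\<in>E \<times> E. ?C q)"
      using Cs E(1) by (intro finite_measure_mono sets.finite_UN) auto
    also have "\<dots> \<le> (\<Sum>q\<in>E \<times> E. measure M (?C q))" using Cs E(1) by (intro finite_measure_subadditive_finite) auto
    also have "\<dots> \<le> (\<Sum>q\<in>E \<times> E. \<delta>)"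
    proof (intro sum_mono)
      fix q assume q: "q \<in> E \<times> E"
      hence "fst q \<otimes> d \<in> F" "snd q \<otimes> d' \<in> F" "fst q \<otimes> d \<noteq> snd q \<otimes> d'"
        using dd sparse[of d d' "fst q" "snd q"] by (auto simp: F_def)
      thus "measure M (?C q) \<le> \<delta>" using coll by blast
    qed
    finally show ?thesis by (simp add: card_cartesian_product power2_eq_square)
  qed
  have "\<exists>c. \<forall>t\<in>T. \<forall>Z\<in>sets M. (\<forall>d\<in>D. \<forall>x. act d x \<in> Z \<longleftrightarrow> x \<in> Z) \<longrightarrow>
    \<bar>\<integral>x. indicator Z x * Gf t (\<sigma> t x) (c ((snd \<circ> snd) (\<sigma> t x))) \<partial>M\<bar> \<le> sqrt (card T * (1 / n + (card E)\<^sup>2 * \<delta>))"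
  proof (rule random_labels[OF fT fU n0, where D="\<lambda>_. D" and A="\<lambda>_. act"])
    show "measure M {x. (snd \<circ> snd) (\<sigma> t (act d x)) = (snd \<circ> snd) (\<sigma> t (act d' x))} \<le> (card E)\<^sup>2 * \<delta>"
      if "t \<in> T" "d \<in> D" "d' \<in> D" "d \<noteq> d'" for t d d' using lc[OF that(2-4)] by (simp add: \<sigma>_def)
  qed (use D d act_mp \<sigma> Gm G0 G1 in auto)
  then obtain c where c0: "\<forall>t\<in>T. \<forall>Z\<in>sets M. (\<forall>d\<in>D. \<forall>x. act d x \<in> Z \<longleftrightarrow> x \<in> Z) \<longrightarrow>
    \<bar>\<integral>x. indicator Z x * Gf t (\<sigma> t x) (c ((snd \<circ> snd) (\<sigma> t x))) \<partial>M\<bar> \<le> sqrt (card T * (1 / n + (card E)\<^sup>2 * \<delta>))"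
    by (elim exE) (rule that)
  have lab\<sigma>: "(snd \<circ> snd) (\<sigma> t x) = lab x" for t x by (simp add: \<sigma>_def)
  have c: "\<bar>\<integral>x. indicator Z x * Gf t (\<sigma> t x) (c (lab x)) \<partial>M\<bar> \<le> sqrt (card T * (1 / n + (card E)\<^sup>2 * \<delta>))"
    if "t \<in> T" "Z \<in> sets M" "\<forall>d\<in>D. \<forall>x. act d x \<in> Z \<longleftrightarrow> x \<in> Z" for t Z
    using c0[THEN bspec, OF that(1), THEN bspec, OF that(2), THEN mp, OF that(3)] unfolding lab\<sigma> .
  have "card T * (1 / n + (card E)\<^sup>2 * \<delta>) \<le> C * (\<epsilon>\<^sup>2 / (8 * C) + \<epsilon>\<^sup>2 / (8 * C))"
  proof (rule mult_mono)
    have "1 / n \<le> \<epsilon>\<^sup>2 / (8 * C)" using n n0 C e by (simp add: field_simps)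
    moreover have "(card E)\<^sup>2 * \<delta> \<le> (card E)\<^sup>2 * (\<epsilon>\<^sup>2 / (8 * C * (card E)\<^sup>2))" by (intro mult_left_mono) (auto simp: \<delta>_def)
    ultimately show "1 / n + (card E)\<^sup>2 * \<delta> \<le> \<epsilon>\<^sup>2 / (8 * C) + \<epsilon>\<^sup>2 / (8 * C)" using cE by simp
  qed (use C d in auto)
  also have "\<dots> = (\<epsilon> / 2)\<^sup>2" using C by (simp add: power2_eq_square)
  finally have sq: "sqrt (card T * (1 / n + (card E)\<^sup>2 * \<delta>)) \<le> \<epsilon> / 2" using e by (intro real_le_lsqrt) auto
  have cb': "measure M {x. ce (act h x) \<otimes> h \<noteq> ce x} \<le> \<epsilon> / 2" if "h \<in> K'" for h
  proof -
    have "(card F0)\<^sup>2 * \<delta> \<le> ((card F0)\<^sup>2 + 1) * (\<epsilon> / (4 * card K' * ((card F0)\<^sup>2 + 1)))"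
      using d by (intro mult_mono) (auto simp: \<delta>_def)
    also have "\<dots> = \<epsilon> / (4 * card K')"
    proof -
      have cancel: "w * (\<epsilon> / (v * w)) = \<epsilon> / v" if "w > 0" for v w :: real using that by simp
      show ?thesis unfolding of_nat_mult by (rule cancel) linarith
    qed
    finally have "card K' * (2 * \<epsilon>1 + (card F0)\<^sup>2 * \<delta>) \<le> card K' * (2 * \<epsilon>1 + \<epsilon> / (4 * card K'))" by (intro mult_left_mono) auto
    also have "\<dots> = \<epsilon> / 2" using K'(3) by (simp add: \<epsilon>1_def field_simps)
    finally show ?thesis using cb that by fastforce
  qed
  define \<phi> where "\<phi> x = P (\<beta> (inv (ce x)) (c (lab x)))" for x
  have \<phi>: "\<phi> \<in> M \<rightarrow>\<^sub>M count_space UNIV"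
  proof -
    have "{x. \<phi> x = a} \<in> sets M" for a
    proof -
      have "{x. \<phi> x = a} = (\<Union>g\<in>E. {x. ce x = g} \<inter> {x. P (\<beta> (inv g) (c (p (act g x)))) = a})"
        using ceE by (auto simp: \<phi>_def lab_def)
      also have "\<dots> \<in> sets M"
        using E cs count_space_pred_sets[OF pg, of _ "\<lambda>l. P (\<beta> (inv _) (c l)) = a"] by (intro sets.finite_UN sets.Int) auto
      finally show ?thesis .
    qed
    thus ?thesis by (simp add: measurable_count_space_eq_countable vimage_def space_UNIV)
  qed
  have \<phi>h: "(\<lambda>x. \<phi> (act h x)) \<in> M \<rightarrow>\<^sub>M count_space UNIV" if "h \<in> carrier G" for h
    using measurable_compose[OF mp_measurable[OF act_mp[OF that]] \<phi>] .
  have main: "\<bar>measure M {x\<in>Z. \<phi> x = i \<and> \<phi> (act h x) = j} - \<tau> h i j * measure M Z\<bar> \<le> \<epsilon>"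
    if h: "h \<in> K'" and ij: "i < k" "j < k" and Z: "Z \<in> sets M" "invariant Z" for h i j Z
  proof -
    have hG: "h \<in> carrier G" using h K' by auto
    define B where "B = {x. ce (act h x) \<otimes> h \<noteq> ce x}"
    have Bs: "B \<in> sets M"
    proof -
      have "B = (\<Union>a\<in>E. \<Union>b\<in>{b\<in>E. b \<otimes> h \<noteq> a}. {x. ce x = a} \<inter> {x. ce (act h x) = b})"
        using ceE by (auto simp: B_def)
      also have "\<dots> \<in> sets M" using E cs chs hG by (intro sets.finite_UN sets.Int) auto
      finally show ?thesis .
    qed
    let ?t = "(h, i, j)"
    have tT: "?t \<in> T" using h ij by (simp add: T_def)
    define f where "f x = of_bool (\<phi> x = i \<and> \<phi> (act h x) = j) - \<tau> h i j" for x
    define g where "g x = Gf ?t (\<sigma> ?t x) (c (lab x))" for x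
    \<comment> \<open>Outside B the points x and h x share the centre, hence its piece and its
      random point.\<close>
    have fg: "f x = g x" if "x \<notin> B" for x
    proof -
      have eq: "ce (act h x) \<otimes> h = ce x" using that by (simp add: B_def)
      have "lab (act h x) = p (act (ce (act h x) \<otimes> h) x)" using ceG hG by (simp add: lab_def act_mult)
      hence "lab (act h x) = lab x" using eq by (simp add: lab_def)
      thus ?thesis using eq by (simp add: f_def g_def Gf_def \<sigma>_def \<phi>_def)
    qed
    have gB: "g x = 0" if "x \<in> B" for x using that by (simp add: g_def Gf_def \<sigma>_def B_def)
    have f1: "\<bar>f x\<bar> \<le> 1" for x
      unfolding f_def by (rule abs_of_bool_diff_le) (auto simp: \<tau>_def)
    have Q: "{x. \<phi> x = i \<and> \<phi> (act h x) = j} \<in> sets M"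
      using count_space_rel_sets[OF \<phi> \<phi>h[OF hG], of "\<lambda>a b. a = i \<and> b = j"] .
    have fm: "f \<in> borel_measurable M"
    proof -
      have "f = (\<lambda>x. indicator {x. \<phi> x = i \<and> \<phi> (act h x) = j} x - \<tau> h i j)" by (auto simp: f_def indicator_def)
      thus ?thesis using Q by simp
    qed
    \<comment> \<open>The first part is controlled by the second-moment bound, the second by the
      measure of B; each is allowed \<epsilon> / 2.\<close>
    have split: "indicator Z x * f x = indicator Z x * g x + indicator Z x * indicator B x * f x" for x
      using fg gB by (cases "x \<in> B") auto
    have i1: "integrable M (\<lambda>x. indicator Z x * indicator B x * f x)"
      using Z Bs fm f1 by (intro bounded_integrable[where B=1]) (auto simp: indicator_def)
    have i0: "integrable M (\<lambda>x. indicator Z x * f x)"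
      using Z fm f1 by (intro bounded_integrable[where B=1]) (auto simp: indicator_def)
    have i2: "integrable M (\<lambda>x. indicator Z x * g x)"
    proof -
      have "(\<lambda>x. indicator Z x * g x) = (\<lambda>x. indicator Z x * f x - indicator Z x * indicator B x * f x)" using split by auto
      thus ?thesis using Bochner_Integration.integrable_diff[OF i0 i1] by simp
    qed
    have "(\<integral>x. indicator Z x * f x \<partial>M) = (\<integral>x. indicator Z x * g x \<partial>M) + (\<integral>x. indicator Z x * indicator B x * f x \<partial>M)"
      unfolding split using i1 i2 by (rule Bochner_Integration.integral_add[rotated])
    moreover have "\<bar>\<integral>x. indicator Z x * g x \<partial>M\<bar> \<le> \<epsilon> / 2"
    proof -
      have "\<forall>d\<in>D. \<forall>x. act d x \<in> Z \<longleftrightarrow> x \<in> Z" using Z(2) D(2) by (auto simp: invariant_def)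
      thus ?thesis using c[OF tT Z(1)] sq unfolding g_def by linarith
    qed
    moreover have "\<bar>\<integral>x. indicator Z x * indicator B x * f x \<partial>M\<bar> \<le> \<epsilon> / 2"
    proof -
      have "\<bar>\<integral>x. indicator Z x * indicator B x * f x \<partial>M\<bar> \<le> (\<integral>x. \<bar>indicator Z x * indicator B x * f x\<bar> \<partial>M)" by (rule integral_abs_bound)
      also have "\<dots> \<le> (\<integral>x. indicator B x \<partial>M)"
        using i1 Bs f1 by (intro integral_mono) (auto simp: indicator_def intro!: bounded_integrable[where B=1])
      finally show ?thesis using cb'[OF h] Bs by (simp add: B_def)
    qed
    moreover have "(\<integral>x. indicator Z x * f x \<partial>M) = measure M {x\<in>Z. \<phi> x = i \<and> \<phi> (act h x) = j} - \<tau> h i j * measure M Z"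
      unfolding f_def using Q Z(1) by (rule integral_of_bool_diff)
    ultimately show ?thesis by linarith
  qed
  have UM: "UNIV \<in> sets M" using sets.top[of M] by (simp add: space_UNIV)
  have U1: "measure M UNIV = 1" using prob_space by (simp add: space_UNIV)
  show ?thesis
  proof (intro exI[of _ \<phi>] conjI ballI allI impI)
    fix h i j assume "h \<in> K" "i < k" "j < k"
    thus "\<bar>measure M {x. \<phi> x = i \<and> \<phi> (act h x) = j} - measure M {x. P x = i \<and> P (\<beta> h x) = j}\<bar> \<le> \<epsilon>"
      using main[of h i j UNIV] UM U1 by (simp add: K'_def invariant_def \<tau>_def)
  next
    fix Z j assume Z: "Z \<in> sets M" "invariant Z" and j: "j < k"
    have "\<tau> \<one> j j = measure M {x. P x = j}" unfolding \<tau>_def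
      using \<beta>_one count_space_pred_sets[OF P(1)] count_space_rel_sets[OF P(1) P\<beta>[OF one_closed], of "\<lambda>a b. a = j \<and> b = j"]
      by (intro measure_eq_AE) (auto elim!: eventually_mono)
    thus "\<bar>measure M {x\<in>Z. \<phi> x = j} - measure M {x. P x = j} * measure M Z\<bar> \<le> \<epsilon>"
      using main[of \<one> j j Z] Z j by (simp add: K'_def act_one)
  qed (use \<phi> P in \<open>auto simp: \<phi>_def\<close>)
qed

end

section \<open>Extending homomorphisms to a free product\<close>

definition letters :: "'i set \<Rightarrow> ('i \<Rightarrow> 'g set) \<Rightarrow> ('i \<times> 'g) set" where
  "letters I H = {(i, h). i \<in> I \<and> h \<in> H i}"

definition word_map :: "('i \<Rightarrow> 'g \<Rightarrow> 'a \<Rightarrow> 'a) \<Rightarrow> ('i \<times> 'g) list \<Rightarrow> 'a \<Rightarrow> 'a" where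
  "word_map \<Gamma> w = foldr (\<lambda>l f. \<Gamma> (fst l) (snd l) \<circ> f) w id"

lemma word_map_simps [simp]:
  "word_map \<Gamma> [] = id" "word_map \<Gamma> (l # w) = \<Gamma> (fst l) (snd l) \<circ> word_map \<Gamma> w"
  by (simp_all add: word_map_def)

lemma word_map_append: "word_map \<Gamma> (u @ v) = word_map \<Gamma> u \<circ> word_map \<Gamma> v"
  by (induction u) (auto simp: comp_assoc)

lemma word_eval_simps [simp]:
  "word_eval G [] = \<one>\<^bsub>G\<^esub>" "word_eval G (l # w) = snd l \<otimes>\<^bsub>G\<^esub> word_eval G w"
  by (simp_all add: word_eval_def)

lemma all_nat_split: "(\<forall>k::nat. Q k) \<longleftrightarrow> Q 0 \<and> (\<forall>k. Q (Suc k))"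
  by (metis not0_implies_Suc)

lemma reduced_word_Cons:
  "reduced_word G I H (l # w) \<longleftrightarrow> fst l \<in> I \<and> snd l \<in> H (fst l) \<and> snd l \<noteq> \<one>\<^bsub>G\<^esub> \<and> reduced_word G I H w \<and>
    (w = [] \<or> fst l \<noteq> fst (hd w))"
  unfolding reduced_word_def
  by (subst all_nat_split) (cases w; cases l; auto)

text \<open>The setting of the universal property, with homomorphisms from the factors into the
  bijections of a set.\<close>

locale free_product = group G for G :: "('g, 'b) monoid_scheme" (structure) +
  fixes I :: "'i set" and H :: "'i \<Rightarrow> 'g set" and \<Gamma> :: "'i \<Rightarrow> 'g \<Rightarrow> 'a \<Rightarrow> 'a"
  assumes free_product: "is_free_product G I H"
    and \<Gamma>_bij: "i \<in> I \<Longrightarrow> h \<in> H i \<Longrightarrow> bij (\<Gamma> i h)"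
    and \<Gamma>_mult: "i \<in> I \<Longrightarrow> g \<in> H i \<Longrightarrow> h \<in> H i \<Longrightarrow> \<Gamma> i (g \<otimes> h) = \<Gamma> i g \<circ> \<Gamma> i h"
begin

abbreviation "word w \<equiv> set w \<subseteq> letters I H"

lemma H_subgroup: "i \<in> I \<Longrightarrow> subgroup (H i) G"
  using free_product by (auto simp: is_free_product_def)

lemma H_closed: "i \<in> I \<Longrightarrow> h \<in> H i \<Longrightarrow> h \<in> carrier G"
  using H_subgroup subgroup.mem_carrier by metis

lemma \<Gamma>_one: "i \<in> I \<Longrightarrow> \<Gamma> i \<one> = id"
proof -
  assume i: "i \<in> I"
  have o: "\<one> \<in> H i" using H_subgroup[OF i] by (rule subgroup.one_closed)
  have "\<Gamma> i \<one> (\<Gamma> i \<one> x) = \<Gamma> i \<one> x" for x using \<Gamma>_mult[OF i o o] by (metis comp_apply one_closed r_one)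
  hence "\<Gamma> i \<one> x = x" for x using bij_is_inj[OF \<Gamma>_bij[OF i o]] by (auto dest: injD)
  thus ?thesis by auto
qed

lemma word_eval_closed: "word w \<Longrightarrow> word_eval G w \<in> carrier G"
  by (induction w) (auto simp: letters_def H_closed)

lemma word_eval_append: "word u \<Longrightarrow> word v \<Longrightarrow> word_eval G (u @ v) = word_eval G u \<otimes> word_eval G v"
  by (induction u) (auto simp: letters_def H_closed m_assoc word_eval_closed)

lemma word_map_bij: "word w \<Longrightarrow> bij (word_map \<Gamma> w)"
  by (induction w) (auto simp: letters_def \<Gamma>_bij intro: bij_comp)

text \<open>Letters are put in front one by one; a letter from the factor of the current head is
  merged with the head, and trivial letters are dropped. Neither the product in G nor the composed
  map changes, because \<Gamma> is multiplicative on each factor.\<close>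

lemma reduce:
  "word w \<Longrightarrow> \<exists>v. reduced_word G I H v \<and> word_eval G v = word_eval G w \<and> word_map \<Gamma> v = word_map \<Gamma> w"
proof (induction w)
  case Nil
  show ?case by (intro exI[of _ "[]"]) (simp add: reduced_word_def)
next
  case (Cons l w)
  obtain i h where l: "l = (i, h)" by (cases l)
  have ih: "i \<in> I" "h \<in> H i" "h \<in> carrier G" and w: "word w" using Cons.prems l by (auto simp: letters_def H_closed)
  obtain v where v: "reduced_word G I H v" "word_eval G v = word_eval G w" "word_map \<Gamma> v = word_map \<Gamma> w"
    using Cons.IH w by blast
  show ?case
  proof (cases "h = \<one>")
    case True
    thus ?thesis using v l \<Gamma>_one ih word_eval_closed[OF w] by (intro exI[of _ v]) auto
  next
    case h: False
    show ?thesis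
    proof (cases "v = [] \<or> fst (hd v) \<noteq> i")
      case True
      thus ?thesis using v l ih h by (intro exI[of _ "l # v"]) (auto simp: reduced_word_Cons)
    next
      case False
      then obtain g u where vu: "v = (i, g) # u" by (cases v) auto
      hence g: "g \<in> H i" "g \<in> carrier G" and u: "reduced_word G I H u" "u = [] \<or> i \<noteq> fst (hd u)"
        using v(1) ih H_closed by (auto simp: reduced_word_Cons)
      have "word u" using u by (auto simp: reduced_word_def letters_def)
      hence ue: "word_eval G u \<in> carrier G" by (rule word_eval_closed)
      have hg: "h \<otimes> g \<in> H i" using ih g H_subgroup by (simp add: subgroup.m_closed)
      have e: "word_eval G (l # w) = (h \<otimes> g) \<otimes> word_eval G u"
        using v(2) vu l ih g ue by (simp add: m_assoc)
      have m: "word_map \<Gamma> (l # w) = \<Gamma> i (h \<otimes> g) \<circ> word_map \<Gamma> u"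
        using v(3) vu l \<Gamma>_mult[OF ih(1,2) g(1)] by (simp add: comp_assoc)
      show ?thesis
      proof (cases "h \<otimes> g = \<one>")
        case True
        thus ?thesis using e m u ue \<Gamma>_one[OF ih(1)] by (intro exI[of _ u]) auto
      next
        case False
        thus ?thesis using e m u ih hg by (intro exI[of _ "(i, h \<otimes> g) # u"]) (auto simp: reduced_word_Cons)
      qed
    qed
  qed
qed

definition inv_word :: "('i \<times> 'g) list \<Rightarrow> ('i \<times> 'g) list" where
  "inv_word w = rev (map (\<lambda>l. (fst l, inv (snd l))) w)"

lemma inv_word: "word w \<Longrightarrow> word (inv_word w)"
  using H_subgroup by (auto simp: inv_word_def letters_def subgroup.m_inv_closed)

lemma inv_word_eval: "word w \<Longrightarrow> word_eval G (inv_word w) \<otimes> word_eval G w = \<one>"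
  and inv_word_map: "word w \<Longrightarrow> word_map \<Gamma> (inv_word w) \<circ> word_map \<Gamma> w = id"
proof (induction w)
  case (Cons l w)
  {
    case 1
    obtain i h where l: "l = (i, h)" by (cases l)
    have w: "word w" and h: "i \<in> I" "h \<in> H i" "h \<in> carrier G" using 1 l by (auto simp: letters_def H_closed)
    have c: "word_eval G w \<in> carrier G" "word_eval G (inv_word w) \<in> carrier G"
      using word_eval_closed w inv_word by blast+
    have s: "word [(i, inv h)]" using h H_subgroup by (auto simp: letters_def subgroup.m_inv_closed)
    have "word_eval G (inv_word (l # w)) = word_eval G (inv_word w) \<otimes> inv h"
      using word_eval_append[OF inv_word[OF w] s] h by (simp add: inv_word_def l)
    moreover have "inv h \<otimes> (h \<otimes> word_eval G w) = word_eval G w" using h c by (simp add: m_assoc[symmetric])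
    ultimately show ?case using Cons.IH(1)[OF w] h c l by (simp add: m_assoc)
  next
    case 2
    obtain i h where l: "l = (i, h)" by (cases l)
    have w: "word w" and h: "i \<in> I" "h \<in> H i" "h \<in> carrier G" "inv h \<in> H i"
      using 2 l H_subgroup by (auto simp: letters_def H_closed subgroup.m_inv_closed)
    have "\<Gamma> i (inv h) \<circ> \<Gamma> i h = id" using \<Gamma>_mult[OF h(1,4,2)] h \<Gamma>_one by simp
    hence "\<Gamma> i (inv h) (\<Gamma> i h y) = y" for y by (metis comp_apply id_apply)
    moreover have "word_map \<Gamma> (inv_word (l # w)) = word_map \<Gamma> (inv_word w) \<circ> \<Gamma> i (inv h)"
      by (simp add: inv_word_def l word_map_append)
    ultimately show ?case using Cons.IH(2)[OF w] l by (simp add: fun_eq_iff)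
  }
qed (simp_all add: inv_word_def)

text \<open>The word formed by the inverse of v followed by u has product 1. Its reduced form is
  empty because the product is free, so its map is the identity.\<close>

lemma word_map_unique:
  assumes u: "word u" and v: "word v" and e: "word_eval G u = word_eval G v"
  shows "word_map \<Gamma> u = word_map \<Gamma> v"
proof -
  have wv: "word (inv_word v)" using v by (rule inv_word)
  have "word_eval G (inv_word v @ u) = \<one>" using word_eval_append[OF wv u] inv_word_eval[OF v] e by simp
  moreover obtain x where x: "reduced_word G I H x" "word_eval G x = word_eval G (inv_word v @ u)" "word_map \<Gamma> x = word_map \<Gamma> (inv_word v @ u)"
    using reduce[of "inv_word v @ u"] u wv by auto
  ultimately have "x = []" using free_product by (auto simp: is_free_product_def)
  hence "word_map \<Gamma> (inv_word v) \<circ> word_map \<Gamma> u = word_map \<Gamma> (inv_word v) \<circ> word_map \<Gamma> v"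
    using x(3) inv_word_map[OF v] by (simp add: word_map_append)
  moreover have "inj (word_map \<Gamma> (inv_word v))" using word_map_bij[OF wv] by (rule bij_is_inj)
  ultimately show ?thesis by (metis fun.inj_map_strong injD inj_eq comp_apply ext)
qed

lemma word_exists: "g \<in> carrier G \<Longrightarrow> \<exists>w. word w \<and> word_eval G w = g"
proof -
  assume "g \<in> carrier G"
  hence "g \<in> generate G (\<Union>i\<in>I. H i)" using free_product by (simp add: is_free_product_def)
  thus ?thesis
  proof induction
    case one
    show ?case by (intro exI[of _ "[]"]) simp
  next
    case (incl h)
    then obtain i where "i \<in> I" "h \<in> H i" by blast
    thus ?case using H_closed by (intro exI[of _ "[(i, h)]"]) (auto simp: letters_def)
  next
    case (inv h)
    then obtain i where "i \<in> I" "h \<in> H i" by blast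
    thus ?case using H_closed H_subgroup by (intro exI[of _ "[(i, inv h)]"]) (auto simp: letters_def subgroup.m_inv_closed)
  next
    case (eng g h)
    then obtain u v where "word u" "word_eval G u = g" "word v" "word_eval G v = h" by blast
    thus ?case using word_eval_append by (intro exI[of _ "u @ v"]) auto
  qed
qed

definition extension :: "'g \<Rightarrow> 'a \<Rightarrow> 'a" where
  "extension g = word_map \<Gamma> (SOME w. word w \<and> word_eval G w = g)"

lemma extension_word: "word w \<Longrightarrow> extension (word_eval G w) = word_map \<Gamma> w"
proof -
  assume w: "word w"
  have "word (SOME v. word v \<and> word_eval G v = word_eval G w) \<and>
    word_eval G (SOME v. word v \<and> word_eval G v = word_eval G w) = word_eval G w"
    by (rule someI[of _ w]) (simp add: w)
  thus ?thesis unfolding extension_def using w by (intro word_map_unique) auto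
qed

lemma extension_mult:
  assumes "g \<in> carrier G" "h \<in> carrier G"
  shows "extension (g \<otimes> h) = extension g \<circ> extension h"
proof -
  obtain u v where "word u" "word_eval G u = g" "word v" "word_eval G v = h" using word_exists assms by metis
  thus ?thesis using extension_word[of "u @ v"] extension_word[of u] extension_word[of v] word_eval_append
    by (auto simp: word_map_append)
qed

lemma extension_letter: "i \<in> I \<Longrightarrow> h \<in> H i \<Longrightarrow> extension h = \<Gamma> i h"
  using extension_word[of "[(i, h)]"] H_closed by (simp add: letters_def)

end

section \<open>The weak topology\<close>

context pmp
begin

section \<open>The group of automorphisms\<close>

lemma Aut_bij: "T \<in> Aut M \<Longrightarrow> bij T"
  by (simp add: Aut_def space_UNIV)

lemma Aut_mp: "T \<in> Aut M \<Longrightarrow> T \<in> mp"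
  by (simp add: Aut_def mp_def)

lemma Aut_image_eq:
  assumes T: "T \<in> Aut M"
  shows "T ` A = {x. the_inv_into UNIV T x \<in> A}"
proof (intro equalityI subsetI)
  fix x assume "x \<in> T ` A"
  thus "x \<in> {x. the_inv_into UNIV T x \<in> A}" using the_inv_into_f_f[of T UNIV] Aut_bij[OF T] by (auto simp: bij_def)
next
  fix x assume "x \<in> {x. the_inv_into UNIV T x \<in> A}"
  thus "x \<in> T ` A" using f_the_inv_into_f_bij_betw[OF Aut_bij[OF T], of x] by (metis UNIV_I image_eqI mem_Collect_eq)
qed

lemma Aut_image_sets: "T \<in> Aut M \<Longrightarrow> A \<in> sets M \<Longrightarrow> T ` A \<in> sets M"
  using measurable_sets[of "the_inv_into UNIV T" M M A] by (simp add: Aut_image_eq Aut_def space_UNIV vimage_def)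

lemma Aut_image_measure:
  assumes T: "T \<in> Aut M" and A: "A \<in> sets M"
  shows "measure M (T ` A) = measure M A"
proof -
  have "{x. T x \<in> T ` A} = A" using Aut_bij[OF T] by (auto simp: bij_def inj_def)
  thus ?thesis using mp_measure[OF Aut_mp[OF T] Aut_image_sets[OF T A]] by simp
qed

lemma Aut_comp:
  assumes S: "S \<in> Aut M" and T: "T \<in> Aut M"
  shows "S \<circ> T \<in> Aut M"
proof -
  have b: "bij (S \<circ> T)" using Aut_bij[OF S] Aut_bij[OF T] by (rule bij_comp[rotated])
  have i: "the_inv_into UNIV (S \<circ> T) x = the_inv_into UNIV T (the_inv_into UNIV S x)" for x
  proof -
    have "(S \<circ> T) (the_inv_into UNIV T (the_inv_into UNIV S x)) = x"
      using f_the_inv_into_f_bij_betw[OF Aut_bij[OF T]] f_the_inv_into_f_bij_betw[OF Aut_bij[OF S]] by simp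
    thus ?thesis using the_inv_into_f_f[of "S \<circ> T" UNIV] b by (metis UNIV_I bij_def)
  qed
  have m: "the_inv_into UNIV T \<in> M \<rightarrow>\<^sub>M M" "the_inv_into UNIV S \<in> M \<rightarrow>\<^sub>M M"
    using S T by (auto simp: Aut_def space_UNIV)
  have "the_inv_into UNIV (S \<circ> T) \<in> M \<rightarrow>\<^sub>M M"
    unfolding i[abs_def] using measurable_compose[OF m(2,1)] .
  moreover have "S \<circ> T \<in> mp" using mp_comp[OF Aut_mp[OF S] Aut_mp[OF T]] by (simp add: comp_def)
  ultimately show ?thesis using b by (auto simp: Aut_def mp_def space_UNIV)
qed

lemma Aut_inv:
  assumes T: "T \<in> Aut M"
  shows "the_inv_into UNIV T \<in> Aut M"
proof -
  let ?V = "the_inv_into UNIV T"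
  have b: "bij T" using T by (rule Aut_bij)
  have bV: "bij ?V" using bij_betw_the_inv_into[OF b] .
  have VT: "?V (T x) = x" for x using the_inv_into_f_f[of T UNIV x] b by (simp add: bij_def)
  have "the_inv_into UNIV ?V = T"
  proof
    fix x
    have "the_inv_into UNIV ?V (?V (T x)) = T x" using the_inv_into_f_f[of ?V UNIV "T x"] bV by (simp add: bij_def)
    thus "the_inv_into UNIV ?V x = T x" by (simp add: VT)
  qed
  moreover have m: "?V \<in> M \<rightarrow>\<^sub>M M" "T \<in> M \<rightarrow>\<^sub>M M" using T by (auto simp: Aut_def space_UNIV)
  moreover have "distr M M ?V = M"
  proof (rule measure_eqI)
    fix A assume "A \<in> sets (distr M M ?V)"
    hence A: "A \<in> sets M" by simp
    have "emeasure (distr M M ?V) A = emeasure M (T ` A)"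
      using A m by (simp add: emeasure_distr space_UNIV Aut_image_eq[OF T] vimage_def)
    thus "emeasure (distr M M ?V) A = emeasure M A" using Aut_image_measure[OF T A] by (simp add: emeasure_eq_measure)
  qed simp
  ultimately show ?thesis using bV by (simp add: Aut_def space_UNIV)
qed

lemma Aut_id: "id \<in> Aut M"
proof -
  have "the_inv_into UNIV (id :: 'a \<Rightarrow> 'a) = id" by (auto simp: the_inv_into_def)
  moreover have "distr M M id = M" unfolding id_def by (rule distr_id)
  ultimately show ?thesis by (simp add: Aut_def space_UNIV)
qed

section \<open>Neighbourhoods and density\<close>

lemma sym_diff_triangle:
  assumes "A \<in> sets M" "B \<in> sets M" "C \<in> sets M"
  shows "measure M (sym_diff A C) \<le> measure M (sym_diff A B) + measure M (sym_diff B C)"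
proof -
  have "measure M (sym_diff A C) \<le> measure M (sym_diff A B \<union> sym_diff B C)"
    using assms by (intro finite_measure_mono) auto
  also have "\<dots> \<le> measure M (sym_diff A B) + measure M (sym_diff B C)"
    using assms by (intro measure_Un_le) auto
  finally show ?thesis .
qed

lemma topspace_weak: "topspace (weak_topology M) = Aut M"
proof
  show "topspace (weak_topology M) \<subseteq> Aut M"
    by (auto simp: weak_topology_def topology_generated_by_topspace weak_nbhd_def)
  have "finite_borel_partition M {space M}" by (simp add: finite_borel_partition_def)
  hence "weak_nbhd M T 1 {space M} \<in> {weak_nbhd M S \<epsilon> P | S \<epsilon> P. S \<in> Aut M \<and> \<epsilon> > 0 \<and> finite_borel_partition M P}"
    if "T \<in> Aut M" for T using that by (intro CollectI exI conjI refl) auto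
  moreover have "T \<in> weak_nbhd M T 1 {space M}" if "T \<in> Aut M" for T using that by (simp add: weak_nbhd_def)
  ultimately show "Aut M \<subseteq> topspace (weak_topology M)"
    unfolding weak_topology_def topology_generated_by_topspace by (intro subsetI UnionI)
qed

text \<open>The subbasic sets have arbitrary centres S. As T satisfies finitely many strict
  inequalities, the room that is left passes to a neighbourhood centred at T by the triangle
  inequality.\<close>

lemma weak_nbhd_basis:
  assumes V: "openin (weak_topology M) V" and T: "T \<in> V"
  shows "\<exists>Q \<epsilon>. finite Q \<and> Q \<subseteq> sets M \<and> \<epsilon> > 0 \<and>
    (\<forall>R\<in>Aut M. (\<forall>A\<in>Q. measure M (sym_diff (R ` A) (T ` A)) < \<epsilon>) \<longrightarrow> R \<in> V)"
proof -
  have TA: "T \<in> Aut M" using openin_subset[OF V] T topspace_weak by auto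
  have "generate_topology_on {weak_nbhd M S \<epsilon> P | S \<epsilon> P. S \<in> Aut M \<and> \<epsilon> > 0 \<and> finite_borel_partition M P} V"
    using V by (simp add: weak_topology_def openin_topology_generated_by_iff)
  thus ?thesis using T
  proof induction
    case (Int U W)
    hence TU: "T \<in> U" and TW: "T \<in> W" by auto
    from Int.IH(1)[OF TU] obtain Q1 e1 where 1: "finite Q1" "Q1 \<subseteq> sets M" "e1 > (0::real)"
      "\<forall>R\<in>Aut M. (\<forall>A\<in>Q1. measure M (sym_diff (R ` A) (T ` A)) < e1) \<longrightarrow> R \<in> U" by (elim exE conjE) (rule that)
    from Int.IH(2)[OF TW] obtain Q2 e2 where 2: "finite Q2" "Q2 \<subseteq> sets M" "e2 > (0::real)"
      "\<forall>R\<in>Aut M. (\<forall>A\<in>Q2. measure M (sym_diff (R ` A) (T ` A)) < e2) \<longrightarrow> R \<in> W" by (elim exE conjE) (rule that)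
    show ?case using 1 2 by (intro exI[of _ "Q1 \<union> Q2"] exI[of _ "min e1 e2"]) auto
  next
    case (UN K)
    then obtain k where k: "k \<in> K" "T \<in> k" by blast
    from UN.IH[OF k] obtain Q e where "finite Q" "Q \<subseteq> sets M" "e > (0::real)"
      "\<forall>R\<in>Aut M. (\<forall>A\<in>Q. measure M (sym_diff (R ` A) (T ` A)) < e) \<longrightarrow> R \<in> k" by (elim exE conjE) (rule that)
    thus ?case using k(1) by (intro exI[of _ Q] exI[of _ e]) auto
  next
    case (Basis s)
    then obtain S \<epsilon> P where s: "s = weak_nbhd M S \<epsilon> P" "S \<in> Aut M" "\<epsilon> > 0" "finite P" "P \<subseteq> sets M"
      by (auto simp: finite_borel_partition_def)
    have T': "measure M (sym_diff (T ` p) (S ` p)) < \<epsilon>" if "p \<in> P" for p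
      using Basis.prems s(1) that by (auto simp: weak_nbhd_def)
    \<comment> \<open>The 1 keeps the minimum meaningful when P is empty.\<close>
    define \<delta> where "\<delta> = Min (insert 1 ((\<lambda>p. \<epsilon> - measure M (sym_diff (T ` p) (S ` p))) ` P))"
    have d: "\<delta> > 0" unfolding \<delta>_def using s(4) T' by (subst Min_gr_iff) auto
    have "R \<in> s" if R: "R \<in> Aut M" "\<forall>A\<in>P. measure M (sym_diff (R ` A) (T ` A)) < \<delta>" for R
    proof -
      have "measure M (sym_diff (R ` p) (S ` p)) < \<epsilon>" if p: "p \<in> P" for p
      proof -
        have "measure M (sym_diff (R ` p) (S ` p)) \<le> measure M (sym_diff (R ` p) (T ` p)) + measure M (sym_diff (T ` p) (S ` p))"
          using p s R TA by (intro sym_diff_triangle Aut_image_sets) auto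
        moreover have "\<delta> \<le> \<epsilon> - measure M (sym_diff (T ` p) (S ` p))" unfolding \<delta>_def using s(4) p by (intro Min_le) auto
        ultimately show ?thesis using R(2) p by fastforce
      qed
      thus ?thesis using R(1) by (simp add: s(1) weak_nbhd_def)
    qed
    thus ?case using s d by blast
  qed simp
qed

lemma topspace_actions: "topspace (actions_topology G M) = actions G M"
proof -
  have "actions G M \<subseteq> PiE (carrier G) (\<lambda>_. Aut M)" by (auto simp: actions_def PiE_def)
  thus ?thesis by (auto simp: actions_topology_def topspace_product_topology topspace_weak)
qed

text \<open>A basic open set of the product restricts finitely many coordinates only, and
  \<open>weak_nbhd_basis\<close> turns each restriction into finitely many measurable sets.\<close>

lemma dense_criterion:
  fixes C :: "('g \<Rightarrow> 'a \<Rightarrow> 'a) set"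
  assumes C: "C \<subseteq> actions G M"
    and dense: "\<And>\<beta> F Q \<epsilon>. \<beta> \<in> actions G M \<Longrightarrow> finite F \<Longrightarrow> F \<subseteq> carrier G \<Longrightarrow> finite Q \<Longrightarrow> Q \<subseteq> sets M \<Longrightarrow> \<epsilon> > 0 \<Longrightarrow>
      \<exists>\<gamma>\<in>C. \<forall>g\<in>F. \<forall>A\<in>Q. measure M (sym_diff (\<gamma> g ` A) (\<beta> g ` A)) < \<epsilon>"
  shows "(actions_topology G M) closure_of C = topspace (actions_topology G M)"
proof
  show "topspace (actions_topology G M) \<subseteq> actions_topology G M closure_of C"
  proof
    fix \<beta> assume b: "\<beta> \<in> topspace (actions_topology G M)"
    hence \<beta>: "\<beta> \<in> actions G M" by (simp add: topspace_actions)
    have "\<exists>\<gamma>\<in>C. \<gamma> \<in> T" if T: "\<beta> \<in> T" "openin (actions_topology G M) T" for T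
    proof -
      obtain U where U: "openin (product_topology (\<lambda>_. weak_topology M) (carrier G)) U" "T = U \<inter> actions G M"
        using T(2) by (auto simp: actions_topology_def openin_subtopology)
      have "\<beta> \<in> U" using T U by blast
      from U(1)[unfolded openin_product_topology_alt, THEN bspec, OF this] obtain W where W: "finite {g \<in> carrier G. W g \<noteq> topspace (weak_topology M)}"
        "\<forall>g\<in>carrier G. openin (weak_topology M) (W g)" "\<beta> \<in> PiE (carrier G) W" "PiE (carrier G) W \<subseteq> U"
        by (elim exE conjE) (rule that, auto)
      define F where "F = {g \<in> carrier G. W g \<noteq> topspace (weak_topology M)}"
      have "\<exists>Q \<epsilon>. finite Q \<and> Q \<subseteq> sets M \<and> \<epsilon> > 0 \<and>
        (\<forall>R\<in>Aut M. (\<forall>A\<in>Q. measure M (sym_diff (R ` A) (\<beta> g ` A)) < \<epsilon>) \<longrightarrow> R \<in> W g)" if "g \<in> F" for g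
        using that W by (intro weak_nbhd_basis) (auto simp: F_def PiE_def)
      then obtain Q \<epsilon> where Q: "\<And>g. g \<in> F \<Longrightarrow> finite (Q g) \<and> Q g \<subseteq> sets M \<and> \<epsilon> g > (0::real) \<and>
        (\<forall>R\<in>Aut M. (\<forall>A\<in>Q g. measure M (sym_diff (R ` A) (\<beta> g ` A)) < \<epsilon> g) \<longrightarrow> R \<in> W g)" by metis
      have fF: "finite F" "F \<subseteq> carrier G" using W(1) by (auto simp: F_def)
      define \<delta> where "\<delta> = Min (insert 1 (\<epsilon> ` F))"
      have d: "\<delta> > 0" unfolding \<delta>_def using fF Q by (subst Min_gr_iff) auto
      have "finite (\<Union>g\<in>F. Q g)" "(\<Union>g\<in>F. Q g) \<subseteq> sets M" using fF Q by auto
      then obtain \<gamma> where \<gamma>: "\<gamma> \<in> C" "\<forall>g\<in>F. \<forall>A\<in>(\<Union>g\<in>F. Q g). measure M (sym_diff (\<gamma> g ` A) (\<beta> g ` A)) < \<delta>"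
        using dense[OF \<beta> fF _ _ d] by blast
      have \<gamma>a: "\<gamma> \<in> actions G M" using \<gamma> C by blast
      have "\<gamma> g \<in> W g" if g: "g \<in> carrier G" for g
      proof (cases "g \<in> F")
        case True
        have "\<delta> \<le> \<epsilon> g" unfolding \<delta>_def using fF True by (intro Min_le) auto
        hence "\<forall>A\<in>Q g. measure M (sym_diff (\<gamma> g ` A) (\<beta> g ` A)) < \<epsilon> g" using \<gamma>(2) True by fastforce
        thus ?thesis using Q[OF True] \<gamma>a g by (auto simp: actions_def)
      next
        case False
        hence "W g = Aut M" using g by (simp add: F_def topspace_weak)
        thus ?thesis using \<gamma>a g by (auto simp: actions_def)
      qed
      hence "\<gamma> \<in> PiE (carrier G) W" using \<gamma>a by (auto simp: actions_def PiE_def)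
      hence "\<gamma> \<in> U" using W(4) by (rule rev_subsetD)
      thus ?thesis using U(2) \<gamma>(1) \<gamma>a by auto
    qed
    thus "\<beta> \<in> actions_topology G M closure_of C" using b by (auto simp: in_closure_of)
  qed
qed (rule closure_of_subset_topspace)

section \<open>Strict actions: reduction to generators and to labels\<close>

definition strict_action :: "('g, 'b) monoid_scheme \<Rightarrow> ('g \<Rightarrow> 'a \<Rightarrow> 'a) \<Rightarrow> bool" where
  "strict_action G \<gamma> \<longleftrightarrow> (\<forall>g\<in>carrier G. \<gamma> g \<in> Aut M) \<and>
     (\<forall>g\<in>carrier G. \<forall>h\<in>carrier G. \<gamma> (g \<otimes>\<^bsub>G\<^esub> h) = \<gamma> g \<circ> \<gamma> h)"

lemma strict_action_one:
  assumes "group G" "strict_action G \<gamma>"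
  shows "\<gamma> \<one>\<^bsub>G\<^esub> = id"
proof -
  interpret group G by fact
  have a: "\<gamma> \<one>\<^bsub>G\<^esub> \<in> Aut M" and "\<gamma> (\<one>\<^bsub>G\<^esub> \<otimes>\<^bsub>G\<^esub> \<one>\<^bsub>G\<^esub>) = \<gamma> \<one>\<^bsub>G\<^esub> \<circ> \<gamma> \<one>\<^bsub>G\<^esub>"
    using assms(2) one_closed unfolding strict_action_def by blast+
  hence "\<gamma> \<one>\<^bsub>G\<^esub> (\<gamma> \<one>\<^bsub>G\<^esub> x) = \<gamma> \<one>\<^bsub>G\<^esub> x" for x by (metis comp_apply one_closed r_one)
  thus ?thesis using bij_is_inj[OF Aut_bij[OF a]] by (auto simp: fun_eq_iff dest: injD)
qed

text \<open>For a product, \<gamma> g (\<gamma> h A) is close to \<gamma> g (\<beta> h A) because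
  \<gamma> g preserves the measure, and this is close to \<beta> g (\<beta> h A) by the closeness of
  \<gamma> g and \<beta> g on the set \<beta> h A. The test sets thus involve \<beta> only, which
  makes the choice uniform in \<gamma>.\<close>

lemma generators_suffice:
  assumes G: "group G" and \<beta>: "strict_action G \<beta>" and S: "S \<subseteq> carrier G" "\<And>s. s \<in> S \<Longrightarrow> inv\<^bsub>G\<^esub> s \<in> S"
    and g: "g \<in> generate G S" and A: "A \<in> sets M" and e: "\<epsilon> > 0"
  shows "\<exists>L Q \<delta>. finite L \<and> L \<subseteq> S \<and> finite Q \<and> Q \<subseteq> sets M \<and> \<delta> > 0 \<and>
    (\<forall>\<gamma>. strict_action G \<gamma> \<longrightarrow> (\<forall>h\<in>L. \<forall>B\<in>Q. measure M (sym_diff (\<gamma> h ` B) (\<beta> h ` B)) < \<delta>) \<longrightarrow>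
      measure M (sym_diff (\<gamma> g ` A) (\<beta> g ` A)) < \<epsilon>)"
  using g A e
proof (induction arbitrary: A \<epsilon>)
  case one
  have "\<gamma> \<one>\<^bsub>G\<^esub> = \<beta> \<one>\<^bsub>G\<^esub>" if "strict_action G \<gamma>" for \<gamma>
    using strict_action_one[OF G that] strict_action_one[OF G \<beta>] by simp
  thus ?case using one by (intro exI[of _ "{}"] exI[of _ 1]) auto
next
  case (incl h)
  thus ?case by (intro exI[of _ "{h}"] exI[of _ "{A}"] exI[of _ \<epsilon>]) auto
next
  case (inv h)
  thus ?case using S by (intro exI[of _ "{inv\<^bsub>G\<^esub> h}"] exI[of _ "{A}"] exI[of _ \<epsilon>]) auto
next
  case (eng g h)
  have gh: "g \<in> carrier G" "h \<in> carrier G" using eng.hyps group.generate_in_carrier[OF G S(1)] by auto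
  have \<beta>A: "\<beta> h ` A \<in> sets M" using \<beta> gh eng.prems by (intro Aut_image_sets) (auto simp: strict_action_def)
  have e2: "\<epsilon> / 2 > 0" using eng.prems by simp
  obtain L1 Q1 d1 where 1: "finite L1" "L1 \<subseteq> S" "finite Q1" "Q1 \<subseteq> sets M" "d1 > 0"
    "\<And>\<gamma>. strict_action G \<gamma> \<Longrightarrow> \<forall>h\<in>L1. \<forall>B\<in>Q1. measure M (sym_diff (\<gamma> h ` B) (\<beta> h ` B)) < d1 \<Longrightarrow>
      measure M (sym_diff (\<gamma> g ` \<beta> h ` A) (\<beta> g ` \<beta> h ` A)) < \<epsilon> / 2"
    using eng.IH(1)[OF \<beta>A e2] by blast
  obtain L2 Q2 d2 where 2: "finite L2" "L2 \<subseteq> S" "finite Q2" "Q2 \<subseteq> sets M" "d2 > 0"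
    "\<And>\<gamma>. strict_action G \<gamma> \<Longrightarrow> \<forall>h\<in>L2. \<forall>B\<in>Q2. measure M (sym_diff (\<gamma> h ` B) (\<beta> h ` B)) < d2 \<Longrightarrow>
      measure M (sym_diff (\<gamma> h ` A) (\<beta> h ` A)) < \<epsilon> / 2"
    using eng.IH(2)[OF eng.prems(1) e2] by blast
  have "measure M (sym_diff (\<gamma> (g \<otimes>\<^bsub>G\<^esub> h) ` A) (\<beta> (g \<otimes>\<^bsub>G\<^esub> h) ` A)) < \<epsilon>"
    if \<gamma>: "strict_action G \<gamma>" and close: "\<forall>h\<in>L1 \<union> L2. \<forall>B\<in>Q1 \<union> Q2. measure M (sym_diff (\<gamma> h ` B) (\<beta> h ` B)) < min d1 d2" for \<gamma>
  proof -
    have A: "\<gamma> g \<in> Aut M" "\<gamma> h \<in> Aut M" "\<beta> g \<in> Aut M" using \<gamma> \<beta> gh by (auto simp: strict_action_def)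
    have c1: "measure M (sym_diff (\<gamma> g ` \<beta> h ` A) (\<beta> g ` \<beta> h ` A)) < \<epsilon> / 2" using close by (intro 1(6) \<gamma>) auto
    have c2: "measure M (sym_diff (\<gamma> h ` A) (\<beta> h ` A)) < \<epsilon> / 2" using close by (intro 2(6) \<gamma>) auto
    have s: "\<gamma> h ` A \<in> sets M" using A eng.prems by (intro Aut_image_sets)
    have "sym_diff (\<gamma> g ` \<gamma> h ` A) (\<gamma> g ` \<beta> h ` A) = \<gamma> g ` sym_diff (\<gamma> h ` A) (\<beta> h ` A)"
      using bij_is_inj[OF Aut_bij[OF A(1)]] by (simp add: image_Un image_set_diff)
    hence "measure M (sym_diff (\<gamma> g ` \<gamma> h ` A) (\<gamma> g ` \<beta> h ` A)) < \<epsilon> / 2"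
      using Aut_image_measure[OF A(1), of "sym_diff (\<gamma> h ` A) (\<beta> h ` A)"] s \<beta>A c2 by simp
    moreover have "measure M (sym_diff (\<gamma> g ` \<gamma> h ` A) (\<beta> g ` \<beta> h ` A)) \<le>
      measure M (sym_diff (\<gamma> g ` \<gamma> h ` A) (\<gamma> g ` \<beta> h ` A)) + measure M (sym_diff (\<gamma> g ` \<beta> h ` A) (\<beta> g ` \<beta> h ` A))"
      by (intro sym_diff_triangle Aut_image_sets[OF A(1) s] Aut_image_sets[OF A(1) \<beta>A] Aut_image_sets[OF A(3) \<beta>A])
    moreover have "\<gamma> (g \<otimes>\<^bsub>G\<^esub> h) ` A = \<gamma> g ` \<gamma> h ` A" "\<beta> (g \<otimes>\<^bsub>G\<^esub> h) ` A = \<beta> g ` \<beta> h ` A"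
      using \<gamma> \<beta> gh by (auto simp: strict_action_def)
    ultimately show ?thesis using c1 by simp
  qed
  thus ?case using 1 2 by (intro exI[of _ "L1 \<union> L2"] exI[of _ "Q1 \<union> Q2"] exI[of _ "min d1 d2"]) auto
qed

text \<open>P numbers the atoms of the finite algebra generated by the family.\<close>

lemma labels_of_family:
  assumes "finite \<A>" "\<A> \<subseteq> sets M"
  shows "\<exists>P k. P \<in> M \<rightarrow>\<^sub>M count_space UNIV \<and> (\<forall>x. P x < (k::nat)) \<and> (\<forall>A\<in>\<A>. \<exists>a. A = {x. P x \<in> a})"
proof -
  obtain f where f: "bij_betw f (Pow \<A>) {0..<card (Pow \<A>)}" using ex_bij_betw_finite_nat[of "Pow \<A>"] assms by auto
  define P where "P x = f {A\<in>\<A>. x \<in> A}" for x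
  have inj: "inj_on f (Pow \<A>)" using f by (simp add: bij_betw_def)
  have lt: "P x < card (Pow \<A>)" for x using f unfolding P_def bij_betw_def by auto
  have "{x. P x = j} \<in> sets M" for j
  proof (cases "j \<in> f ` Pow \<A>")
    case True
    then obtain B where B: "B \<subseteq> \<A>" "j = f B" by auto
    have "P x = j \<longleftrightarrow> {A\<in>\<A>. x \<in> A} = B" for x
      unfolding P_def B(2) using inj B(1) by (subst inj_on_eq_iff[OF inj]) auto
    hence "{x. P x = j} = {x. {A\<in>\<A>. x \<in> A} = B}" by simp
    also have "\<dots> = (\<Inter>A\<in>\<A>. if A \<in> B then A else space M - A)"
      using B(1) by (auto simp: space_UNIV split: if_splits)
    also have "\<dots> \<in> sets M"
    proof (cases "\<A> = {}")
      case True
      thus ?thesis using sets.top[of M] by (simp add: space_UNIV)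
    next
      case False
      thus ?thesis using assms by (intro sets.finite_INT) auto
    qed
    finally show ?thesis .
  next
    case False
    hence "{x. P x = j} = {}" by (auto simp: P_def)
    thus ?thesis by simp
  qed
  hence "P \<in> M \<rightarrow>\<^sub>M count_space UNIV"
    by (simp add: measurable_count_space_eq_countable vimage_def space_UNIV)
  moreover have "\<exists>a. A = {x. P x \<in> a}" if "A \<in> \<A>" for A
  proof (intro exI[of _ "f ` {B \<in> Pow \<A>. A \<in> B}"] equalityI subsetI)
    fix x assume "x \<in> {x. P x \<in> f ` {B \<in> Pow \<A>. A \<in> B}}"
    then obtain B where "B \<in> Pow \<A>" "A \<in> B" "f {A\<in>\<A>. x \<in> A} = f B" by (auto simp: P_def)
    hence "{A\<in>\<A>. x \<in> A} = B" using inj by (auto dest!: inj_onD)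
    thus "x \<in> A" using \<open>A \<in> B\<close> by blast
  qed (use that in \<open>auto simp: P_def\<close>)
  ultimately show ?thesis using lt by blast
qed

text \<open>A point lies in the symmetric difference only through a pair of labels (i, j) with
  exactly one of i \<in> a and j \<in> b. No point has such a pair under T, so a one-sided
  comparison bounds each of these at most k^2 pairs by \<eta> under S.\<close>

lemma sym_diff_from_labels:
  fixes P :: "'a \<Rightarrow> nat"
  assumes S: "S \<in> Aut M" and T: "T \<in> Aut M" and P: "P \<in> M \<rightarrow>\<^sub>M count_space UNIV" "\<And>x. P x < k"
    and A: "A \<in> sets M" "A = {x. P x \<in> a}" and B: "T ` A = {x. P x \<in> b}"
    and close: "\<And>i j. i < k \<Longrightarrow> j < k \<Longrightarrow> measure M {x. P x = i \<and> P (S x) = j} \<le> measure M {x. P x = i \<and> P (T x) = j} + \<eta>"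
    and \<eta>: "\<eta> \<ge> 0"
  shows "measure M (sym_diff (S ` A) (T ` A)) \<le> (real k)\<^sup>2 * \<eta>"
proof -
  have bS: "bij S" and bT: "bij T" using S T Aut_bij by auto
  define J where "J = {(i, j) \<in> {..<k} \<times> {..<k}. (i \<in> a) \<noteq> (j \<in> b)}"
  have fJ: "finite J" unfolding J_def by (rule finite_subset[of _ "{..<k} \<times> {..<k}"]) auto
  have PS: "(\<lambda>x. P (S x)) \<in> M \<rightarrow>\<^sub>M count_space UNIV"
    using measurable_compose[OF mp_measurable[OF Aut_mp[OF S]] P(1)] .
  have s: "{x. P x = i \<and> P (S x) = j} \<in> sets M" for i j
  proof -
    have "{x. P x = i} \<in> sets M" "{x. P (S x) = j} \<in> sets M"
      using measurable_sets[OF P(1), of "{i}"] measurable_sets[OF PS, of "{j}"] by (auto simp: vimage_def space_UNIV)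
    hence "{x. P x = i} \<inter> {x. P (S x) = j} \<in> sets M" by blast
    thus ?thesis by (simp add: Collect_conj_eq)
  qed
  have "sym_diff (S ` A) (T ` A) = S ` {x. (P x \<in> a) \<noteq> (P (S x) \<in> b)}"
  proof (intro equalityI subsetI)
    fix y assume y: "y \<in> sym_diff (S ` A) (T ` A)"
    obtain x where x: "y = S x" using bS by (metis bij_pointE)
    have "S x \<in> S ` A \<longleftrightarrow> x \<in> A" using bS by (auto simp: bij_def inj_def)
    thus "y \<in> S ` {x. (P x \<in> a) \<noteq> (P (S x) \<in> b)}" using y x A(2) B by auto
  next
    fix y assume "y \<in> S ` {x. (P x \<in> a) \<noteq> (P (S x) \<in> b)}"
    then obtain x where x: "y = S x" "(P x \<in> a) \<noteq> (P (S x) \<in> b)" by blast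
    have "S x \<in> S ` A \<longleftrightarrow> x \<in> A" using bS by (auto simp: bij_def inj_def)
    thus "y \<in> sym_diff (S ` A) (T ` A)" using x A(2) B by auto
  qed
  also have "{x. (P x \<in> a) \<noteq> (P (S x) \<in> b)} = (\<Union>q\<in>J. {x. P x = fst q \<and> P (S x) = snd q})"
    using P(2) by (auto simp: J_def)
  finally have img: "sym_diff (S ` A) (T ` A) = S ` (\<Union>q\<in>J. {x. P x = fst q \<and> P (S x) = snd q})" .
  have "(\<Union>q\<in>J. {x. P x = fst q \<and> P (S x) = snd q}) \<in> sets M" using s fJ by (intro sets.finite_UN) auto
  hence "measure M (sym_diff (S ` A) (T ` A)) = measure M (\<Union>q\<in>J. {x. P x = fst q \<and> P (S x) = snd q})"
    unfolding img by (rule Aut_image_measure[OF S])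
  also have "\<dots> \<le> (\<Sum>q\<in>J. measure M {x. P x = fst q \<and> P (S x) = snd q})"
    using fJ s by (intro finite_measure_subadditive_finite) auto
  also have "\<dots> \<le> (\<Sum>q\<in>J. \<eta>)"
  proof (intro sum_mono)
    fix q assume "q \<in> J"
    hence q: "fst q < k" "snd q < k" "(fst q \<in> a) \<noteq> (snd q \<in> b)" by (auto simp: J_def)
    have "T x \<in> T ` A \<longleftrightarrow> x \<in> A" for x using bT by (auto simp: bij_def inj_def)
    hence e: "P (T x) \<in> b \<longleftrightarrow> P x \<in> a" for x using A(2) B by auto
    have "{x. P x = fst q \<and> P (T x) = snd q} = {}"
    proof (rule equals0I)
      fix x assume "x \<in> {x. P x = fst q \<and> P (T x) = snd q}"
      hence "P x = fst q" "P (T x) = snd q" by auto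
      thus False using e[of x] q(3) by simp
    qed
    hence "measure M {x. P x = fst q \<and> P (T x) = snd q} = 0" by (simp only: measure_empty)
    thus "measure M {x. P x = fst q \<and> P (S x) = snd q} \<le> \<eta>" using close[OF q(1,2)] by linarith
  qed
  also have "\<dots> = card J * \<eta>" by simp
  also have "\<dots> \<le> card ({..<k} \<times> {..<k}) * \<eta>" using \<eta> by (intro mult_right_mono of_nat_mono card_mono) (auto simp: J_def)
  finally show ?thesis by (simp add: card_cartesian_product power2_eq_square)
qed

end

section \<open>Approximation on the free factors\<close>

context pmp
begin

lemma Aut_inv_apply [simp]:
  assumes "T \<in> Aut M"
  shows "the_inv_into UNIV T (T x) = x" "T (the_inv_into UNIV T x) = x"
  using the_inv_into_f_f[of T UNIV x] f_the_inv_into_f_bij_betw[OF Aut_bij[OF assms], of x] Aut_bij[OF assms]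
  by (auto simp: bij_def)

lemma Aut_inv_inv:
  assumes T: "T \<in> Aut M"
  shows "the_inv_into UNIV (the_inv_into UNIV T) = T"
proof
  fix x
  show "the_inv_into UNIV (the_inv_into UNIV T) x = T x"
    using Aut_inv_apply(1)[OF Aut_inv[OF T], of "T x"] T by simp
qed

lemma AutI:
  assumes T: "T \<in> mp" and V: "V \<in> M \<rightarrow>\<^sub>M M" and VT: "\<And>x. V (T x) = x" and TV: "\<And>x. T (V x) = x"
  shows "T \<in> Aut M"
proof -
  have b: "bij T" by (rule bijI') (metis VT, metis TV)
  have "the_inv_into UNIV T = V"
  proof
    fix x show "the_inv_into UNIV T x = V x"
      using the_inv_into_f_f[of T UNIV "V x"] b TV by (simp add: bij_def)
  qed
  thus ?thesis using b T V by (simp add: Aut_def mp_def space_UNIV)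
qed

lemma Aut_sym_diff_null:
  assumes S: "S \<in> Aut M" and T: "T \<in> Aut M" and ae: "AE x in M. S x = T x" and A: "A \<in> sets M"
  shows "measure M (sym_diff (S ` A) (T ` A)) = 0"
proof -
  obtain N where N: "{x \<in> space M. S x \<noteq> T x} \<subseteq> N" "emeasure M N = 0" "N \<in> sets M" using ae by (auto elim!: AE_E)
  have sub: "sym_diff (S ` A) (T ` A) \<subseteq> S ` N \<union> T ` N"
  proof
    fix y assume "y \<in> sym_diff (S ` A) (T ` A)"
    then consider x where "x \<in> A" "y = S x" "y \<notin> T ` A" | x where "x \<in> A" "y = T x" "y \<notin> S ` A" by blast
    thus "y \<in> S ` N \<union> T ` N"
    proof cases
      case 1
      hence "S x \<noteq> T x" by auto
      hence "x \<in> N" using N(1) by (auto simp: space_UNIV)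
      thus ?thesis using 1 by blast
    next
      case 2
      hence "S x \<noteq> T x" by force
      hence "x \<in> N" using N(1) by (auto simp: space_UNIV)
      thus ?thesis using 2 by blast
    qed
  qed
  have m: "measure M (S ` N) = 0" "measure M (T ` N) = 0" "S ` N \<in> sets M" "T ` N \<in> sets M"
    using N Aut_image_measure[OF S, of N] Aut_image_measure[OF T, of N] Aut_image_sets[OF S, of N] Aut_image_sets[OF T, of N]
    by (auto simp: measure_def)
  have "measure M (sym_diff (S ` A) (T ` A)) \<le> measure M (S ` N \<union> T ` N)" using sub m by (intro finite_measure_mono) auto
  also have "\<dots> \<le> 0" using measure_Un_le[of "S ` N" M "T ` N"] m by simp
  finally show ?thesis by (simp add: measure_le_0_iff)
qed

text \<open>By countability all instances of the action law hold at once off a null set. On the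
  conull set of points whose whole orbit avoids this null set the action is kept; at all other
  points every group element acts as the identity.\<close>

lemma strictify:
  assumes G: "group G" and c: "countable (carrier G)" and \<alpha>: "\<alpha> \<in> actions G M"
  shows "\<exists>a. strict_action G a \<and> (\<forall>g\<in>carrier G. AE x in M. a g x = \<alpha> g x)"
proof -
  interpret group G by (rule G)
  have A: "\<alpha> g \<in> Aut M" if "g \<in> carrier G" for g using \<alpha> that by (auto simp: actions_def)
  have "AE x in M. \<forall>g\<in>carrier G. \<forall>h\<in>carrier G. \<alpha> (g \<otimes>\<^bsub>G\<^esub> h) x = \<alpha> g (\<alpha> h x)"
    using \<alpha> c by (simp add: AE_ball_countable actions_def)
  then obtain N where N: "{x \<in> space M. \<not> (\<forall>g\<in>carrier G. \<forall>h\<in>carrier G. \<alpha> (g \<otimes>\<^bsub>G\<^esub> h) x = \<alpha> g (\<alpha> h x))} \<subseteq> N"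
    "emeasure M N = 0" "N \<in> sets M" by (rule AE_E)
  define X0 where "X0 = space M - N"
  have X0m: "X0 \<in> sets M" using N by (simp add: X0_def)
  have X0: "\<alpha> (g \<otimes>\<^bsub>G\<^esub> h) x = \<alpha> g (\<alpha> h x)" if "x \<in> X0" "g \<in> carrier G" "h \<in> carrier G" for x g h
    using N(1) that by (auto simp: X0_def)
  have X0AE: "AE x in M. x \<in> X0" using N by (intro AE_I[of _ _ N]) (auto simp: X0_def)
  define X where "X = X0 \<inter> (\<Inter>g\<in>carrier G. {x. \<alpha> g x \<in> X0})"
  have ne: "carrier G \<noteq> {}" by auto
  have Xm: "X \<in> sets M" unfolding X_def
    using X0m mp_sets[OF Aut_mp[OF A]] c ne by (intro sets.Int sets.countable_INT') auto
  have XAE: "AE x in M. x \<in> X"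
  proof -
    have "AE x in M. \<forall>g\<in>carrier G. \<alpha> g x \<in> X0"
      using c mp_AE[OF Aut_mp[OF A] X0AE] by (simp add: AE_ball_countable)
    thus ?thesis using X0AE by eventually_elim (auto simp: X_def)
  qed
  have one: "\<alpha> \<one>\<^bsub>G\<^esub> x = x" if "x \<in> X0" for x
    using X0[OF that one_closed one_closed] bij_is_inj[OF Aut_bij[OF A[OF one_closed]]] by (simp add: inj_eq)
  have inX: "\<alpha> g x \<in> X" if "x \<in> X" "g \<in> carrier G" for g x
    using that X0[of x _ g] by (auto simp: X_def) (metis m_closed)
  define a where "a g x = (if x \<in> X then \<alpha> g x else x)" for g x
  have mult: "a (g \<otimes>\<^bsub>G\<^esub> h) x = a g (a h x)" if "g \<in> carrier G" "h \<in> carrier G" for g h x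
    using that inX X0[of x g h] by (auto simp: a_def X_def)
  have inv: "a (inv\<^bsub>G\<^esub> g) (a g x) = x" if "g \<in> carrier G" for g x
  proof -
    have "a \<one>\<^bsub>G\<^esub> x = x" using one[of x] by (simp add: a_def X_def)
    thus ?thesis using mult[of "inv\<^bsub>G\<^esub> g" g x] that by simp
  qed
  have ae: "AE x in M. a g x = \<alpha> g x" for g using XAE by eventually_elim (simp add: a_def)
  have meas: "a g \<in> M \<rightarrow>\<^sub>M M" if "g \<in> carrier G" for g
    unfolding a_def[abs_def] using mp_measurable[OF Aut_mp[OF A[OF that]]] Xm
    by (intro measurable_If) (auto simp: space_UNIV)
  have "a g \<in> mp" if g: "g \<in> carrier G" for g
  proof -
    have "distr M M (a g) = distr M M (\<alpha> g)"
      using meas[OF g] mp_measurable[OF Aut_mp[OF A[OF g]]] ae by (intro distr_cong_AE) auto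
    thus ?thesis using meas[OF g] Aut_mp[OF A[OF g]] by (simp add: mp_def)
  qed
  hence "a g \<in> Aut M" if "g \<in> carrier G" for g
    using that meas inv inv[of "inv\<^bsub>G\<^esub> g"] by (intro AutI[of _ "a (inv\<^bsub>G\<^esub> g)"]) auto
  hence "strict_action G a" using mult by (auto simp: strict_action_def fun_eq_iff)
  thus ?thesis using ae by blast
qed

end

lemma free_product_countable:
  assumes "group G" "is_free_product G I H" "countable I" "\<forall>i\<in>I. countable (H i)"
  shows "countable (carrier G)"
proof -
  \<comment> \<open>The trivial maps of a one-point set satisfy the locale, which makes
    \<open>word_exists\<close> available.\<close>
  interpret free_product G I H "\<lambda>_ _. id :: unit \<Rightarrow> unit"
    using assms by (auto simp: free_product_def free_product_axioms_def)
  have "letters I H = (SIGMA i:I. H i)" by (auto simp: letters_def)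
  hence "countable (letters I H)" using assms by auto
  hence "countable (lists (letters I H))" by (rule countable_lists)
  moreover have "carrier G \<subseteq> word_eval G ` lists (letters I H)"
    using word_exists by (auto simp: image_iff lists_eq_set)
  ultimately show ?thesis using countable_subset countable_image by metis
qed

context free_action
begin

lemma act_Aut: "g \<in> carrier G \<Longrightarrow> act g \<in> Aut M"
  using mp_measurable[OF act_mp] by (intro AutI[of _ "act (inv g)"]) (auto simp: act_mp)

text \<open>The transformations R i of the orbits of H i carry the common labelling
  q, hence the partition P pulled back by S, to labellings whose statistics
  under H i are those of \<beta>.\<close>

lemma letter_approximation:
  fixes H :: "'i \<Rightarrow> 'g set"
  assumes H: "\<And>i. i \<in> I \<Longrightarrow> subgroup (H i) G" "\<And>i. i \<in> I \<Longrightarrow> infinite (H i)" "\<And>i. i \<in> I \<Longrightarrow> countable (H i)"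
    and comm: "\<And>i x y. i \<in> I \<Longrightarrow> x \<in> H i \<Longrightarrow> y \<in> H i \<Longrightarrow> x \<otimes> y = y \<otimes> x"
    and \<beta>: "strict_action G \<beta>"
    and L: "finite L" "L \<subseteq> (\<Union>i\<in>I. H i)" and Q: "finite Q" "Q \<subseteq> sets M" and \<delta>: "\<delta> > 0"
  shows "\<exists>S R. S \<in> Aut M \<and> (\<forall>i\<in>I. R i \<in> Aut M \<and> (\<forall>x. \<exists>h\<in>H i. R i x = act h x)) \<and>
    (\<forall>h\<in>L. \<exists>i\<in>I. h \<in> H i \<and> (\<forall>A\<in>Q.
      measure M (sym_diff ((S \<circ> the_inv_into UNIV (R i) \<circ> act h \<circ> R i \<circ> the_inv_into UNIV S) ` A) (\<beta> h ` A)) < \<delta>))"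
proof -
  have "\<forall>h\<in>L. \<exists>i. i \<in> I \<and> h \<in> H i" using L by auto
  then obtain f where f: "\<And>h. h \<in> L \<Longrightarrow> f h \<in> I \<and> h \<in> H (f h)" by metis
  define I0 where "I0 = f ` L"
  have I0: "finite I0" "I0 \<subseteq> I" using L f by (auto simp: I0_def)
  have HG: "H i \<subseteq> carrier G" if "i \<in> I" for i using H(1)[OF that] by (rule subgroup.subset)
  have LG: "L \<subseteq> carrier G" using L HG by auto
  have \<beta>A: "\<beta> g \<in> Aut M" if "g \<in> carrier G" for g using \<beta> that by (simp add: strict_action_def)
  \<comment> \<open>P has to resolve the images under \<beta> h as well, since
    \<open>sym_diff_from_labels\<close> reads both sets from the labels.\<close>
  define \<A> where "\<A> = Q \<union> (\<lambda>(h, A). \<beta> h ` A) ` (L \<times> Q)"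
  have "\<A> \<subseteq> sets M" unfolding \<A>_def using Q LG Aut_image_sets[OF \<beta>A] by auto
  moreover have "finite \<A>" unfolding \<A>_def using Q L by auto
  ultimately obtain P k where P: "P \<in> M \<rightarrow>\<^sub>M count_space UNIV" "\<And>x. P x < (k::nat)" and lab: "\<forall>A\<in>\<A>. \<exists>a. A = {x. P x \<in> a}"
    using labels_of_family by metis
  \<comment> \<open>Each pair of labels will be off by \<eta> = \<epsilon> (1 + 2 k^2 + 4 k), and
    there are at most k^2 pairs. This choice gives (k^2 + 1) \<eta> = \<delta> / 2.\<close>
  define \<epsilon> where "\<epsilon> = \<delta> / (2 * ((real k)\<^sup>2 + 1) * (1 + 2 * (real k)\<^sup>2 + 4 * k))"
  have pos: "(real k)\<^sup>2 + 1 > 0" "1 + 2 * (real k)\<^sup>2 + real (4 * k) > 0" by (simp_all add: add_nonneg_pos add_pos_nonneg)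
  have e: "\<epsilon> > 0" unfolding \<epsilon>_def using \<delta> pos by (intro divide_pos_pos mult_pos_pos) auto
  have Ps: "{x. P x = j} \<in> sets M" "{x. P x \<le> j} \<in> sets M" for j using count_space_pred_sets[OF P(1)] by auto
  obtain q where q: "q \<in> M \<rightarrow>\<^sub>M count_space UNIV" "\<And>x. q x < k"
    and qZ: "\<And>i Z j. i \<in> I0 \<Longrightarrow> Z \<in> sets M \<Longrightarrow> (\<forall>h\<in>H i. \<forall>x. act h x \<in> Z \<longleftrightarrow> x \<in> Z) \<Longrightarrow> j < k \<Longrightarrow>
      \<bar>measure M {x\<in>Z. q x = j} - measure M {x. P x = j} * measure M Z\<bar> \<le> \<epsilon>"
  proof -
    have "\<And>i. i \<in> I0 \<Longrightarrow> H i \<subseteq> carrier G \<and> infinite (H i)" using I0 HG H by blast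
    hence "\<exists>q. q \<in> M \<rightarrow>\<^sub>M count_space UNIV \<and> (\<forall>x. q x < k) \<and>
      (\<forall>i\<in>I0. \<forall>Z\<in>sets M. (\<forall>h\<in>H i. \<forall>x. act h x \<in> Z \<longleftrightarrow> x \<in> Z) \<longrightarrow>
      (\<forall>j<k. \<bar>measure M {x\<in>Z. q x = j} - measure M {x. P x = j} * measure M Z\<bar> \<le> \<epsilon>))"
      by (rule independent_label[OF I0(1) _ P e])
    then obtain q where
      "q \<in> M \<rightarrow>\<^sub>M count_space UNIV \<and> (\<forall>x. q x < k) \<and>
      (\<forall>i\<in>I0. \<forall>Z\<in>sets M. (\<forall>h\<in>H i. \<forall>x. act h x \<in> Z \<longleftrightarrow> x \<in> Z) \<longrightarrow>
      (\<forall>j<k. \<bar>measure M {x\<in>Z. q x = j} - measure M {x. P x = j} * measure M Z\<bar> \<le> \<epsilon>))" by (elim exE)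
    thus ?thesis by (intro that[of q]) blast+
  qed
  have UM: "UNIV \<in> sets M" using sets.top[of M] by (simp add: space_UNIV)
  have U1: "measure M UNIV = 1" using prob_space by (simp add: space_UNIV)
  have qs: "{x. q x = j} \<in> sets M" for j using count_space_pred_sets[OF q(1)] by auto
  have loc: "\<exists>R \<phi>. R \<in> Aut M \<and> (\<forall>x. \<exists>h\<in>H i. R x = act h x) \<and> \<phi> \<in> M \<rightarrow>\<^sub>M count_space UNIV \<and>
      measure M {x. \<phi> (R x) \<noteq> q x} \<le> k * (2 * \<epsilon>) \<and>
      (\<forall>h\<in>L \<inter> H i. \<forall>m<k. \<forall>n<k. \<bar>measure M {x. \<phi> x = m \<and> \<phi> (act h x) = n} - measure M {x. P x = m \<and> P (\<beta> h x) = n}\<bar> \<le> \<epsilon>)"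
    if i: "i \<in> I0" for i
  proof -
    let ?G = "G\<lparr>carrier := H i\<rparr>"
    have iI: "i \<in> I" using i I0 by blast
    interpret Hi: group ?G using H(1)[OF iI] is_group by (rule subgroup.subgroup_is_group)
    have cG: "comm_group ?G" using comm[OF iI] by (intro Hi.group_comm_groupI) simp
    interpret Hi: free_action M ?G act
    proof
      show "act g \<in> mp" if "g \<in> carrier ?G" for g using that HG[OF iI] by (auto intro: act_mp)
      show "act (g \<otimes>\<^bsub>?G\<^esub> h) x = act g (act h x)" if "g \<in> carrier ?G" "h \<in> carrier ?G" for g h x
        using that HG[OF iI] by (auto intro: act_mult)
      show "AE x in M. act g x \<noteq> x" if "g \<in> carrier ?G" "g \<noteq> \<one>\<^bsub>?G\<^esub>" for g
        using that HG[OF iI] by (auto intro: free)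
    qed (simp add: act_one)
    have b1: "AE x in M. \<beta> \<one>\<^bsub>?G\<^esub> x = x" using strict_action_one[OF is_group \<beta>] by simp
    have b2: "AE x in M. \<beta> (g \<otimes>\<^bsub>?G\<^esub> h) x = \<beta> g (\<beta> h x)" if "g \<in> carrier ?G" "h \<in> carrier ?G" for g h
    proof -
      have "\<beta> (g \<otimes> h) = \<beta> g \<circ> \<beta> h" using \<beta> that HG[OF iI] by (auto simp: strict_action_def)
      thus ?thesis by simp
    qed
    have b3: "\<beta> g \<in> mp" if "g \<in> carrier ?G" for g using that HG[OF iI] \<beta>A by (auto intro: Aut_mp)
    have fin: "finite (L \<inter> H i)" "L \<inter> H i \<subseteq> carrier ?G" and inf: "infinite (carrier ?G)" using L H(2)[OF iI] by auto
    have "\<exists>\<phi>. \<phi> \<in> M \<rightarrow>\<^sub>M count_space UNIV \<and> (\<forall>x. \<phi> x < k) \<and>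
      (\<forall>h\<in>L \<inter> H i. \<forall>m<k. \<forall>n<k. \<bar>measure M {x. \<phi> x = m \<and> \<phi> (act h x) = n} - measure M {x. P x = m \<and> P (\<beta> h x) = n}\<bar> \<le> \<epsilon>) \<and>
      (\<forall>Z\<in>sets M. Hi.invariant Z \<longrightarrow> (\<forall>j<k. \<bar>measure M {x\<in>Z. \<phi> x = j} - measure M {x. P x = j} * measure M Z\<bar> \<le> \<epsilon>))"
      by (rule Hi.label_approximation[OF cG inf b3 b2 b1 fin P e])
    then obtain \<phi> where \<phi>: "\<phi> \<in> M \<rightarrow>\<^sub>M count_space UNIV" "\<And>x. \<phi> x < k"
      and st: "\<forall>h\<in>L \<inter> H i. \<forall>m<k. \<forall>n<k. \<bar>measure M {x. \<phi> x = m \<and> \<phi> (act h x) = n} - measure M {x. P x = m \<and> P (\<beta> h x) = n}\<bar> \<le> \<epsilon>"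
      and \<phi>Z: "\<forall>Z\<in>sets M. Hi.invariant Z \<longrightarrow> (\<forall>j<k. \<bar>measure M {x\<in>Z. \<phi> x = j} - measure M {x. P x = j} * measure M Z\<bar> \<le> \<epsilon>)"
      by (elim exE conjE) (rule that, auto)
    have "measure M {x\<in>Z. \<phi> x = j} - measure M {x\<in>Z. q x = j} \<le> 2 * \<epsilon>" if "j < k" "Z \<in> sets M" "Hi.invariant Z" for j Z
    proof -
      have "\<forall>h\<in>H i. \<forall>x. act h x \<in> Z \<longleftrightarrow> x \<in> Z" using that(3) by (simp add: Hi.invariant_def)
      hence "\<bar>measure M {x\<in>Z. q x = j} - measure M {x. P x = j} * measure M Z\<bar> \<le> \<epsilon>" using qZ[OF i that(2) _ that(1)] by blast
      moreover have "\<bar>measure M {x\<in>Z. \<phi> x = j} - measure M {x. P x = j} * measure M Z\<bar> \<le> \<epsilon>" using \<phi>Z that by blast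
      ultimately show ?thesis by linarith
    qed
    moreover have "countable (carrier ?G)" using H(3)[OF iI] by simp
    ultimately obtain R where "R \<in> Aut M" "\<forall>x. \<exists>g\<in>carrier ?G. R x = act g x" "measure M {x. \<phi> (R x) \<noteq> q x} \<le> k * (2 * \<epsilon>)"
      using Hi.exchange[OF _ q(1) \<phi>] by blast
    thus ?thesis using \<phi> st by (intro exI[of _ R] exI[of _ \<phi>]) auto
  qed
  show ?thesis
  proof (cases "L = {}")
    case True
    have "id x = act \<one> x" for x by (simp add: act_one)
    moreover have "\<one> \<in> H i" if "i \<in> I" for i using H(1)[OF that] by (rule subgroup.one_closed)
    ultimately have "\<forall>i\<in>I. id \<in> Aut M \<and> (\<forall>x. \<exists>h\<in>H i. id x = act h x)" using Aut_id by blast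
    thus ?thesis using True Aut_id by (intro exI[of _ id] exI[of _ "\<lambda>_. id"]) simp
  next
    case False
    \<comment> \<open>Some factor is needed to compare the distributions of q and P: the whole space
      is one of its invariant sets.\<close>
    then obtain i0 where i0: "i0 \<in> I0" by (auto simp: I0_def)
    have qP: "\<bar>measure M {x. P x = j} - measure M {x. q x = j}\<bar> \<le> \<epsilon>" if "j < k" for j
      using qZ[OF i0 UM _ that] U1 by (simp add: abs_minus_commute)
    have cum: "measure M {x. p x \<le> j} = (\<Sum>m\<le>j. measure M {x. p x = m})" if "\<And>m. {x. p x = m} \<in> sets M" for p :: "'a \<Rightarrow> nat" and j
    proof -
      have "{x. p x \<le> j} = (\<Union>m\<le>j. {x. p x = m})" by auto
      thus ?thesis using that finite_measure_finite_Union[of "{..j}" "\<lambda>m. {x. p x = m}"] by (auto simp: disjoint_family_on_def)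
    qed
    obtain S where S: "S \<in> Aut M" "measure M {x. P (S x) \<noteq> q x} \<le> (\<Sum>j<k. \<bar>measure M {x. P x \<le> j} - measure M {x. q x \<le> j}\<bar>)"
      using Aut_matching_labels[OF P q] by blast
    have "(\<Sum>j<k. \<bar>measure M {x. P x \<le> j} - measure M {x. q x \<le> j}\<bar>) \<le> (\<Sum>j<k. k * \<epsilon>)"
    proof (intro sum_mono)
      fix j assume j: "j \<in> {..<k}"
      have "\<bar>measure M {x. P x \<le> j} - measure M {x. q x \<le> j}\<bar> = \<bar>\<Sum>m\<le>j. measure M {x. P x = m} - measure M {x. q x = m}\<bar>"
        using cum[of P j] cum[of q j] Ps qs by (simp add: sum_subtractf)
      also have "\<dots> \<le> (\<Sum>m\<le>j. \<bar>measure M {x. P x = m} - measure M {x. q x = m}\<bar>)" by (rule sum_abs)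
      also have "\<dots> \<le> (\<Sum>m\<le>j. \<epsilon>)" using j qP by (intro sum_mono) auto
      also have "\<dots> \<le> k * \<epsilon>" using j e by (simp add: mult_right_mono)
      finally show "\<bar>measure M {x. P x \<le> j} - measure M {x. q x \<le> j}\<bar> \<le> k * \<epsilon>" .
    qed
    hence Sq: "measure M {x. P (S x) \<noteq> q x} \<le> (real k)\<^sup>2 * \<epsilon>" using S(2) by (simp add: power2_eq_square)
    define X where "X i R \<phi> \<longleftrightarrow> R \<in> Aut M \<and> (\<forall>x. \<exists>h\<in>H i. R x = act h x) \<and> \<phi> \<in> M \<rightarrow>\<^sub>M count_space UNIV \<and>
      measure M {x. \<phi> (R x) \<noteq> q x} \<le> k * (2 * \<epsilon>) \<and>
      (\<forall>h\<in>L \<inter> H i. \<forall>m<k. \<forall>n<k. \<bar>measure M {x. \<phi> x = m \<and> \<phi> (act h x) = n} - measure M {x. P x = m \<and> P (\<beta> h x) = n}\<bar> \<le> \<epsilon>)"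
      for i R \<phi>
    have "\<forall>i\<in>I0. \<exists>R \<phi>. X i R \<phi>" unfolding X_def using loc by (rule ballI)
    then obtain R \<phi> where X: "\<And>i. i \<in> I0 \<Longrightarrow> X i (R i) (\<phi> i)" by metis
    note X = X[unfolded X_def]
    have R: "R i \<in> Aut M" "\<exists>h\<in>H i. R i x = act h x" and \<phi>: "\<phi> i \<in> M \<rightarrow>\<^sub>M count_space UNIV"
      and R\<phi>: "measure M {x. \<phi> i (R i x) \<noteq> q x} \<le> k * (2 * \<epsilon>)" if "i \<in> I0" for i x
      using X[OF that] by auto
    have st: "\<bar>measure M {x. \<phi> i x = m \<and> \<phi> i (act h x) = n} - measure M {x. P x = m \<and> P (\<beta> h x) = n}\<bar> \<le> \<epsilon>"
      if "i \<in> I0" "h \<in> L \<inter> H i" "m < k" "n < k" for i h m n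
      using X[OF that(1)] that(2-4) by blast
    define R' where "R' i = (if i \<in> I0 then R i else id)" for i
    have R': "R' i \<in> Aut M \<and> (\<forall>x. \<exists>h\<in>H i. R' i x = act h x)" if "i \<in> I" for i
    proof (cases "i \<in> I0")
      case True
      thus ?thesis using R by (simp add: R'_def)
    next
      case False
      have "\<one> \<in> H i" using H(1)[OF that] by (rule subgroup.one_closed)
      hence "\<exists>h\<in>H i. x = act h x" for x using act_one[of x] by (intro bexI[of _ \<one>]) simp_all
      thus ?thesis using False Aut_id by (simp add: R'_def)
    qed
    have close: "measure M (sym_diff ((S \<circ> the_inv_into UNIV (R' i) \<circ> act h \<circ> R' i \<circ> the_inv_into UNIV S) ` A) (\<beta> h ` A)) < \<delta>"
      if h: "h \<in> L" and i: "i = f h" and A: "A \<in> Q" for h i A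
    proof -
      have iI0: "i \<in> I0" and hH: "h \<in> L \<inter> H i" and hG: "h \<in> carrier G" using h i f LG by (auto simp: I0_def)
      \<comment> \<open>W conjugates act h to \<gamma>, so the statistics of P under \<gamma> are
        those of P o W under act h. P o W is close to \<phi> i because P o S and \<phi> i o R i are
        both close to q.\<close>
      define W where "W x = S (the_inv_into UNIV (R i) x)" for x
      have RA: "R i \<in> Aut M" using R iI0 by blast
      have WA: "W \<in> Aut M" unfolding W_def[abs_def] using Aut_comp[OF S(1) Aut_inv[OF RA]] by (simp add: comp_def)
      define \<gamma> where "\<gamma> = S \<circ> the_inv_into UNIV (R' i) \<circ> act h \<circ> R' i \<circ> the_inv_into UNIV S"
      have \<gamma>A: "\<gamma> \<in> Aut M" unfolding \<gamma>_def R'_def using iI0 S(1) RA Aut_inv hG act_Aut by (auto intro!: Aut_comp)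
      have \<gamma>W: "\<gamma> (W x) = W (act h x)" for x using iI0 S(1) RA by (simp add: \<gamma>_def R'_def W_def)
      have PW: "(\<lambda>x. P (W x)) \<in> M \<rightarrow>\<^sub>M count_space UNIV"
        using measurable_compose[OF mp_measurable[OF Aut_mp[OF WA]] P(1)] .
      define D where "D = {x. P (W x) \<noteq> \<phi> i x}"
      have D: "D \<in> sets M" unfolding D_def using count_space_rel_sets[OF PW \<phi>[OF iI0], of "(\<noteq>)"] .
      have "measure M D = measure M {z. R i z \<in> D}" using mp_measure[OF Aut_mp[OF RA] D] by simp
      also have "{z. R i z \<in> D} = {z. P (S z) \<noteq> \<phi> i (R i z)}" using RA by (auto simp: D_def W_def)
      also have "measure M \<dots> \<le> measure M ({z. P (S z) \<noteq> q z} \<union> {z. \<phi> i (R i z) \<noteq> q z})"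
      proof (rule finite_measure_mono)
        have "{z. P (S z) \<noteq> q z} \<in> sets M"
          using count_space_rel_sets[OF measurable_compose[OF mp_measurable[OF Aut_mp[OF S(1)]] P(1)] q(1), of "(\<noteq>)"] .
        moreover have "{z. \<phi> i (R i z) \<noteq> q z} \<in> sets M"
          using count_space_rel_sets[OF measurable_compose[OF mp_measurable[OF Aut_mp[OF RA]] \<phi>[OF iI0]] q(1), of "(\<noteq>)"] .
        ultimately show "{z. P (S z) \<noteq> q z} \<union> {z. \<phi> i (R i z) \<noteq> q z} \<in> sets M" by blast
      qed auto
      also have "\<dots> \<le> measure M {z. P (S z) \<noteq> q z} + measure M {z. \<phi> i (R i z) \<noteq> q z}"
      proof (rule measure_Un_le)
        show "{z. P (S z) \<noteq> q z} \<in> sets M"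
          using count_space_rel_sets[OF measurable_compose[OF mp_measurable[OF Aut_mp[OF S(1)]] P(1)] q(1), of "(\<noteq>)"] .
        show "{z. \<phi> i (R i z) \<noteq> q z} \<in> sets M"
          using count_space_rel_sets[OF measurable_compose[OF mp_measurable[OF Aut_mp[OF RA]] \<phi>[OF iI0]] q(1), of "(\<noteq>)"] .
      qed
      also have "\<dots> \<le> (real k)\<^sup>2 * \<epsilon> + k * (2 * \<epsilon>)" using Sq R\<phi>[OF iI0] by linarith
      finally have mD: "measure M D \<le> (real k)\<^sup>2 * \<epsilon> + k * (2 * \<epsilon>)" .
      define \<eta> where "\<eta> = \<epsilon> * (1 + 2 * (real k)\<^sup>2 + 4 * k)"
      have cl: "measure M {x. P x = m \<and> P (\<gamma> x) = n} \<le> measure M {x. P x = m \<and> P (\<beta> h x) = n} + \<eta>" if mn: "m < k" "n < k" for m n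
      proof -
        have s1: "{x. P x = m \<and> P (\<gamma> x) = n} \<in> sets M"
          using count_space_rel_sets[OF P(1) measurable_compose[OF mp_measurable[OF Aut_mp[OF \<gamma>A]] P(1)], of "\<lambda>a b. a = m \<and> b = n"] .
        have s2: "{x. \<phi> i x = m \<and> \<phi> i (act h x) = n} \<in> sets M"
          using count_space_rel_sets[OF \<phi>[OF iI0] measurable_compose[OF mp_measurable[OF act_mp[OF hG]] \<phi>[OF iI0]], of "\<lambda>a b. a = m \<and> b = n"] .
        have s3: "{x. act h x \<in> D} \<in> sets M" "measure M {x. act h x \<in> D} = measure M D"
          using mp_sets[OF act_mp[OF hG] D] mp_measure[OF act_mp[OF hG] D] .
        have "measure M {x. P x = m \<and> P (\<gamma> x) = n} = measure M {x. W x \<in> {x. P x = m \<and> P (\<gamma> x) = n}}"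
          using mp_measure[OF Aut_mp[OF WA] s1] by simp
        also have "\<dots> \<le> measure M ({x. \<phi> i x = m \<and> \<phi> i (act h x) = n} \<union> (D \<union> {x. act h x \<in> D}))"
          using s2 s3 D by (intro finite_measure_mono) (auto simp: \<gamma>W D_def)
        also have "\<dots> \<le> measure M {x. \<phi> i x = m \<and> \<phi> i (act h x) = n} + measure M (D \<union> {x. act h x \<in> D})"
          using s2 s3 D by (intro measure_Un_le) auto
        also have "measure M (D \<union> {x. act h x \<in> D}) \<le> measure M D + measure M D"
          using measure_Un_le[OF D s3(1)] s3(2) by simp
        finally have "measure M {x. P x = m \<and> P (\<gamma> x) = n} \<le> measure M {x. \<phi> i x = m \<and> \<phi> i (act h x) = n} + 2 * measure M D" by simp
        also have "\<dots> \<le> (measure M {x. P x = m \<and> P (\<beta> h x) = n} + \<epsilon>) + 2 * ((real k)\<^sup>2 * \<epsilon> + k * (2 * \<epsilon>))"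
        proof (intro add_mono mult_left_mono mD)
          show "measure M {x. \<phi> i x = m \<and> \<phi> i (act h x) = n} \<le> measure M {x. P x = m \<and> P (\<beta> h x) = n} + \<epsilon>"
            using st[OF iI0 hH mn] by linarith
        qed simp
        also have "\<dots> = measure M {x. P x = m \<and> P (\<beta> h x) = n} + \<eta>" by (simp add: \<eta>_def algebra_simps)
        finally show ?thesis .
      qed
      have AA: "A \<in> \<A>" "\<beta> h ` A \<in> \<A>" "A \<in> sets M" using A h Q by (auto simp: \<A>_def)
      obtain a where a: "A = {x. P x \<in> a}" using lab AA(1) by blast
      obtain b where b: "\<beta> h ` A = {x. P x \<in> b}" using lab AA(2) by blast
      have \<eta>0: "\<eta> \<ge> 0" unfolding \<eta>_def using e pos by (intro mult_nonneg_nonneg) auto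
      have "measure M (sym_diff (\<gamma> ` A) (\<beta> h ` A)) \<le> (real k)\<^sup>2 * \<eta>"
        by (rule sym_diff_from_labels[OF \<gamma>A \<beta>A[OF hG] P AA(3) a b cl \<eta>0])
      also have "\<dots> \<le> ((real k)\<^sup>2 + 1) * \<eta>" using \<eta>0 by (intro mult_right_mono) auto
      also have "\<dots> = \<delta> / 2"
      proof -
        have cancel: "u * (\<delta> / (2 * u * v) * v) = \<delta> / 2" if "u > 0" "v > 0" for u v :: real using that by simp
        show ?thesis unfolding \<eta>_def \<epsilon>_def using pos by (rule cancel)
      qed
      also have "\<dots> < \<delta>" using \<delta> by simp
      finally show ?thesis unfolding \<gamma>_def .
    qed
    show ?thesis using S(1) R' close f by (intro exI[of _ S] exI[of _ R']) blast
  qed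
qed

end

section \<open>Density\<close>

text \<open>As R i moves points inside the orbits of H i, conjugating by it neither leaves these
  orbits nor misses a point of them. The group element that matches a given one varies with x; the
  induction over generators therefore follows each point separately.\<close>

lemma (in free_action) conjugate_orbits:
  assumes H: "\<And>i. i \<in> I \<Longrightarrow> subgroup (H i) G" and gen: "generate G (\<Union>i\<in>I. H i) = carrier G"
    and S: "S \<in> Aut M" and R: "\<And>i. i \<in> I \<Longrightarrow> R i \<in> Aut M" "\<And>i x. i \<in> I \<Longrightarrow> \<exists>h\<in>H i. R i x = act h x"
    and \<gamma>: "strict_action G \<gamma>"
    and \<gamma>H: "\<And>i h. i \<in> I \<Longrightarrow> h \<in> H i \<Longrightarrow> \<gamma> h = S \<circ> the_inv_into UNIV (R i) \<circ> act h \<circ> R i \<circ> the_inv_into UNIV S"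
  shows "(\<lambda>g. act g x) ` carrier G = (\<lambda>g. the_inv_into UNIV S (\<gamma> g (S x))) ` carrier G"
proof -
  define \<theta> where "\<theta> g x = the_inv_into UNIV S (\<gamma> g (S x))" for g x
  have HG: "h \<in> carrier G" if "i \<in> I" "h \<in> H i" for i h using H that subgroup.mem_carrier by metis
  have mult: "\<theta> (g \<otimes> h) x = \<theta> g (\<theta> h x)" if "g \<in> carrier G" "h \<in> carrier G" for g h x
    using \<gamma> that S by (simp add: \<theta>_def strict_action_def)
  have \<theta>_one: "\<theta> \<one> x = x" for x using strict_action_one[OF is_group \<gamma>] S by (simp add: \<theta>_def)
  have letter: "\<theta> h x = the_inv_into UNIV (R i) (act h (R i x))" if "i \<in> I" "h \<in> H i" for i h x
    using \<gamma>H[OF that] S by (simp add: \<theta>_def)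
  have 1: "\<exists>h'\<in>H i. \<theta> h x = act h' x" if i: "i \<in> I" and h: "h \<in> H i" for i h x
  proof -
    interpret K: subgroup "H i" G using H[OF i] .
    obtain k where k: "k \<in> H i" "R i x = act k x" using R(2)[OF i] by blast
    define y where "y = the_inv_into UNIV (R i) (act h (R i x))"
    obtain m where m: "m \<in> H i" "R i y = act m y" using R(2)[OF i] by blast
    have "act m y = act h (act k x)" using m(2) k(2) R(1)[OF i] by (simp add: y_def)
    hence "y = act (inv m) (act h (act k x))" using m HG[OF i] by (metis act_inv(1))
    also have "\<dots> = act (inv m \<otimes> h \<otimes> k) x" using m k h HG[OF i] by (simp add: act_mult)
    finally show ?thesis using m k h letter[OF i h] y_def by (intro bexI[of _ "inv m \<otimes> h \<otimes> k"]) auto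
  qed
  have 2: "\<exists>h'\<in>H i. act h x = \<theta> h' x" if i: "i \<in> I" and h: "h \<in> H i" for i h x
  proof -
    interpret K: subgroup "H i" G using H[OF i] .
    obtain k where k: "k \<in> H i" "R i x = act k x" using R(2)[OF i] by blast
    obtain m where m: "m \<in> H i" "R i (act h x) = act m (act h x)" using R(2)[OF i] by blast
    \<comment> \<open>This element takes R i x = act k x to act m (act h x), which is R i (act h
      x).\<close>
    have mem: "m \<otimes> h \<otimes> inv k \<in> H i" using m k h by simp
    have "act (m \<otimes> h \<otimes> inv k) (R i x) = R i (act h x)" using m k h HG[OF i] by (simp add: act_mult)
    hence "\<theta> (m \<otimes> h \<otimes> inv k) x = act h x" using letter[OF i mem] R(1)[OF i] by simp
    thus ?thesis using mem by metis
  qed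
  have H_inv: "inv h \<in> H i" if "i \<in> I" "h \<in> H i" for i h using H[OF that(1)] that(2) by (rule subgroup.m_inv_closed)
  have A: "\<forall>x. \<exists>g'\<in>carrier G. \<theta> g x = act g' x" if "g \<in> generate G (\<Union>i\<in>I. H i)" for g
    using that
  proof induction
    case one
    show ?case using \<theta>_one act_one by (intro allI bexI[of _ \<one>]) simp_all
  next
    case (incl h)
    thus ?case using 1 HG by blast
  next
    case (inv h)
    thus ?case using 1 HG H_inv by blast
  next
    case (eng g h)
    show ?case
    proof
      fix x
      obtain h' where h': "h' \<in> carrier G" "\<theta> h x = act h' x" using eng.IH(2) by blast
      obtain g' where g': "g' \<in> carrier G" "\<theta> g (act h' x) = act g' (act h' x)" using eng.IH(1) by blast
      show "\<exists>g'\<in>carrier G. \<theta> (g \<otimes> h) x = act g' x"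
        using eng.hyps gen h' g' mult act_mult by (intro bexI[of _ "g' \<otimes> h'"]) auto
    qed
  qed
  have B: "\<forall>x. \<exists>g'\<in>carrier G. act g x = \<theta> g' x" if "g \<in> generate G (\<Union>i\<in>I. H i)" for g
    using that
  proof induction
    case one
    show ?case using \<theta>_one act_one by (intro allI bexI[of _ \<one>]) simp_all
  next
    case (incl h)
    thus ?case using 2 HG by blast
  next
    case (inv h)
    thus ?case using 2 HG H_inv by blast
  next
    case (eng g h)
    show ?case
    proof
      fix x
      obtain h' where h': "h' \<in> carrier G" "act h x = \<theta> h' x" using eng.IH(2) by blast
      obtain g' where g': "g' \<in> carrier G" "act g (\<theta> h' x) = \<theta> g' (\<theta> h' x)" using eng.IH(1) by blast
      show "\<exists>g'\<in>carrier G. act (g \<otimes> h) x = \<theta> g' x"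
        using eng.hyps gen h' g' mult act_mult by (intro bexI[of _ "g' \<otimes> h'"]) auto
    qed
  qed
  have "(\<lambda>g. act g x) ` carrier G = (\<lambda>g. \<theta> g x) ` carrier G"
    using A B gen by (auto simp: image_iff)
  thus ?thesis by (simp add: \<theta>_def)
qed

theorem theorem1p3:
  fixes G :: "('g, 'b) monoid_scheme" and I :: "'i set" and H :: "'i \<Rightarrow> 'g set"
    and M :: "'a::polish_space measure" and \<alpha> :: "'g \<Rightarrow> 'a \<Rightarrow> 'a"
  assumes "group G"
    and "std_nonatomic_prob M"
    and "countable I"
    and "is_free_product G I H"
    and "\<forall>i\<in>I. countable (H i) \<and> infinite (H i)"
    and "\<forall>i\<in>I. \<forall>x\<in>H i. \<forall>y\<in>H i. x \<otimes>\<^bsub>G\<^esub> y = y \<otimes>\<^bsub>G\<^esub> x"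
    and "\<alpha> \<in> free_actions G M"
  shows "(actions_topology G M) closure_of (OE_class G M \<alpha>) = topspace (actions_topology G M)"
proof -
  interpret group G by fact
  have sM: "sets M = sets borel" and pM: "prob_space M" using assms(2) by (auto simp: std_nonatomic_prob_def)
  interpret std_nonatomic M
  proof (intro std_nonatomic.intro pmp.intro pmp_axioms.intro std_nonatomic_axioms.intro pM sM)
    show "space M = UNIV" using sets_eq_imp_space_eq[OF sM] by simp
  qed (use assms(2) in \<open>auto simp: std_nonatomic_prob_def\<close>)
  have cG: "countable (carrier G)" using assms(1,3-5) by (intro free_product_countable) auto
  have \<alpha>: "\<alpha> \<in> actions G M" "essentially_free G M \<alpha>" using assms(7) by (auto simp: free_actions_def)
  obtain a where a: "strict_action G a" and a\<alpha>: "\<forall>g\<in>carrier G. AE x in M. a g x = \<alpha> g x"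
    using strictify[OF assms(1) cG \<alpha>(1)] by blast
  interpret act: free_action M G a
  proof
    show "a g \<in> mp" if "g \<in> carrier G" for g using a that Aut_mp by (simp add: strict_action_def)
    show "a (g \<otimes>\<^bsub>G\<^esub> h) x = a g (a h x)" if "g \<in> carrier G" "h \<in> carrier G" for g h x
      using a that by (simp add: strict_action_def)
    show "a \<one>\<^bsub>G\<^esub> x = x" for x using strict_action_one[OF assms(1) a] by simp
    show "AE x in M. a g x \<noteq> x" if "g \<in> carrier G" "g \<noteq> \<one>\<^bsub>G\<^esub>" for g
    proof -
      have "AE x in M. \<alpha> g x \<noteq> x" "AE x in M. a g x = \<alpha> g x" using \<alpha>(2) a\<alpha> that by (auto simp: essentially_free_def)
      thus ?thesis by eventually_elim simp
    qed
  qed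
  have H: "subgroup (H i) G" if "i \<in> I" for i using assms(4) that by (auto simp: is_free_product_def)
  have gen: "generate G (\<Union>i\<in>I. H i) = carrier G" using assms(4) by (simp add: is_free_product_def)
  have HG: "(\<Union>i\<in>I. H i) \<subseteq> carrier G" using H subgroup.subset by blast
  have Hinv: "inv\<^bsub>G\<^esub> s \<in> (\<Union>i\<in>I. H i)" if "s \<in> (\<Union>i\<in>I. H i)" for s
    using that H subgroup.m_inv_closed by fast
  show ?thesis
  proof (rule dense_criterion)
    show "OE_class G M \<alpha> \<subseteq> actions G M" by (auto simp: OE_class_def)
    fix \<beta> F Q and \<epsilon> :: real
    assume \<beta>: "\<beta> \<in> actions G M" and F: "finite F" "F \<subseteq> carrier G" and Q: "finite Q" "Q \<subseteq> sets M" and e: "\<epsilon> > 0"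
    obtain b where b: "strict_action G b" and b\<beta>: "\<forall>g\<in>carrier G. AE x in M. b g x = \<beta> g x"
      using strictify[OF assms(1) cG \<beta>] by blast
    \<comment> \<open>For each pair of g in F and A in Q: the letters, test sets and tolerance that
      control the image of A under g. The finitely many choices are merged into L0, Q0 and
      \<delta>0.\<close>
    define good where "good q L Q' \<delta> \<longleftrightarrow> finite L \<and> L \<subseteq> (\<Union>i\<in>I. H i) \<and> finite Q' \<and> Q' \<subseteq> sets M \<and> \<delta> > 0 \<and>
      (\<forall>\<gamma>. strict_action G \<gamma> \<longrightarrow> (\<forall>h\<in>L. \<forall>B\<in>Q'. measure M (sym_diff (\<gamma> h ` B) (b h ` B)) < \<delta>) \<longrightarrow>
      measure M (sym_diff (\<gamma> (fst q) ` snd q) (b (fst q) ` snd q)) < \<epsilon>)" for q :: "'g \<times> 'a set" and L Q' and \<delta> :: real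
    have "\<forall>q\<in>F \<times> Q. \<exists>L Q' \<delta>. good q L Q' \<delta>"
    proof
      fix q assume q: "q \<in> F \<times> Q"
      have "fst q \<in> generate G (\<Union>i\<in>I. H i)" "snd q \<in> sets M" using q F Q gen by auto
      from generators_suffice[OF assms(1) b HG Hinv this e] show "\<exists>L Q' \<delta>. good q L Q' \<delta>" unfolding good_def .
    qed
    then obtain L Q' \<delta> where good: "\<And>q. q \<in> F \<times> Q \<Longrightarrow> good q (L q) (Q' q) (\<delta> q)" by metis
    note good = good[unfolded good_def]
    define L0 where "L0 = (\<Union>q\<in>F \<times> Q. L q)"
    define Q0 where "Q0 = (\<Union>q\<in>F \<times> Q. Q' q)"
    define \<delta>0 where "\<delta>0 = Min (insert 1 (\<delta> ` (F \<times> Q)))"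
    have fFQ: "finite (F \<times> Q)" using F Q by simp
    have gd: "finite (L q)" "L q \<subseteq> (\<Union>i\<in>I. H i)" "finite (Q' q)" "Q' q \<subseteq> sets M" "\<delta> q > 0" if "q \<in> F \<times> Q" for q
      using good[OF that] by simp_all
    have L0: "finite L0" "L0 \<subseteq> (\<Union>i\<in>I. H i)"
      unfolding L0_def by (rule finite_UN_I[OF fFQ gd(1)], assumption, rule UN_least[OF gd(2)])
    have Q0: "finite Q0" "Q0 \<subseteq> sets M"
      unfolding Q0_def by (rule finite_UN_I[OF fFQ gd(3)], assumption, rule UN_least[OF gd(4)])
    have \<delta>0: "\<delta>0 > 0" unfolding \<delta>0_def using fFQ gd(5) by (subst Min_gr_iff) auto
    have \<delta>0_le: "\<delta>0 \<le> \<delta> q" if "q \<in> F \<times> Q" for q unfolding \<delta>0_def using F Q that by (intro Min_le) auto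
    have "\<exists>S R. S \<in> Aut M \<and> (\<forall>i\<in>I. R i \<in> Aut M \<and> (\<forall>x. \<exists>h\<in>H i. R i x = a h x)) \<and>
      (\<forall>h\<in>L0. \<exists>i\<in>I. h \<in> H i \<and> (\<forall>A\<in>Q0.
        measure M (sym_diff ((S \<circ> the_inv_into UNIV (R i) \<circ> a h \<circ> R i \<circ> the_inv_into UNIV S) ` A) (b h ` A)) < \<delta>0))"
      using assms(5,6) by (intro act.letter_approximation H b L0 Q0 \<delta>0) auto
    then obtain S R where S: "S \<in> Aut M" and R0: "\<forall>i\<in>I. R i \<in> Aut M \<and> (\<forall>x. \<exists>h\<in>H i. R i x = a h x)"
      and close: "\<forall>h\<in>L0. \<exists>i\<in>I. h \<in> H i \<and> (\<forall>A\<in>Q0.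
        measure M (sym_diff ((S \<circ> the_inv_into UNIV (R i) \<circ> a h \<circ> R i \<circ> the_inv_into UNIV S) ` A) (b h ` A)) < \<delta>0)"
      by (elim exE conjE) (rule that)
    have R: "\<And>i. i \<in> I \<Longrightarrow> R i \<in> Aut M" "\<And>i x. i \<in> I \<Longrightarrow> \<exists>h\<in>H i. R i x = a h x" using R0 by auto
    define \<Gamma> where "\<Gamma> i h = S \<circ> the_inv_into UNIV (R i) \<circ> a h \<circ> R i \<circ> the_inv_into UNIV S" for i h
    have HGi: "h \<in> carrier G" if "i \<in> I" "h \<in> H i" for i h using HG that by blast
    have \<Gamma>A: "\<Gamma> i h \<in> Aut M" if "i \<in> I" "h \<in> H i" for i h
      unfolding \<Gamma>_def by (intro Aut_comp Aut_inv S R(1) act.act_Aut HGi[OF that] that(1))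
    interpret ext: free_product G I H \<Gamma>
    proof
      show "\<Gamma> i (g \<otimes>\<^bsub>G\<^esub> h) = \<Gamma> i g \<circ> \<Gamma> i h" if "i \<in> I" "g \<in> H i" "h \<in> H i" for i g h
        using that S R(1)[OF that(1)] HGi by (simp add: \<Gamma>_def fun_eq_iff act.act_mult)
    qed (use assms(4) \<Gamma>A Aut_bij in auto)
    define \<gamma> where "\<gamma> = ext.extension"
    have word_Aut: "word_map \<Gamma> w \<in> Aut M" if "set w \<subseteq> letters I H" for w
      using that by (induction w) (auto simp: letters_def Aut_id intro!: Aut_comp \<Gamma>A)
    have \<gamma>s: "strict_action G \<gamma>"
    proof -
      have "\<gamma> g \<in> Aut M" if "g \<in> carrier G" for g
        using ext.word_exists[OF that] ext.extension_word word_Aut unfolding \<gamma>_def by metis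
      thus ?thesis using ext.extension_mult by (simp add: strict_action_def \<gamma>_def)
    qed
    have \<gamma>H: "\<gamma> h = \<Gamma> i h" if "i \<in> I" "h \<in> H i" for i h using ext.extension_letter that by (simp add: \<gamma>_def)
    \<comment> \<open>Members of \<open>actions\<close> are extensional, whereas
      \<open>extension\<close> has no prescribed value outside the carrier.\<close>
    define \<gamma>' where "\<gamma>' = restrict \<gamma> (carrier G)"
    have \<gamma>': "\<gamma>' \<in> actions G M" using \<gamma>s by (auto simp: actions_def \<gamma>'_def strict_action_def)
    have orb: "(\<lambda>g. a g x) ` carrier G = (\<lambda>g. the_inv_into UNIV S (\<gamma> g (S x))) ` carrier G" for x
      using \<gamma>H by (intro act.conjugate_orbits[OF H gen S R \<gamma>s]) (auto simp: \<Gamma>_def)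
    have "orbit_equivalent G M \<alpha> \<gamma>'"
      unfolding orbit_equivalent_def
    \<comment> \<open>The conjugating map is the inverse of S, since \<open>orbit_equivalent\<close>
      carries the orbits of its second action to those of its first.\<close>
    proof (intro bexI[of _ "the_inv_into UNIV S"] Aut_inv S)
      have "AE x in M. \<forall>g\<in>carrier G. a g x = \<alpha> g x" using a\<alpha> cG by (simp add: AE_ball_countable)
      thus "AE x in M. (\<lambda>g. \<alpha> g x) ` carrier G =
        (\<lambda>g. the_inv_into UNIV S (\<gamma>' g (the_inv_into (space M) (the_inv_into UNIV S) x))) ` carrier G"
      proof eventually_elim
        case (elim x)
        have "(\<lambda>g. \<alpha> g x) ` carrier G = (\<lambda>g. a g x) ` carrier G" using elim by (auto simp: image_iff)
        thus ?case using orb[of x] by (simp add: space_UNIV Aut_inv_inv[OF S] \<gamma>'_def cong: image_cong)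
      qed
    qed
    hence "\<gamma>' \<in> OE_class G M \<alpha>" using \<gamma>' by (simp add: OE_class_def)
    moreover have "measure M (sym_diff (\<gamma>' g ` A) (\<beta> g ` A)) < \<epsilon>" if g: "g \<in> F" and A: "A \<in> Q" for g A
    proof -
      have gG: "g \<in> carrier G" and Am: "A \<in> sets M" using g F A Q by auto
      have Auts: "\<gamma> g \<in> Aut M" "b g \<in> Aut M" "\<beta> g \<in> Aut M"
        using \<gamma>s b \<beta> gG by (auto simp: strict_action_def actions_def)
      have q: "(g, A) \<in> F \<times> Q" using g A by simp
      have "\<forall>h\<in>L (g, A). \<forall>B\<in>Q' (g, A). measure M (sym_diff (\<gamma> h ` B) (b h ` B)) < \<delta> (g, A)"
      proof (intro ballI)
        fix h B assume h: "h \<in> L (g, A)" and B: "B \<in> Q' (g, A)"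
        have "h \<in> L0" "B \<in> Q0" using h B q by (auto simp: L0_def Q0_def)
        then obtain i where i: "i \<in> I" "h \<in> H i" "measure M (sym_diff (\<Gamma> i h ` B) (b h ` B)) < \<delta>0"
          using close[THEN bspec, of h] unfolding \<Gamma>_def by blast
        show "measure M (sym_diff (\<gamma> h ` B) (b h ` B)) < \<delta> (g, A)" using i(3) \<delta>0_le[OF q] \<gamma>H[OF i(1,2)] by simp
      qed
      hence "measure M (sym_diff (\<gamma> g ` A) (b g ` A)) < \<epsilon>" using good[OF q] \<gamma>s by simp
      moreover have "measure M (sym_diff (b g ` A) (\<beta> g ` A)) = 0"
        using b\<beta> gG by (intro Aut_sym_diff_null Auts Am) auto
      moreover have "measure M (sym_diff (\<gamma> g ` A) (\<beta> g ` A)) \<le> measure M (sym_diff (\<gamma> g ` A) (b g ` A)) + measure M (sym_diff (b g ` A) (\<beta> g ` A))"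
        by (intro sym_diff_triangle Aut_image_sets Auts Am)
      ultimately show ?thesis using gG by (simp add: \<gamma>'_def)
    qed
    ultimately show "\<exists>\<gamma>\<in>OE_class G M \<alpha>. \<forall>g\<in>F. \<forall>A\<in>Q. measure M (sym_diff (\<gamma> g ` A) (\<beta> g ` A)) < \<epsilon>" by blast
  qed
qed

end
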